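(* Let $(S^x_n)$ be the singular reflected quadrant walk with data $(p,h,v,q)$ (as defined in the context), and let $f_n(i,j)=\mathbf P(Z_{(i,j)}=n)$, where $Z_{(i,j)}$ is its number of boundary contacts. With $\widetilde v_1=\sum_{k,\ell}v_{k,\ell}\alpha_1^k\beta_0^\ell$, $\widetilde h_0=\sum_{k,\ell}h_{k,\ell}\alpha_0^k\beta_{-1}^\ell$, and the functions $S_0(z),S_1(z)$ (depending on $(i,j)$) defined in the context, for any $(i,j)\in\mathbb N_0^2\setminus\{(0,0)\}$ one has, as $n\to\infty$, $$f_n(i,j)\sim C_{i,j}\,\bigl(\max\{\widetilde v_1,\widetilde h_0\}\bigr)^n,$$ where $$C_{i,j}=\begin{cases}(1/\widetilde v_1-1)\,S_1(1/\widetilde v_1), & \widetilde v_1>\widetilde h_0,\\ (1/\widetilde v_1-1)\,[S_1(1/\widetilde v_1)+S_0(1/\widetilde v_1)], & \widetilde v_1=\widetilde h_0,\\ (1/\widetilde h_0-1)\,S_0(1/\widetilde h_0), & \widetilde v_1<\widetilde h_0.\end{cases}$$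
   Context: $\mathbb N=\{1,2,\dots\}$, $\mathbb N_0=\{0,1,2,\dots\}$. **Singular reflected quadrant walk with data $(p,h,v,q)$.** Let $\{p_{k,\ell}\},\{h_{k,\ell}\},\{v_{k,\ell}\},\{q_{k,\ell}\}$, indexed by $(k,\ell)\in\mathbb Z^2$, be non-negative weights such that: (1) each family sums to $1$; (2) $p_{k,\ell}=0$ whenever $k\le -2$ or $\ell\le -2$; (3) $p_{-1,-1}=p_{-1,0}=p_{0,-1}=0$; (4) $p_{-1,1}\,p_{1,-1}\ne 0$; (5) $p_{k,\ell}>0$ for some $(k,\ell)$ with $k+\ell>0$; (6) $\sum_{k,\ell}p_{k,\ell}e^{kx+\ell y}$ is finite in a neighborhood of every point of the curve $\mathcal L=\{(x,y)\in\mathbb R^2:\sum_{k,\ell}p_{k,\ell}e^{kx+\ell y}=1\}$; (7) $h_{k,\ell}=v_{k,\ell}=q_{k,\ell}=0$ whenever $k<0$ or $\ell<0$ or $(k,\ell)=(0,0)$; (8) $0<\sum\ell h_{k,\ell}<\infty$, $\sum k h_{k,\ell}<\infty$; $0<\sum k v_{k,\ell}<\infty$, $\sum\ell v_{k,\ell}<\infty$; $0<\sum k q_{k,\ell}<\infty$, $0<\sum\ell q_{k,\ell}<\infty$; (9) positive interior drift: $\sum k p_{k,\ell}>0$ and $\sum\ell p_{k,\ell}>0$. For $x\in\mathbb N_0^2$, $(S_n^x)_{n\ge0}$ is the Markov chain on $\mathbb N_0^2$ with $S_0^x=x$ whose increments are independent and distributed according to $p$ at points of $\mathbb N^2$, according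 to $h$ at points of $\mathbb N\times\{0\}$, according to $v$ at points of $\{0\}\times\mathbb N$, and according to $q$ at $(0,0)$. The number of boundary contacts is $Z_x=\sum_{n\ge0}\mathbf 1_{\{S_n^x\in\mathbb N_0^2\setminus\mathbb N^2\}}$. **The sequence $(\alpha_m,\beta_m)$.** Let $K(\alpha,\beta)=\sum_{k,\ell\ge -1}p_{k,\ell}\alpha^{k+1}\beta^{\ell+1}-\alpha\beta$. For $\alpha\in(0,1)$ let $u(\alpha)$ be the unique $\beta>\alpha$ with $K(\alpha,\beta)=0$; for $\beta\in(0,1)$ let $v(\beta)$ be the unique $\alpha>\beta$ with $K(\alpha,\beta)=0$; put $u(0)=v(0)=0$, $u(1)=v(1)=1$ (the function $v(\cdot)$ is not to be confused with the weights $v_{k,\ell}$). It is known that $u$ has a unique maximizer $\widehat\alpha\in(0,1)$ on $[0,1]$, with $\widehat\beta:=u(\widehat\alpha)>1$, and is strictly increasing on $[0,\widehat\alpha]$; likewise $v$ has a unique maximizer $\widetilde\beta\in(0,1)$, with $\widetilde\alpha:=v(\widetilde\beta)>1$, and is strictly increasing on $[0,\widetilde\beta]$. Let $u^*:[0,\widehat\beta]\to[0,\widehat\alpha]$ and $v^*:[0,\widetilde\alpha]\to[0,\widetilde\beta]$ be the inverses of these restrictions. Then $\alpha_0=\beta_0=1$; for $m\ge1$, $\alpha_m=u^*(\beta_{m-1})$, $\beta_m=v^*(\alpha_m)$; for $m\le -1$, $\beta_m=v^*(\alpha_{m+1})$, $\alpha_m=u^*(\beta_m)$. **The coefficients.**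 The rational functions $c_m,d_m$ ($m\in\mathbb Z$) are determined by $c_0(z)=1$ and, for all $m\in\mathbb Z$, $$d_{m+1}(z)=-c_m(z)\frac{1-z\sum_{k,\ell}v_{k,\ell}\alpha_m^k\beta_m^\ell}{1-z\sum_{k,\ell}v_{k,\ell}\alpha_{m+1}^k\beta_m^\ell},\qquad c_m(z)=-d_m(z)\frac{1-z\sum_{k,\ell}h_{k,\ell}\alpha_m^k\beta_{m-1}^\ell}{1-z\sum_{k,\ell}h_{k,\ell}\alpha_m^k\beta_m^\ell}$$ (used forwards for positive indices and solved backwards from $c_0=1$ for $d_0,c_{-1},d_{-1},\dots$). **The functions $S_1,S_0$.** For fixed $(i,j)$, $$S_1(z)=\sum_{m\ge1}\Bigl(\frac{d_m(z)}{d_1(z)}\alpha_m^i\beta_{m-1}^j+\frac{c_m(z)}{d_1(z)}\alpha_m^i\beta_m^j\Bigr),\qquad S_0(z)=\sum_{m\le0}\Bigl(\frac{d_m(z)}{d_0(z)}\alpha_m^i\beta_{m-1}^j+\frac{c_{m-1}(z)}{d_0(z)}\alpha_{m-1}^i\beta_{m-1}^j\Bigr),$$ where the quotients $d_m/d_1$, $c_m/d_1$, $d_m/d_0$, $c_{m-1}/d_0$ are taken as quotients of rational functions (after cancellation). *)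

theory Defs
  imports
    "HOL-Probability.Probability"
    "HOL-Computational_Algebra.Computational_Algebra"
    "HOL-Computational_Algebra.Field_as_Ring"
    "HOL-Library.Landau_Symbols"
begin

text \<open>A family of non-negative weights on \<open>\<int>\<^sup>2\<close> with total mass \<open>1\<close> is a pmf on \<open>int \<times> int\<close>.\<close>

type_synonym weights = "(int \<times> int) pmf"

locale singular_reflected_data =
  fixes p h v q :: weights
  assumes p_small_jumps: "\<And>k l. k \<le> -2 \<or> l \<le> -2 \<Longrightarrow> pmf p (k, l) = 0"
    and p_singular: "pmf p (-1, -1) = 0" "pmf p (-1, 0) = 0" "pmf p (0, -1) = 0"
    and p_nondegenerate: "pmf p (-1, 1) * pmf p (1, -1) \<noteq> 0"
    and p_forward: "\<exists>k l. k + l > 0 \<and> pmf p (k, l) > 0"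
    and p_finite_near_curve:
      "\<And>x y. ((\<lambda>(k, l). pmf p (k, l) * exp (of_int k * x + of_int l * y)) has_sum 1) UNIV \<Longrightarrow>
         \<forall>\<^sub>F (x', y') in nhds (x, y).
           (\<lambda>(k, l). pmf p (k, l) * exp (of_int k * x' + of_int l * y')) summable_on UNIV"
    and reflection_support:
      "\<And>w k l. w \<in> {h, v, q} \<Longrightarrow> k < 0 \<or> l < 0 \<or> (k, l) = (0, 0) \<Longrightarrow> pmf w (k, l) = 0"
    and reflection_finite_means:
      "\<And>w. w \<in> {h, v, q} \<Longrightarrow> (\<lambda>(k, l). of_int k * pmf w (k, l)) summable_on UNIV"
      "\<And>w. w \<in> {h, v, q} \<Longrightarrow> (\<lambda>(k, l). of_int l * pmf w (k, l)) summable_on UNIV"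
    and h_drift: "(\<Sum>\<^sub>\<infinity>(k, l). of_int l * pmf h (k, l)) > 0"
    and v_drift: "(\<Sum>\<^sub>\<infinity>(k, l). of_int k * pmf v (k, l)) > 0"
    and q_drift: "(\<Sum>\<^sub>\<infinity>(k, l). of_int k * pmf q (k, l)) > 0"
      "(\<Sum>\<^sub>\<infinity>(k, l). of_int l * pmf q (k, l)) > 0"
    and p_drift: "(\<Sum>\<^sub>\<infinity>(k, l). of_int k * pmf p (k, l)) > 0"
      "(\<Sum>\<^sub>\<infinity>(k, l). of_int l * pmf p (k, l)) > 0"

definition increment_law ::
    "weights \<Rightarrow> weights \<Rightarrow> weights \<Rightarrow> weights \<Rightarrow> nat \<times> nat \<Rightarrow> weights" where
  "increment_law p h v q s =
    (if fst s > 0 \<and> snd s > 0 then p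
     else if fst s > 0 then h
     else if snd s > 0 then v
     else q)"

definition displacement :: "nat \<times> nat \<Rightarrow> nat \<times> nat \<Rightarrow> int \<times> int" where
  "displacement s t = (int (fst t) - int (fst s), int (snd t) - int (snd s))"

text \<open>The process \<open>S\<close> on the probability space \<open>M\<close> is a Markov chain started in \<open>x\<close>: given any
  history of positive probability, the next increment has the law attached to the current state.\<close>

definition reflected_walk ::
    "weights \<Rightarrow> weights \<Rightarrow> weights \<Rightarrow> weights \<Rightarrow> 'w measure \<Rightarrow> nat \<times> nat \<Rightarrow>
      (nat \<Rightarrow> 'w \<Rightarrow> nat \<times> nat) \<Rightarrow> bool" where
  "reflected_walk p h v q M x S \<longleftrightarrow>
    prob_space M \<and>
    (\<forall>n. S n \<in> measurable M (count_space UNIV)) \<and>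
    (\<forall>\<omega>\<in>space M. S 0 \<omega> = x) \<and>
    (\<forall>n s e. \<P>(\<omega> in M. \<forall>k\<le>n. S k \<omega> = s k) > 0 \<longrightarrow>
       \<P>(\<omega> in M. displacement (S n \<omega>) (S (Suc n) \<omega>) = e \<bar> \<forall>k\<le>n. S k \<omega> = s k)
         = pmf (increment_law p h v q (s n)) e)"

definition boundary_contacts :: "(nat \<Rightarrow> 'w \<Rightarrow> nat \<times> nat) \<Rightarrow> 'w \<Rightarrow> ennreal" where
  "boundary_contacts S \<omega> = (\<Sum>n. indicator (UNIV - {0<..} \<times> {0<..}) (S n \<omega>))"

text \<open>If the series diverges, \<open>infsum\<close> returns \<open>0\<close>; the kernel is then \<open>- \<alpha> * \<beta>\<close>, so that
  divergence creates no zeros of the kernel with \<open>\<alpha>, \<beta> > 0\<close>.\<close>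

definition kernel :: "weights \<Rightarrow> real \<Rightarrow> real \<Rightarrow> real" where
  "kernel p \<alpha> \<beta> =
    (\<Sum>\<^sub>\<infinity>(k, l)\<in>{-1..} \<times> {-1..}. pmf p (k, l) * \<alpha> powi (k + 1) * \<beta> powi (l + 1)) - \<alpha> * \<beta>"

definition u_fun :: "weights \<Rightarrow> real \<Rightarrow> real" where
  "u_fun p \<alpha> = (if \<alpha> = 0 then 0 else if \<alpha> = 1 then 1
     else (THE \<beta>. \<beta> > \<alpha> \<and> kernel p \<alpha> \<beta> = 0))"

definition v_fun :: "weights \<Rightarrow> real \<Rightarrow> real" where
  "v_fun p \<beta> = (if \<beta> = 0 then 0 else if \<beta> = 1 then 1
     else (THE \<alpha>. \<alpha> > \<beta> \<and> kernel p \<alpha> \<beta> = 0))"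

definition alpha_hat :: "weights \<Rightarrow> real" where
  "alpha_hat p = arg_max_on (u_fun p) {0..1}"

definition beta_tilde :: "weights \<Rightarrow> real" where
  "beta_tilde p = arg_max_on (v_fun p) {0..1}"

definition u_star :: "weights \<Rightarrow> real \<Rightarrow> real" where
  "u_star p = inv_into {0..alpha_hat p} (u_fun p)"

definition v_star :: "weights \<Rightarrow> real \<Rightarrow> real" where
  "v_star p = inv_into {0..beta_tilde p} (v_fun p)"

primrec ab_fwd :: "weights \<Rightarrow> nat \<Rightarrow> real \<times> real" where
  "ab_fwd p 0 = (1, 1)"
| "ab_fwd p (Suc n) = (let \<alpha> = u_star p (snd (ab_fwd p n)) in (\<alpha>, v_star p \<alpha>))"

primrec ab_bwd :: "weights \<Rightarrow> nat \<Rightarrow> real \<times> real" where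
  "ab_bwd p 0 = (1, 1)"
| "ab_bwd p (Suc n) = (let \<beta> = v_star p (fst (ab_bwd p n)) in (u_star p \<beta>, \<beta>))"

definition alpha :: "weights \<Rightarrow> int \<Rightarrow> real" where
  "alpha p m = (if m \<ge> 0 then fst (ab_fwd p (nat m)) else fst (ab_bwd p (nat (- m))))"

definition beta :: "weights \<Rightarrow> int \<Rightarrow> real" where
  "beta p m = (if m \<ge> 0 then snd (ab_fwd p (nat m)) else snd (ab_bwd p (nat (- m))))"

lemma alpha_beta_0: "alpha p 0 = 1" "beta p 0 = 1"
  by (simp_all add: alpha_def beta_def)

lemma alpha_beta_pos:
  assumes "m \<ge> 1"
  shows "alpha p m = u_star p (beta p (m - 1))" "beta p m = v_star p (alpha p m)"
proof -
  have "nat m = Suc (nat (m - 1))"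
    using assms by simp
  then show "alpha p m = u_star p (beta p (m - 1))" "beta p m = v_star p (alpha p m)"
    using assms by (simp_all add: alpha_def beta_def Let_def)
qed

lemma alpha_beta_neg:
  assumes "m \<le> -1"
  shows "beta p m = v_star p (alpha p (m + 1))" "alpha p m = u_star p (beta p m)"
proof -
  have *: "nat (- m) = Suc (nat (- (m + 1)))"
    using assms by simp
  have "alpha p (m + 1) = fst (ab_bwd p (nat (- (m + 1))))"
    using assms by (cases "m = -1") (simp_all add: alpha_def)
  then show "beta p m = v_star p (alpha p (m + 1))" "alpha p m = u_star p (beta p m)"
    using assms by (simp_all add: alpha_def beta_def Let_def *)
qed

definition gen_fun :: "weights \<Rightarrow> real \<Rightarrow> real \<Rightarrow> real" where
  "gen_fun w \<alpha> \<beta> = (\<Sum>\<^sub>\<infinity>(k, l). pmf w (k, l) * \<alpha> powi k * \<beta> powi l)"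

text \<open>\<open>one_minus_z t\<close> is the rational function \<open>1 - z * t\<close> of the variable \<open>z\<close>.\<close>

definition one_minus_z :: "real \<Rightarrow> real poly fract" where
  "one_minus_z t = to_fract [:1, - t:]"

definition v_quot :: "weights \<Rightarrow> weights \<Rightarrow> int \<Rightarrow> real poly fract" where
  "v_quot p v m = one_minus_z (gen_fun v (alpha p m) (beta p m)) /
                  one_minus_z (gen_fun v (alpha p (m + 1)) (beta p m))"

definition h_quot :: "weights \<Rightarrow> weights \<Rightarrow> int \<Rightarrow> real poly fract" where
  "h_quot p h m = one_minus_z (gen_fun h (alpha p m) (beta p (m - 1))) /
                  one_minus_z (gen_fun h (alpha p m) (beta p m))"

text \<open>The recurrences \<open>d\<^sub>m\<^sub>+\<^sub>1 = - c\<^sub>m * v_quot m\<close> and \<open>c\<^sub>m = - d\<^sub>m * h_quot m\<close> are solved here for \<open>c\<close>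
  by eliminating \<open>d\<close>; they are recovered in the lemma \<open>coeff_recurrences\<close>.\<close>

primrec c_fwd :: "weights \<Rightarrow> weights \<Rightarrow> weights \<Rightarrow> nat \<Rightarrow> real poly fract" where
  "c_fwd p h v 0 = 1"
| "c_fwd p h v (Suc n) = c_fwd p h v n * v_quot p v (int n) * h_quot p h (int n + 1)"

primrec c_bwd :: "weights \<Rightarrow> weights \<Rightarrow> weights \<Rightarrow> nat \<Rightarrow> real poly fract" where
  "c_bwd p h v 0 = 1"
| "c_bwd p h v (Suc n) = c_bwd p h v n / (v_quot p v (- int n - 1) * h_quot p h (- int n))"

definition c_coeff :: "weights \<Rightarrow> weights \<Rightarrow> weights \<Rightarrow> int \<Rightarrow> real poly fract" where
  "c_coeff p h v m = (if m \<ge> 0 then c_fwd p h v (nat m) else c_bwd p h v (nat (- m)))"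

definition d_coeff :: "weights \<Rightarrow> weights \<Rightarrow> weights \<Rightarrow> int \<Rightarrow> real poly fract" where
  "d_coeff p h v m = - c_coeff p h v (m - 1) * v_quot p v (m - 1)"

lemma one_minus_z_nonzero: "one_minus_z t \<noteq> 0"
  by (simp add: one_minus_z_def)

lemma coeff_recurrences:
  "c_coeff p h v 0 = 1"
  "d_coeff p h v (m + 1) = - c_coeff p h v m *
     (one_minus_z (gen_fun v (alpha p m) (beta p m)) /
      one_minus_z (gen_fun v (alpha p (m + 1)) (beta p m)))"
  "c_coeff p h v m = - d_coeff p h v m *
     (one_minus_z (gen_fun h (alpha p m) (beta p (m - 1))) /
      one_minus_z (gen_fun h (alpha p m) (beta p m)))"
proof -
  have nz: "v_quot p v k \<noteq> 0" "h_quot p h k \<noteq> 0" for k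
    by (simp_all add: v_quot_def h_quot_def one_minus_z_nonzero)
  have "c_coeff p h v m = c_coeff p h v (m - 1) * v_quot p v (m - 1) * h_quot p h m"
  proof (cases "m \<ge> 1")
    case True
    then have "nat m = Suc (nat (m - 1))"
      by simp
    with True show ?thesis
      by (simp add: c_coeff_def)
  next
    case False
    then have *: "nat (- (m - 1)) = Suc (nat (- m))"
      by simp
    have "c_coeff p h v m = c_bwd p h v (nat (- m))"
      using False by (cases "m = 0") (simp_all add: c_coeff_def)
    moreover have "c_coeff p h v (m - 1) =
        c_bwd p h v (nat (- m)) / (v_quot p v (m - 1) * h_quot p h m)"
      using False unfolding c_coeff_def * by simp
    ultimately show ?thesis
      using nz by simp
  qed
  then show "c_coeff p h v m = - d_coeff p h v m *
     (one_minus_z (gen_fun h (alpha p m) (beta p (m - 1))) /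
      one_minus_z (gen_fun h (alpha p m) (beta p m)))"
    by (simp add: d_coeff_def h_quot_def)
qed (simp_all add: c_coeff_def d_coeff_def v_quot_def)

text \<open>Value of a rational function after cancellation: \<open>quot_of_fract\<close> gives the representation in
  lowest terms.\<close>

definition rat_eval :: "real poly fract \<Rightarrow> real \<Rightarrow> real" where
  "rat_eval r z = poly (fst (quot_of_fract r)) z / poly (snd (quot_of_fract r)) z"

text \<open>The index \<open>n \<ge> 0\<close> of the series stands for \<open>m = n + 1\<close> in \<open>S\<^sub>1\<close> and for \<open>m = - n\<close> in \<open>S\<^sub>0\<close>.\<close>

definition S1 :: "weights \<Rightarrow> weights \<Rightarrow> weights \<Rightarrow> nat \<Rightarrow> nat \<Rightarrow> real \<Rightarrow> real" where
  "S1 p h v i j z = (\<Sum>n. let m = int n + 1; c = c_coeff p h v; d = d_coeff p h v in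
     rat_eval (d m / d 1) z * alpha p m ^ i * beta p (m - 1) ^ j +
     rat_eval (c m / d 1) z * alpha p m ^ i * beta p m ^ j)"

definition S0 :: "weights \<Rightarrow> weights \<Rightarrow> weights \<Rightarrow> nat \<Rightarrow> nat \<Rightarrow> real \<Rightarrow> real" where
  "S0 p h v i j z = (\<Sum>n. let m = - int n; c = c_coeff p h v; d = d_coeff p h v in
     rat_eval (d m / d 0) z * alpha p m ^ i * beta p (m - 1) ^ j +
     rat_eval (c (m - 1) / d 0) z * alpha p (m - 1) ^ i * beta p (m - 1) ^ j)"

definition v_tilde_1 :: "weights \<Rightarrow> weights \<Rightarrow> real" where
  "v_tilde_1 p v = gen_fun v (alpha p 1) (beta p 0)"

definition h_tilde_0 :: "weights \<Rightarrow> weights \<Rightarrow> real" where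
  "h_tilde_0 p h = gen_fun h (alpha p 0) (beta p (- 1))"

definition C_const :: "weights \<Rightarrow> weights \<Rightarrow> weights \<Rightarrow> nat \<Rightarrow> nat \<Rightarrow> real" where
  "C_const p h v i j =
    (let v1 = v_tilde_1 p v; h0 = h_tilde_0 p h in
     if v1 > h0 then (1 / v1 - 1) * S1 p h v i j (1 / v1)
     else if v1 = h0 then (1 / v1 - 1) * (S1 p h v i j (1 / v1) + S0 p h v i j (1 / v1))
     else (1 / h0 - 1) * S0 p h v i j (1 / h0))"

end

(* The generating function of the number of contacts is H(z) = 1 + d_1(z) S_1(z) + d_0(z) S_0(z),
   where d_1(z) = - (1 - z) / (1 - z v_1) and d_0(z) = - (1 - z) / (1 - z h_0).  Indeed the
   compensation series S_1 and S_0 are harmonic for the interior steps; the recurrences for c_m and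
   d_m make them satisfy one boundary condition each, and d_1, d_0 absorb the defect at the other one.
   Uniqueness for |z| < 1 follows from the test function a^i + b^j with a, b < 1, which the weighted
   transition operator contracts, while H(z) - 1 is bounded by a multiple of it.  The points
   (alpha_m, beta_m) decay geometrically, so S_1 and S_0 are holomorphic beyond |z| = 1 / max(v_1, h_0),
   and the coefficients of H are governed by the simple poles at 1 / v_1 and 1 / h_0.  The constant is
   positive: far from both axes the leading terms alpha_1^i and beta_(-1)^j dominate, and positivity
   propagates backwards along the steps of the walk, since one step bounds f_n at a state from below
   by a multiple of f_n or f_(n-1) at its successor. *)

theory Submission
  imports
    Defs
    "HOL-Real_Asymp.Real_Asymp"
    "HOL-Complex_Analysis.Complex_Analysis"
begin

section \<open>The kernel\<close>

text \<open>Consecutive points of the staircase share a coordinate. The monomials of d_m and c_m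
  have the same alpha_m and coincide on the horizontal axis; those of c_m and d_(m+1) have the same
  beta_m and coincide on the vertical axis. Each recurrence is the cancellation of such a pair, so
  every new term repairs the boundary condition broken by its predecessor.

  The main obstacle is that \<open>u_star\<close> inverts a function defined by \<open>THE\<close>,
  up to a point chosen by \<open>arg_max_on\<close>, and none of the known facts about u is assumed.
  They are replaced by convexity of the kernel in each variable, its negativity on the diagonal, the
  two drifts, and a zero of maximal height. Convergence beyond the unit square is known only near
  zeros, so the highest zero is reached through Fatou's lemma.

  Strict dominance of the two poles rests on two comparisons: (alpha_2, beta_1) lies strictly below
  (alpha_1, beta_0), and (alpha_1, beta_1) strictly below (alpha_0, beta_(-1)). The half with
  negative indices is the positive half of the transposed walk, with \<open>h\<close> and
  \<open>v\<close> exchanged.\<close>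

text \<open>Both sides default to 0 when the series diverges, so the equation is
  unconditional.\<close>

lemma infsum_pmf_times:
  fixes f :: "'a \<Rightarrow> real"
  shows "(\<Sum>\<^sub>\<infinity>x. pmf w x * f x) = measure_pmf.expectation w f"
proof -
  have "measure_pmf.expectation w f = infsetsum (\<lambda>x. pmf w x * f x) UNIV"
    by (rule pmf_expectation_eq_infsetsum)
  also have "\<dots> = (\<Sum>\<^sub>\<infinity>x. pmf w x * f x)"
  proof (cases "Infinite_Set_Sum.abs_summable_on (\<lambda>x. pmf w x * f x) UNIV")
    case True
    then show ?thesis by (rule infsetsum_infsum)
  next
    case False
    then have "\<not> (\<lambda>x. pmf w x * f x) summable_on UNIV"
      by (metis abs_summable_equivalent summable_on_iff_abs_summable_on_real)
    with False show ?thesis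
      by (simp add: infsum_not_exists infsetsum_def Infinite_Set_Sum.abs_summable_on_def not_integrable_integral_eq)
  qed
  finally show ?thesis by simp
qed

lemma summable_on_pmf_times_iff:
  fixes f :: "'a \<Rightarrow> real"
  shows "(\<lambda>x. pmf w x * f x) summable_on UNIV \<longleftrightarrow> integrable (measure_pmf w) f"
proof -
  have "integrable (measure_pmf w) f \<longleftrightarrow> integrable (count_space UNIV) (\<lambda>x. pmf w x *\<^sub>R f x)"
    unfolding measure_pmf_eq_density by (rule integrable_density) auto
  also have "\<dots> \<longleftrightarrow> Infinite_Set_Sum.abs_summable_on (\<lambda>x. pmf w x * f x) UNIV"
    by (simp add: Infinite_Set_Sum.abs_summable_on_def)
  also have "\<dots> \<longleftrightarrow> (\<lambda>x. pmf w x * f x) summable_on UNIV"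
    by (metis abs_summable_equivalent summable_on_iff_abs_summable_on_real)
  finally show ?thesis by simp
qed

lemma integral_pmf_ge_single:
  fixes f :: "'a \<Rightarrow> real"
  assumes "integrable (measure_pmf w) f" "\<And>x. x \<in> set_pmf w \<Longrightarrow> 0 \<le> f x"
  shows "pmf w y * f y \<le> measure_pmf.expectation w f"
proof -
  have "pmf w y * f y = measure_pmf.expectation w (\<lambda>x. f y * indicator {y} x)"
    by (simp add: measure_pmf_single)
  also have "\<dots> \<le> measure_pmf.expectation w f"
    using assms
    by (intro integral_mono_AE assms(1) measure_pmf.integrable_const_bound[where B = "\<bar>f y\<bar>"])
      (auto simp: AE_measure_pmf_iff indicator_def)
  finally show ?thesis .
qed

lemma integral_pmf_pos:
  fixes f :: "'a \<Rightarrow> real"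
  assumes "integrable (measure_pmf w) f" "\<And>x. x \<in> set_pmf w \<Longrightarrow> 0 \<le> f x"
    and "y \<in> set_pmf w" "0 < f y"
  shows "0 < measure_pmf.expectation w f"
  using integral_pmf_ge_single[OF assms(1,2), of y] assms(3,4) pmf_positive[of y w]
  by (smt (verit) mult_pos_pos)

text \<open>Convexity of the power function, cleared of denominators. In this form it can be
  integrated term by term to give convexity of the kernel in one variable.\<close>

lemma power_three_point:
  fixes x y w :: real
  assumes "0 \<le> x" "x < y" "y < w"
  shows "(w - x) * y ^ n \<le> (w - y) * x ^ n + (y - x) * w ^ n"
proof -
  have "convex_on {0..} (\<lambda>x::real. x ^ n)"
    by (cases "even n") (auto intro: convex_on_subset[OF convex_power_even] convex_power_odd)
  then have "((1 - (y - x) / (w - x)) *\<^sub>R x + ((y - x) / (w - x)) *\<^sub>R w) ^ n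
      \<le> (1 - (y - x) / (w - x)) * x ^ n + (y - x) / (w - x) * w ^ n"
    using assms by (intro convex_onD) (auto simp: field_simps)
  also have "(1 - (y - x) / (w - x)) *\<^sub>R x + ((y - x) / (w - x)) *\<^sub>R w = y"
    using assms by (simp add: divide_simps) (simp add: algebra_simps)
  also have "1 - (y - x) / (w - x) = (w - y) / (w - x)"
    using assms by (simp add: divide_simps)
  finally show ?thesis using assms by (simp add: divide_simps) (simp add: algebra_simps)
qed

section \<open>The interior law and elementary properties of its kernel\<close>

text \<open>The monomial of the kernel sum. The shifted exponents are nonnegative on the support of
  \<open>p\<close>, so \<open>nat\<close> truncates nothing there, and 0 is an admissible
  base.\<close>

definition jump_monom :: "real \<Rightarrow> real \<Rightarrow> int \<times> int \<Rightarrow> real" where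
  "jump_monom a b x = a ^ nat (fst x + 1) * b ^ nat (snd x + 1)"

lemma jump_monom_nonneg: "0 \<le> a \<Longrightarrow> 0 \<le> b \<Longrightarrow> 0 \<le> jump_monom a b x"
  by (simp add: jump_monom_def)

lemma jump_monom_mono:
  "0 \<le> a \<Longrightarrow> 0 \<le> b \<Longrightarrow> a \<le> a' \<Longrightarrow> b \<le> b' \<Longrightarrow> jump_monom a b x \<le> jump_monom a' b' x"
  by (auto simp: jump_monom_def intro!: mult_mono power_mono)

lemma jump_monom_swap: "jump_monom a b (prod.swap x) = jump_monom b a x"
  by (simp add: jump_monom_def)

locale step_law =
  fixes p :: weights
  assumes small_jumps: "\<And>k l. k \<le> -2 \<or> l \<le> -2 \<Longrightarrow> pmf p (k, l) = 0"
    and singular: "pmf p (-1, -1) = 0" "pmf p (-1, 0) = 0" "pmf p (0, -1) = 0"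
    and antidiagonal: "pmf p (-1, 1) \<noteq> 0" "pmf p (1, -1) \<noteq> 0"
    and forward: "\<exists>k l. k + l > 0 \<and> pmf p (k, l) > 0"
    and finite_near_curve:
      "\<And>x y. ((\<lambda>(k, l). pmf p (k, l) * exp (of_int k * x + of_int l * y)) has_sum 1) UNIV \<Longrightarrow>
         \<forall>\<^sub>F (x', y') in nhds (x, y).
           (\<lambda>(k, l). pmf p (k, l) * exp (of_int k * x' + of_int l * y')) summable_on UNIV"
    and drift: "0 < measure_pmf.expectation p (\<lambda>x. real_of_int (fst x))"
      "0 < measure_pmf.expectation p (\<lambda>x. real_of_int (snd x))"

lemma case_prod_pmf_times:
  "(\<lambda>(k, l). f (k, l) * pmf w (k, l)) = (\<lambda>x. pmf w x * f x)" for f :: "_ \<Rightarrow> real"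
  by (auto simp: fun_eq_iff)

lemma (in singular_reflected_data) step_law: "step_law p"
proof
  show "0 < measure_pmf.expectation p (\<lambda>x. real_of_int (fst x))"
    using p_drift(1) case_prod_pmf_times[of "\<lambda>x. real_of_int (fst x)" p]
    by (simp add: infsum_pmf_times)
  show "0 < measure_pmf.expectation p (\<lambda>x. real_of_int (snd x))"
    using p_drift(2) case_prod_pmf_times[of "\<lambda>x. real_of_int (snd x)" p]
    by (simp add: infsum_pmf_times)
qed (use p_small_jumps p_singular p_nondegenerate p_forward p_finite_near_curve in auto)

lemma pmf_swap: "pmf (map_pmf prod.swap w) x = pmf w (prod.swap x)"
  by (metis pmf_map_inj' inj_swap swap_swap)

context step_law
begin

text \<open>The symmetry that halves the work: facts about v, beta and S_0 are those about u, alpha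
  and S_1 for the transposed law.\<close>

lemma step_law_swap: "step_law (map_pmf prod.swap p)"
proof
  show "\<exists>k l. k + l > 0 \<and> pmf (map_pmf prod.swap p) (k, l) > 0"
    using forward by (simp add: pmf_swap) (metis add.commute)
  fix x y :: real
  let ?f = "\<lambda>x y (k, l). pmf p (k, l) * exp (of_int k * x + of_int l * y)"
  let ?g = "\<lambda>x y (k, l). pmf (map_pmf prod.swap p) (k, l) * exp (of_int k * x + of_int l * y)"
  have eq: "?g x y = ?f y x \<circ> prod.swap" for x y
    by (auto simp: fun_eq_iff pmf_swap add.commute)
  have bij: "inj_on prod.swap (UNIV :: (int \<times> int) set)" "prod.swap ` (UNIV :: (int \<times> int) set) = UNIV"
    by (auto simp: inj_on_def)
  have summ: "?g x y summable_on UNIV \<longleftrightarrow> ?f y x summable_on UNIV" for x y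
    unfolding eq using summable_on_reindex[OF bij(1), of "?f y x"] by (simp only: bij(2))
  assume "(?g x y has_sum 1) UNIV"
  then have "(?f y x has_sum 1) UNIV"
    unfolding eq using has_sum_reindex[OF bij(1), of "?f y x"] by (simp only: bij(2))
  from finite_near_curve[OF this]
  have "\<forall>\<^sub>F z in nhds (y, x). ?f (fst z) (snd z) summable_on UNIV"
    by (simp only: case_prod_unfold)
  moreover have "((\<lambda>z. (snd z, fst z)) \<longlongrightarrow> (snd (x, y), fst (x, y))) (nhds (x, y))"
    by (intro tendsto_Pair tendsto_fst tendsto_snd filterlim_ident)
  ultimately have "\<forall>\<^sub>F z in nhds (x, y). ?f (fst (snd z, fst z)) (snd (snd z, fst z)) summable_on UNIV"
    unfolding fst_conv[of x y] snd_conv[of x y] by (rule eventually_compose_filterlim)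
  then show "\<forall>\<^sub>F (x', y') in nhds (x, y). ?g x' y' summable_on UNIV"
    by (simp only: case_prod_unfold fst_conv snd_conv summ[unfolded case_prod_unfold])
qed (use small_jumps singular antidiagonal drift in \<open>auto simp: pmf_swap\<close>)

text \<open>Among the jumps with both coordinates at least -1, the three excluded ones are exactly
  those of negative coordinate sum.\<close>

lemma support: "x \<in> set_pmf p \<Longrightarrow> fst x \<ge> -1 \<and> snd x \<ge> -1 \<and> fst x + snd x \<ge> 0"
proof -
  assume "x \<in> set_pmf p"
  then have "pmf p (fst x, snd x) \<noteq> 0" by (simp add: set_pmf_iff)
  then have a: "fst x \<ge> -1" "snd x \<ge> -1" using small_jumps[of "fst x" "snd x"] by linarith+
  moreover have "fst x + snd x \<ge> 0"
  proof (rule ccontr)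
    assume "\<not> fst x + snd x \<ge> 0"
    with a have "(fst x, snd x) \<in> {(-1,-1), (-1,0), (0,-1)}" by (cases x) auto
    then show False using singular \<open>pmf p (fst x, snd x) \<noteq> 0\<close> by auto
  qed
  ultimately show ?thesis by simp
qed

definition conv :: "real \<Rightarrow> real \<Rightarrow> bool" where
  "conv a b \<longleftrightarrow> integrable (measure_pmf p) (jump_monom a b)"

definition ker_sum :: "real \<Rightarrow> real \<Rightarrow> real" where
  "ker_sum a b = measure_pmf.expectation p (jump_monom a b)"

lemma kernel_eq: "kernel p a b = ker_sum a b - a * b"
proof -
  have "(\<Sum>\<^sub>\<infinity>(k, l)\<in>{-1..} \<times> {-1..}. pmf p (k, l) * a powi (k + 1) * b powi (l + 1))
      = (\<Sum>\<^sub>\<infinity>x. pmf p x * jump_monom a b x)"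
    using small_jumps
    by (intro infsum_cong_neutral)
      (auto simp: jump_monom_def power_int_def not_le)
  then show ?thesis by (simp add: kernel_def ker_sum_def infsum_pmf_times)
qed

text \<open>If the sum diverged, \<open>ker_sum\<close> would default to 0 and the kernel would be
  \<open>- a * b\<close>, which is not 0.\<close>

lemma kernel_zero_imp_conv: "kernel p a b = 0 \<Longrightarrow> a > 0 \<Longrightarrow> b > 0 \<Longrightarrow> conv a b"
  by (smt (verit, ccfv_threshold) conv_def kernel_eq ker_sum_def mult_pos_pos
      not_integrable_integral_eq)

lemma conv_mono: "conv a' b' \<Longrightarrow> 0 \<le> a \<Longrightarrow> 0 \<le> b \<Longrightarrow> a \<le> a' \<Longrightarrow> b \<le> b' \<Longrightarrow> conv a b"
  unfolding conv_def
  by (rule Bochner_Integration.integrable_bound[where f = "jump_monom a' b'"])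
    (auto simp: jump_monom_nonneg jump_monom_mono intro!: AE_I2)

lemma conv_1_1: "conv 1 1" and ker_sum_1_1: "ker_sum 1 1 = 1"
  by (simp_all add: conv_def ker_sum_def jump_monom_def[abs_def])

lemma kernel_1_1: "kernel p 1 1 = 0"
  by (simp add: kernel_eq ker_sum_1_1)

lemma continuous_on_ker_sum_fst:
  assumes "conv a' b" "0 \<le> b"
  shows "continuous_on {0..a'} (\<lambda>a. ker_sum a b)"
proof (rule continuous_on_sequentiallyI)
  fix u :: "nat \<Rightarrow> real" and a
  assume u: "\<forall>n. u n \<in> {0..a'}" and a: "a \<in> {0..a'}" and lim: "u \<longlonglongrightarrow> a"
  show "(\<lambda>n. ker_sum (u n) b) \<longlonglongrightarrow> ker_sum a b"
    unfolding ker_sum_def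
  proof (rule integral_dominated_convergence)
    show "integrable (measure_pmf p) (jump_monom a' b)" using assms(1) by (simp add: conv_def)
    show "AE x in measure_pmf p. (\<lambda>n. jump_monom (u n) b x) \<longlonglongrightarrow> jump_monom a b x"
      using lim by (auto simp: jump_monom_def intro!: AE_I2 tendsto_intros)
    show "AE x in measure_pmf p. norm (jump_monom (u n) b x) \<le> jump_monom a' b x" for n
      using u assms(2) by (auto simp: jump_monom_nonneg jump_monom_mono intro!: AE_I2)
  qed auto
qed

lemma continuous_on_kernel_fst:
  assumes "conv a' b" "0 \<le> b"
  shows "continuous_on {0..a'} (\<lambda>a. kernel p a b)"
  unfolding kernel_eq by (intro continuous_intros continuous_on_ker_sum_fst assms)

lemma kernel_convex_fst:
  assumes "conv w b" "0 \<le> b" "0 \<le> x" "x < y" "y < w"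
  shows "(w - x) * kernel p y b \<le> (w - y) * kernel p x b + (y - x) * kernel p w b"
proof -
  have i: "integrable (measure_pmf p) (jump_monom y b)" "integrable (measure_pmf p) (jump_monom x b)"
    "integrable (measure_pmf p) (jump_monom w b)"
    using assms conv_mono[of w b] by (auto simp: conv_def[symmetric])
  have "(w - x) * ker_sum y b \<le> (w - y) * ker_sum x b + (y - x) * ker_sum w b"
    unfolding ker_sum_def integral_mult_right_zero[symmetric]
    using i
    apply (subst Bochner_Integration.integral_add[symmetric])
      apply simp
     apply simp
  proof (rule integral_mono)
    fix z
    show "(w - x) * jump_monom y b z \<le> (w - y) * jump_monom x b z + (y - x) * jump_monom w b z"
      using mult_right_mono[OF power_three_point[OF assms(3-5), of "nat (fst z + 1)"],
        of "b ^ nat (snd z + 1)"] assms(2)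
      by (simp add: jump_monom_def algebra_simps)
  qed auto
  then show ?thesis unfolding kernel_eq by (simp add: algebra_simps)
qed

text \<open>At abscissa 0 only jumps with first coordinate -1 survive, and the jump (-1, 1)
  contributes a positive multiple of \<open>b\<close> squared.\<close>

lemma kernel_0_pos:
  assumes "conv a b" "0 \<le> a" "0 < b"
  shows "0 < kernel p 0 b"
proof -
  have "0 < ker_sum 0 b"
    unfolding ker_sum_def
  proof (rule integral_pmf_pos)
    show "integrable (measure_pmf p) (jump_monom 0 b)"
      using conv_mono[OF assms(1), of 0 b] assms by (simp add: conv_def)
    show "(-1, 1) \<in> set_pmf p" using antidiagonal by (simp add: set_pmf_iff)
  qed (use assms in \<open>auto simp: jump_monom_def\<close>)
  then show ?thesis by (simp add: kernel_eq)
qed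

text \<open>On the diagonal a jump (k, l) contributes a power of \<open>a\<close> with exponent 2 +
  k + l, which is at least 2; the forward jump makes the comparison with \<open>a\<close> squared
  strict.\<close>

lemma kernel_diag_neg:
  assumes "0 < a" "a < 1"
  shows "kernel p a a < 0"
proof -
  have c: "conv a a" using conv_mono[OF conv_1_1] assms by simp
  have eq: "jump_monom a a x = a ^ (2 + nat (fst x + snd x))" if "x \<in> set_pmf p" for x
  proof -
    have "nat (fst x + 1) + nat (snd x + 1) = 2 + nat (fst x + snd x)"
      using support[OF that] by (subst of_nat_eq_iff[where 'a = int, symmetric]) simp
    then show ?thesis by (simp only: jump_monom_def power_add[symmetric])
  qed
  obtain k l where kl: "k + l > 0" "(k, l) \<in> set_pmf p" using forward by (auto simp: set_pmf_iff)
  have "0 < measure_pmf.expectation p (\<lambda>x. a\<^sup>2 - jump_monom a a x)"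
  proof (rule integral_pmf_pos)
    show "integrable (measure_pmf p) (\<lambda>x. a\<^sup>2 - jump_monom a a x)" using c by (simp add: conv_def)
    show "0 \<le> a\<^sup>2 - jump_monom a a x" if "x \<in> set_pmf p" for x
      using assms support[OF that] power_decreasing[of 2 "2 + nat (fst x + snd x)" a] by (simp add: eq[OF that])
    show "0 < a\<^sup>2 - jump_monom a a (k, l)"
      using assms kl power_strict_decreasing[of 2 "2 + nat (k + l)" a] by (simp add: eq[OF kl(2)])
  qed (use kl in auto)
  also have "\<dots> = - kernel p a a"
    using c by (simp add: kernel_eq ker_sum_def conv_def power2_eq_square)
  finally show ?thesis by simp
qed

end

lemma (in step_law) kernel_swap: "kernel (map_pmf prod.swap p) a b = kernel p b a"
proof -
  interpret sw: step_law "map_pmf prod.swap p" by (rule step_law_swap)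
  show ?thesis
    by (simp add: kernel_eq sw.kernel_eq ker_sum_def sw.ker_sum_def jump_monom_swap)
qed

lemma (in step_law) conv_swap: "step_law.conv (map_pmf prod.swap p) a b = conv b a"
proof -
  interpret sw: step_law "map_pmf prod.swap p" by (rule step_law_swap)
  have "(\<lambda>x. jump_monom a b (prod.swap x)) = jump_monom b a" by (simp add: fun_eq_iff jump_monom_swap)
  then show ?thesis by (simp add: conv_def sw.conv_def)
qed

context step_law
begin

lemmas continuous_on_kernel_snd = step_law.continuous_on_kernel_fst[OF step_law_swap, unfolded conv_swap kernel_swap]
lemmas kernel_convex_snd = step_law.kernel_convex_fst[OF step_law_swap, unfolded conv_swap kernel_swap]

end

section \<open>Zeros of the kernel\<close>

context step_law
begin

lemma integrable_drift:
  "integrable (measure_pmf p) (\<lambda>x. real_of_int (fst x))"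
  "integrable (measure_pmf p) (\<lambda>x. real_of_int (snd x))"
  using drift not_integrable_integral_eq by fastforce+

text \<open>The vertical drift is positive and the kernel on the line of abscissa 1 lies above a
  positive multiple of it.\<close>

lemma kernel_1_pos:
  assumes "conv 1 b" "1 < b"
  shows "0 < kernel p 1 b"
proof -
  have "0 < b * (b - 1) * measure_pmf.expectation p (\<lambda>x. real_of_int (snd x))"
    using drift assms by simp
  also have "\<dots> = measure_pmf.expectation p (\<lambda>x. b * (b - 1) * real_of_int (snd x))" by simp
  also have "\<dots> \<le> measure_pmf.expectation p (\<lambda>x. jump_monom 1 b x - b)"
  proof (rule integral_mono_AE)
    \<comment> \<open>Bernoulli's inequality, with the jump l = -1 apart: there the claim reduces to
      the square of b - 1 being nonnegative.\<close>
    have "b * (b - 1) * real_of_int l \<le> b ^ nat (l + 1) - b" if "l \<ge> -1" for l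
    proof (cases "l = -1")
      case True
      have "0 \<le> (b - 1) * (b - 1)" by simp
      with True show ?thesis by (simp add: algebra_simps)
    next
      case False
      with that obtain n where n: "l = int n" using nonneg_int_cases[of l] by force
      have "1 + real n * (b - 1) \<le> b ^ n"
        using Bernoulli_inequality[of "b - 1" n] assms by simp
      then have "b * (1 + real n * (b - 1)) \<le> b * b ^ n" using assms by simp
      moreover have "nat (int n + 1) = Suc n" by simp
      ultimately show ?thesis by (simp add: n algebra_simps)
    qed
    then show "AE x in measure_pmf p. b * (b - 1) * real_of_int (snd x) \<le> jump_monom 1 b x - b"
      using support by (simp add: AE_measure_pmf_iff jump_monom_def)
  qed (use assms integrable_drift in \<open>auto simp: conv_def\<close>)
  also have "\<dots> = kernel p 1 b"
    using assms by (simp add: kernel_eq ker_sum_def conv_def)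
  finally show ?thesis .
qed

text \<open>The kernel at (a, 1) is (1 - a) times 1 - E(1 + a + ... + a^k), where k is the first
  coordinate of the jump. As a tends to 1 this expectation tends to 1 plus the horizontal drift, by
  dominated convergence.\<close>

lemma kernel_1_neg: "\<exists>a. 0 < a \<and> a < 1 \<and> kernel p a 1 < 0"
proof -
  define u where "u j = 1 - 1 / (real j + 2)" for j
  have u: "0 < u j" "u j < 1" for j by (auto simp: u_def)
  have lim: "u \<longlonglongrightarrow> 1" unfolding u_def by real_asymp
  define n where "n x = nat (fst x + 1)" for x :: "int \<times> int"
  have int_n: "integrable (measure_pmf p) (\<lambda>x. real (n x))"
    and E_n: "measure_pmf.expectation p (\<lambda>x. real (n x)) = 1 + measure_pmf.expectation p (\<lambda>x. real_of_int (fst x))"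
  proof -
    have ae: "AE x in measure_pmf p. 1 + real_of_int (fst x) = real (n x)"
      unfolding AE_measure_pmf_iff
    proof
      fix x assume "x \<in> set_pmf p"
      from support[OF this] show "1 + real_of_int (fst x) = real (n x)" by (simp add: n_def)
    qed
    have i: "integrable (measure_pmf p) (\<lambda>x. 1 + real_of_int (fst x))"
      using integrable_drift by simp
    show "integrable (measure_pmf p) (\<lambda>x. real (n x))"
      using integrable_cong_AE_imp[OF i _ ] ae by simp
    have "measure_pmf.expectation p (\<lambda>x. real (n x)) = measure_pmf.expectation p (\<lambda>x. 1 + real_of_int (fst x))"
      using ae by (intro integral_cong_AE) auto
    then show "measure_pmf.expectation p (\<lambda>x. real (n x)) = 1 + measure_pmf.expectation p (\<lambda>x. real_of_int (fst x))"
      using integrable_drift by simp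
  qed
  have "(\<lambda>j. measure_pmf.expectation p (\<lambda>x. \<Sum>i<n x. u j ^ i)) \<longlonglongrightarrow> measure_pmf.expectation p (\<lambda>x. real (n x))"
  proof (rule integral_dominated_convergence[OF _ _ int_n])
    have "(\<lambda>j. \<Sum>i<n x. u j ^ i) \<longlonglongrightarrow> (\<Sum>i<n x. 1 ^ i)" for x
      by (intro tendsto_intros lim)
    then show "AE x in measure_pmf p. (\<lambda>j. \<Sum>i<n x. u j ^ i) \<longlonglongrightarrow> real (n x)" by simp
    have "(\<Sum>i<n x. u j ^ i) \<le> (\<Sum>i<n x. 1)" for j x
      using u[of j] by (intro sum_mono power_le_one) auto
    then show "AE x in measure_pmf p. norm (\<Sum>i<n x. u j ^ i) \<le> real (n x)" for j
      using u[of j] by (auto simp: sum_nonneg)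
  qed auto
  moreover have "1 < measure_pmf.expectation p (\<lambda>x. real (n x))" using E_n drift by simp
  ultimately have "\<forall>\<^sub>F j in sequentially. 1 < measure_pmf.expectation p (\<lambda>x. \<Sum>i<n x. u j ^ i)"
    by (rule order_tendstoD(1))
  then obtain j where j: "1 < measure_pmf.expectation p (\<lambda>x. \<Sum>i<n x. u j ^ i)"
    using eventually_happens by force
  have c: "conv (u j) 1" using conv_mono[OF conv_1_1] u[of j] by simp
  have "1 - u j < (1 - u j) * measure_pmf.expectation p (\<lambda>x. \<Sum>i<n x. u j ^ i)"
    using j u[of j] by simp
  also have "\<dots> = measure_pmf.expectation p (\<lambda>x. (1 - u j) * (\<Sum>i<n x. u j ^ i))"
    by simp
  also have "\<dots> = measure_pmf.expectation p (\<lambda>x. 1 - jump_monom (u j) 1 x)"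
    by (simp only: one_diff_power_eq[symmetric]) (simp add: jump_monom_def n_def)
  also have "\<dots> = 1 - ker_sum (u j) 1" using c by (simp add: ker_sum_def conv_def)
  finally show ?thesis using u[of j] by (intro exI[of _ "u j"]) (simp add: kernel_eq)
qed

lemma jump_monom_exp:
  assumes "x \<in> set_pmf p"
  shows "jump_monom (exp s) (exp t) x = exp s * exp t * exp (of_int (fst x) * s + of_int (snd x) * t)"
proof -
  have "exp s ^ nat (fst x + 1) = exp s * exp (of_int (fst x) * s)"
    using support[OF assms] by (simp add: exp_of_nat_mult[symmetric] exp_add[symmetric] algebra_simps)
  moreover have "exp t ^ nat (snd x + 1) = exp t * exp (of_int (snd x) * t)"
    using support[OF assms] by (simp add: exp_of_nat_mult[symmetric] exp_add[symmetric] algebra_simps)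
  ultimately show ?thesis by (simp add: jump_monom_def exp_add)
qed

lemma conv_exp_iff:
  "conv (exp s) (exp t) \<longleftrightarrow>
    (\<lambda>(k, l). pmf p (k, l) * exp (of_int k * s + of_int l * t)) summable_on UNIV"
proof -
  have eq: "(\<lambda>(k, l). pmf p (k, l) * exp (of_int k * s + of_int l * t))
      = (\<lambda>x. pmf p x * exp (of_int (fst x) * s + of_int (snd x) * t))" by auto
  have "conv (exp s) (exp t) \<longleftrightarrow> integrable (measure_pmf p)
      (\<lambda>x. (exp s * exp t) * exp (of_int (fst x) * s + of_int (snd x) * t))"
    unfolding conv_def by (intro integrable_cong_AE) (auto simp: AE_measure_pmf_iff jump_monom_exp)
  also have "\<dots> \<longleftrightarrow> integrable (measure_pmf p)
      (\<lambda>x. exp (of_int (fst x) * s + of_int (snd x) * t))"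
    by simp
  finally show ?thesis unfolding eq summable_on_pmf_times_iff .
qed

text \<open>Finiteness near the curve is only available at zeros of the kernel, not on the whole boundary
  of the sublevel set; this suffices because the domain of convergence is a lower set.\<close>

lemma kernel_zero_imp_conv_beyond:
  assumes "kernel p a b = 0" "0 < a" "0 < b"
  shows "\<exists>a' b'. a < a' \<and> b < b' \<and> conv a' b'"
proof -
  define s t where "s = ln a" and "t = ln b"
  have ab: "a = exp s" "b = exp t" using assms by (simp_all add: s_def t_def)
  have c: "conv (exp s) (exp t)" using kernel_zero_imp_conv assms ab by metis
  let ?f = "\<lambda>s t (k, l). pmf p (k, l) * exp (of_int k * s + of_int l * t)"
  have "(\<Sum>\<^sub>\<infinity>x. ?f s t x) = measure_pmf.expectation p (\<lambda>x. exp (of_int (fst x) * s + of_int (snd x) * t))"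
    unfolding infsum_pmf_times[symmetric] by (simp only: case_prod_unfold prod.collapse)
  also have "\<dots> = measure_pmf.expectation p (\<lambda>x. jump_monom (exp s) (exp t) x / (exp s * exp t))"
    by (intro integral_cong_AE) (auto simp: AE_measure_pmf_iff jump_monom_exp)
  also have "\<dots> = 1" using assms(1) ab by (simp add: kernel_eq ker_sum_def)
  finally have "infsum (?f s t) UNIV = 1" .
  with has_sum_infsum[OF c[unfolded conv_exp_iff]] have "(?f s t has_sum 1) UNIV"
    by (simp only:)
  from finite_near_curve[OF this]
  have ev: "\<forall>\<^sub>F z in nhds (s, t). conv (exp (fst z)) (exp (snd z))"
    by (simp only: conv_exp_iff case_prod_unfold)
  have "((\<lambda>e. (s + e, t + e)) \<longlongrightarrow> (s + 0, t + 0)) (at_right 0)"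
    by (intro tendsto_Pair tendsto_intros)
  then have "((\<lambda>e. (s + e, t + e)) \<longlongrightarrow> (s, t)) (at_right 0)" by simp
  with ev have "\<forall>\<^sub>F e in at_right 0. conv (exp (fst (s + e, t + e))) (exp (snd (s + e, t + e)))"
    by (rule eventually_compose_filterlim)
  then have "\<forall>\<^sub>F e in at_right 0. conv (exp (s + e)) (exp (t + e))" by simp
  then have "\<forall>\<^sub>F e in at_right 0. conv (exp (s + e)) (exp (t + e)) \<and> 0 < e"
    using eventually_at_right_less by (rule eventually_conj)
  then obtain e where e: "conv (exp (s + e)) (exp (t + e))" "0 < e"
    using eventually_happens by force
  then show ?thesis unfolding ab by (intro exI[of _ "exp (s + e)"] exI[of _ "exp (t + e)"]) simp
qed

text \<open>The kernel is positive at abscissa 0, so the intermediate value theorem applies. This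
  turns an inequality back into an exact zero at the same height.\<close>

lemma kernel_zero_leftwards:
  assumes "conv a b" "0 < a" "0 < b" "kernel p a b \<le> 0"
  shows "\<exists>a'. 0 < a' \<and> a' \<le> a \<and> kernel p a' b = 0"
proof -
  have pos: "0 < kernel p 0 b" using kernel_0_pos assms by simp
  have "\<exists>x\<ge>0. x \<le> a \<and> kernel p x b = 0"
    using assms pos continuous_on_kernel_fst[of a b] by (intro IVT2') auto
  then show ?thesis using pos by (metis less_eq_real_def less_irrefl)
qed

lemma kernel_neg_upwards:
  assumes "conv a b'" "0 \<le> a" "0 < b" "b < b'" "kernel p a b < 0"
  shows "\<exists>c. b < c \<and> c < b' \<and> kernel p a c < 0"
proof -
  have "continuous_on {0..b'} (kernel p a)"
    using continuous_on_kernel_snd[of a b'] assms by simp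
  then have "isCont (kernel p a) b"
    using assms by (intro continuous_on_interior[of "{0..b'}"]) auto
  then have "(kernel p a \<longlongrightarrow> kernel p a b) (at_right b)"
    by (simp add: isCont_def filterlim_at_split)
  then have "\<forall>\<^sub>F c in at_right b. kernel p a c < 0"
    using assms by (intro order_tendstoD)
  moreover have "\<forall>\<^sub>F c in at_right b. c < b'"
    using eventually_at_right_real[OF assms(4)] by eventually_elim auto
  ultimately have "\<forall>\<^sub>F c in at_right b. kernel p a c < 0 \<and> c < b' \<and> b < c"
    using eventually_at_right_less[of b] by eventually_elim auto
  then show ?thesis using eventually_happens by force
qed

text \<open>The graph of u over (0, 1) as a relation, usable before existence or uniqueness of the
  zero is known.\<close>

definition zero_above :: "real \<Rightarrow> real \<Rightarrow> bool" where
  "zero_above a b \<longleftrightarrow> 0 < a \<and> a < 1 \<and> a < b \<and> kernel p a b = 0"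

text \<open>Only the jump (-1, 1) is kept in the kernel sum. The estimate bounds the heights of
  zeros and also keeps their abscissas away from 0.\<close>

lemma zero_above_le: "zero_above a b \<Longrightarrow> pmf p (-1, 1) * b \<le> a"
proof -
  assume z: "zero_above a b"
  then have "conv a b" by (auto simp: zero_above_def intro: kernel_zero_imp_conv)
  then have "pmf p (-1, 1) * jump_monom a b (-1, 1) \<le> ker_sum a b"
    unfolding ker_sum_def using z
    by (intro integral_pmf_ge_single) (auto simp: conv_def zero_above_def jump_monom_nonneg)
  then have "(pmf p (-1, 1) * b) * b \<le> a * b"
    using z by (simp add: kernel_eq zero_above_def jump_monom_def power2_eq_square algebra_simps)
  then show ?thesis using z by (auto simp: zero_above_def)
qed

text \<open>Fatou's lemma: with no dominating function at hand, convergence at the limit point is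
  part of the conclusion and only an inequality survives.\<close>

lemma kernel_limit_le_0:
  assumes "\<And>n. zero_above (u n) (w n)" "u \<longlonglongrightarrow> a" "w \<longlonglongrightarrow> b" "0 < a" "0 < b"
  shows "conv a b \<and> kernel p a b \<le> 0"
proof -
  have pos: "0 < u n" "0 < w n" for n using assms(1)[of n] by (auto simp: zero_above_def)
  have "(\<integral>\<^sup>+x. ennreal (jump_monom a b x) \<partial>p) = (\<integral>\<^sup>+x. liminf (\<lambda>n. ennreal (jump_monom (u n) (w n) x)) \<partial>p)"
  proof (intro nn_integral_cong)
    fix x
    have "(\<lambda>n. ennreal (jump_monom (u n) (w n) x)) \<longlonglongrightarrow> ennreal (jump_monom a b x)"
      unfolding jump_monom_def by (intro tendsto_intros assms)
    then show "ennreal (jump_monom a b x) = liminf (\<lambda>n. ennreal (jump_monom (u n) (w n) x))"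
      using lim_imp_Liminf trivial_limit_sequentially by metis
  qed
  also have "\<dots> \<le> liminf (\<lambda>n. \<integral>\<^sup>+x. ennreal (jump_monom (u n) (w n) x) \<partial>p)"
    by (intro nn_integral_liminf) auto
  also have "(\<lambda>n. \<integral>\<^sup>+x. ennreal (jump_monom (u n) (w n) x) \<partial>p) = (\<lambda>n. ennreal (u n * w n))"
  proof
    fix n
    have "conv (u n) (w n)" "ker_sum (u n) (w n) = u n * w n"
      using assms(1)[of n] pos[of n] kernel_zero_imp_conv by (auto simp: zero_above_def kernel_eq)
    then show "(\<integral>\<^sup>+x. ennreal (jump_monom (u n) (w n) x) \<partial>p) = ennreal (u n * w n)"
      using pos[of n] by (subst nn_integral_eq_integral) (auto simp: conv_def ker_sum_def jump_monom_nonneg)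
  qed
  also have "liminf (\<lambda>n. ennreal (u n * w n)) = ennreal (a * b)"
    by (intro lim_imp_Liminf tendsto_intros assms) auto
  finally have le: "(\<integral>\<^sup>+x. ennreal (jump_monom a b x) \<partial>p) \<le> ennreal (a * b)" .
  have nn: "0 \<le> jump_monom a b x" for x using assms by (simp add: jump_monom_nonneg)
  have c: "conv a b" unfolding conv_def
    using le nn by (intro integrableI_bounded) (auto intro: le_less_trans)
  then have "ennreal (ker_sum a b) \<le> ennreal (a * b)"
    using le nn by (simp add: conv_def ker_sum_def nn_integral_eq_integral)
  then show ?thesis using c assms by (simp add: kernel_eq)
qed

text \<open>A maximising sequence of zeros has a limit point (a, B). \<open>zero_above_le\<close>
  keeps \<open>a\<close> positive, Fatou makes the kernel nonpositive there,
  \<open>kernel_1_pos\<close> excludes a = 1, and moving left yields an exact zero at height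
  B.\<close>

lemma zero_above_max: "\<exists>a b. zero_above a b \<and> 1 < b \<and> (\<forall>a' b'. zero_above a' b' \<longrightarrow> b' \<le> b)"
proof -
  define G where "G = {b. \<exists>a. zero_above a b}"
  obtain a0 where a0: "0 < a0" "a0 < 1" "kernel p a0 1 < 0" using kernel_1_neg by auto
  \<comment> \<open>Finiteness beyond (1, 1) leaves room above height 1: the kernel at abscissa
    \<open>a0\<close> stays negative up to some \<open>b1 > 1\<close>, so there is a zero at that
    height.\<close>
  obtain a' b' where ab': "1 < a'" "1 < b'" "conv a' b'"
    using kernel_zero_imp_conv_beyond[of 1 1] kernel_1_1 by auto
  have "conv a0 b'" using conv_mono[OF ab'(3)] a0 ab' by simp
  then obtain b1 where b1: "1 < b1" "b1 < b'" "kernel p a0 b1 < 0"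
    using kernel_neg_upwards[of a0 b' 1] a0 ab' by auto
  have "conv a0 b1" using conv_mono[OF ab'(3)] a0 ab' b1 by simp
  then obtain a1 where "0 < a1" "a1 \<le> a0" "kernel p a1 b1 = 0"
    using kernel_zero_leftwards[of a0 b1] a0 b1 by auto
  then have b1G: "b1 \<in> G" using b1 a0 by (auto simp: G_def zero_above_def)
  have ppos: "0 < pmf p (-1, 1)" using antidiagonal by (simp add: pmf_pos)
  have bdd: "bdd_above G"
  proof (rule bdd_aboveI)
    fix b assume "b \<in> G"
    then obtain a where "zero_above a b" by (auto simp: G_def)
    with zero_above_le[OF this] ppos show "b \<le> 1 / pmf p (-1, 1)"
      by (auto simp: zero_above_def field_simps)
  qed
  define B where "B = Sup G"
  have B1: "1 < B" using b1 cSup_upper[OF b1G bdd] by (simp add: B_def)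
  have "B \<in> closure G" unfolding B_def using b1G bdd by (intro closure_contains_Sup) auto
  then obtain w where w: "\<And>n. w n \<in> G" "w \<longlonglongrightarrow> B" by (auto simp: closure_sequential)
  then obtain u where u: "\<And>n. zero_above (u n) (w n)" unfolding G_def by (auto, metis)
  have "\<forall>n. u n \<in> {0..1}" using u by (auto simp: zero_above_def less_imp_le)
  then obtain a r where a: "a \<in> {0..1}" "strict_mono (r :: nat \<Rightarrow> nat)" "(u \<circ> r) \<longlonglongrightarrow> a"
    using compact_Icc[of "0::real" 1] unfolding compact_eq_seq_compact_metric seq_compact_def by metis
  have wr: "(w \<circ> r) \<longlonglongrightarrow> B" by (rule LIMSEQ_subseq_LIMSEQ[OF w(2) a(2)])
  have "pmf p (-1, 1) * B \<le> a"
    by (rule LIMSEQ_le[OF tendsto_mult_left[OF wr] a(3)])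
      (use zero_above_le[OF u] in auto)
  then have apos: "0 < a" using ppos B1 by (smt (verit) mult_pos_pos)
  have ab: "conv a B" "kernel p a B \<le> 0"
    using kernel_limit_le_0[OF _ a(3) wr] u apos B1 by auto
  have "a \<noteq> 1" using kernel_1_pos[of B] ab B1 by auto
  then have "a < 1" using a by auto
  obtain a2 where "0 < a2" "a2 \<le> a" "kernel p a2 B = 0"
    using kernel_zero_leftwards[OF ab(1) apos _ ab(2)] B1 by auto
  then have "zero_above a2 B" using \<open>a < 1\<close> B1 by (simp add: zero_above_def)
  moreover have "b' \<le> B" if "zero_above a' b'" for a' b'
    unfolding B_def by (rule cSup_upper[OF _ bdd]) (use that in \<open>auto simp: G_def\<close>)
  ultimately show ?thesis using B1 by blast
qed

text \<open>A convex function that is negative at the diagonal point cannot vanish twice above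
  it.\<close>

lemma zero_above_unique:
  assumes "zero_above a b" "zero_above a b'"
  shows "b = b'"
proof -
  have False if "zero_above a b" "zero_above a b'" "b < b'" for b b'
  proof -
    have "conv a b'" using that by (auto simp: zero_above_def intro: kernel_zero_imp_conv)
    then have "(b' - a) * kernel p a b \<le> (b' - b) * kernel p a a + (b - a) * kernel p a b'"
      using that kernel_convex_snd[of a b' a b] by (auto simp: zero_above_def)
    moreover have "(b' - b) * kernel p a a < 0"
      using that kernel_diag_neg[of a] by (auto simp: zero_above_def intro: mult_pos_neg)
    ultimately show False using that by (simp add: zero_above_def)
  qed
  then show ?thesis using assms by (metis linorder_neqE_linordered_idom)
qed

lemma u_fun_zero_above: "zero_above a b \<Longrightarrow> u_fun p a = b"
proof -
  assume z: "zero_above a b"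
  have "(THE \<beta>. \<beta> > a \<and> kernel p a \<beta> = 0) = b"
    using z zero_above_unique[OF z] by (intro the_equality) (auto simp: zero_above_def)
  then show ?thesis using z by (simp add: u_fun_def zero_above_def)
qed

text \<open>The hypotheses do not exclude that some \<open>\<alpha> \<in> (0, 1)\<close> has no zero above it; there \<open>u_fun\<close>
  takes the junk value \<open>THE _. False\<close>. Either this value is maximal, hence greater than \<open>1\<close>, or such
  \<open>\<alpha>\<close> lie to the right of the maximiser; in both cases \<open>u_star\<close> is not affected on \<open>(0, 1]\<close>.\<close>

lemma u_fun_junk: "0 < a \<Longrightarrow> a < 1 \<Longrightarrow> \<nexists>b. zero_above a b \<Longrightarrow> u_fun p a = (THE _. False)"
proof -
  assume a: "0 < a" "a < 1" "\<nexists>b. zero_above a b"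
  then have "(\<lambda>\<beta>. \<beta> > a \<and> kernel p a \<beta> = 0) = (\<lambda>_. False)"
    by (auto simp: zero_above_def fun_eq_iff)
  then show ?thesis using a by (simp add: u_fun_def)
qed

end

section \<open>The sequence of zeros\<close>

context step_law
begin

text \<open>\<open>arg_max_on\<close> says something only if a maximum exists. The values of
  \<open>u_fun\<close> on [0, 1] are 0, 1, heights of zeros, all at most B, or one common junk
  value; so a maximum occurs at the highest zero or at a junk point.\<close>

lemma alpha_hat_max:
  "alpha_hat p \<in> {0..1}" "a \<in> {0..1} \<Longrightarrow> u_fun p a \<le> u_fun p (alpha_hat p)"
proof -
  obtain m B where mB: "zero_above m B" "1 < B" "\<And>a' b'. zero_above a' b' \<Longrightarrow> b' \<le> B"
    using zero_above_max by auto
  have um: "u_fun p m = B" using mB u_fun_zero_above by simp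
  have val: "u_fun p a \<le> B \<or> (0 < a \<and> a < 1 \<and> (\<nexists>b. zero_above a b))" if "a \<in> {0..1}" for a
    using that mB(2) mB(3) u_fun_zero_above[of a] by (cases "\<exists>b. zero_above a b") (auto simp: u_fun_def)
  have "\<exists>x. x \<in> {0..1} \<and> (\<forall>a\<in>{0..1}. u_fun p a \<le> u_fun p x)"
  proof (cases "\<exists>x. 0 < x \<and> x < 1 \<and> (\<nexists>b. zero_above x b) \<and> B < u_fun p x")
    case True
    then obtain x where x: "0 < x" "x < 1" "\<nexists>b. zero_above x b" "B < u_fun p x" by auto
    have "u_fun p a \<le> u_fun p x" if "a \<in> {0..1}" for a
      using val[OF that] x u_fun_junk[of a] u_fun_junk[of x] by auto
    with x show ?thesis by (intro exI[of _ x]) auto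
  next
    case False
    then have "u_fun p a \<le> u_fun p m" if "a \<in> {0..1}" for a
      using val[OF that] um by force
    with mB(1) show ?thesis by (intro exI[of _ m]) (auto simp: zero_above_def)
  qed
  then have "\<exists>x. is_arg_max (u_fun p) (\<lambda>x. x \<in> {0..1}) x"
    by (auto simp: is_arg_max_def not_less)
  then have "is_arg_max (u_fun p) (\<lambda>x. x \<in> {0..1}) (alpha_hat p)"
    unfolding alpha_hat_def arg_max_on_def arg_max_def by (rule someI_ex)
  then show "alpha_hat p \<in> {0..1}" "a \<in> {0..1} \<Longrightarrow> u_fun p a \<le> u_fun p (alpha_hat p)"
    by (auto simp: is_arg_max_def not_less)
qed

lemma conv_unit: "0 \<le> a \<Longrightarrow> a \<le> 1 \<Longrightarrow> 0 \<le> b \<Longrightarrow> b \<le> 1 \<Longrightarrow> conv a b"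
  using conv_mono[OF conv_1_1] by simp

lemma kernel_zero_upwards:
  assumes "conv a b" "0 < a" "a < 1" "a < b" "0 \<le> kernel p a b"
  shows "\<exists>c\<le>b. zero_above a c"
proof -
  have neg: "kernel p a a < 0" using kernel_diag_neg assms by simp
  have "continuous_on {0..b} (kernel p a)" using continuous_on_kernel_snd[of a b] assms by simp
  then have "continuous_on {a..b} (kernel p a)" by (rule continuous_on_subset) (use assms in auto)
  then have "\<exists>x\<ge>a. x \<le> b \<and> kernel p a x = 0"
    using assms neg by (intro IVT') auto
  then obtain c where c: "a \<le> c" "c \<le> b" "kernel p a c = 0" by auto
  then have "a \<noteq> c" using neg by auto
  with c assms show ?thesis by (intro exI[of _ c]) (auto simp: zero_above_def)
qed

text \<open>Two things have to be shown about \<open>inv_into\<close>: that b is attained to the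
  left of the maximiser, and that the preimage it happens to choose is a genuine zero and not a
  point where \<open>u_fun\<close> is junk.\<close>

theorem u_star_zero_above:
  assumes "0 < b" "b \<le> 1"
  shows "zero_above (u_star p b) b"
proof -
  obtain m B where mB: "zero_above m B" "1 < B" "\<And>a' b'. zero_above a' b' \<Longrightarrow> b' \<le> B"
    using zero_above_max by auto
  define t where "t = alpha_hat p"
  have t: "0 \<le> t" "t \<le> 1" "B \<le> u_fun p t"
    using alpha_hat_max(1) alpha_hat_max(2)[of m] mB u_fun_zero_above[OF mB(1)]
    by (auto simp: t_def zero_above_def)
  then have t01: "0 < t" "t < 1" using mB(2) by (auto simp: u_fun_def less_le)
  \<comment> \<open>For b < 1 the diagonal point serves; at b = 1 the kernel vanishes on the
    diagonal and the drift is needed instead.\<close>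
  obtain a0 where a0: "0 < a0" "a0 \<le> b" "a0 < 1" "kernel p a0 b < 0"
    using kernel_1_neg kernel_diag_neg[of b] assms by (cases "b = 1") auto
  obtain a where a: "0 < a" "a \<le> a0" "kernel p a b = 0"
    using kernel_zero_leftwards[of a0 b] conv_unit[of a0 b] a0 assms by auto
  have "a < a0" using a a0 by (auto simp: less_le)
  then have za: "zero_above a b" using a a0 by (simp add: zero_above_def)
  \<comment> \<open>Otherwise convexity between \<open>t\<close> and \<open>a0\<close> forces a
    positive kernel at (t, b), hence a zero above \<open>t\<close> of height at most 1, although
    \<open>u_fun p t\<close> is at least B > 1.\<close>
  have "a \<le> t"
  proof (rule ccontr)
    assume "\<not> a \<le> t"
    then have ta: "t < a" by simp
    have "(a0 - t) * kernel p a b \<le> (a0 - a) * kernel p t b + (a - t) * kernel p a0 b"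
      using ta \<open>a < a0\<close> t01 a0 assms conv_unit[of a0 b] by (intro kernel_convex_fst) auto
    moreover have "(a - t) * kernel p a0 b < 0" using ta a0 by (intro mult_pos_neg) auto
    ultimately have "0 < (a0 - a) * kernel p t b" using a by simp
    then have "0 < kernel p t b" using \<open>a < a0\<close> by (simp add: zero_less_mult_iff)
    then obtain c where "c \<le> b" "zero_above t c"
      using kernel_zero_upwards[of t b] conv_unit[of t b] t01 ta \<open>a < a0\<close> a0 assms by auto
    then show False using u_fun_zero_above t mB(2) assms by force
  qed
  then have im: "b \<in> u_fun p ` {0..t}" using a u_fun_zero_above[OF za] by force
  define x where "x = u_star p b"
  have x: "0 \<le> x" "x \<le> t" "u_fun p x = b"
    using inv_into_into[OF im] f_inv_into_f[OF im] by (auto simp: x_def u_star_def t_def)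
  have x01: "0 < x" "x < 1" using x assms t01 by (auto simp: u_fun_def less_le)
  \<comment> \<open>If \<open>x\<close> were junk, the junk value would be b, so \<open>t\<close>
    would carry the highest zero B. The kernel at (x, B) would be negative, hence also slightly
    above B, and moving left would give a zero higher than B.\<close>
  have "\<exists>c. zero_above x c"
  proof (rule ccontr)
    assume bad: "\<nexists>c. zero_above x c"
    then have junk: "(THE _. False) = b" using u_fun_junk[OF x01] x by simp
    have "\<exists>c. zero_above t c" using u_fun_junk[OF t01] junk t mB assms by force
    then obtain c where c: "zero_above t c" by auto
    then have cB: "c = B" using u_fun_zero_above[OF c] t mB(3)[OF c] by simp
    have xt: "x < t" using bad c x by (auto simp: less_le)
    have "t < c" "0 < c" using c t01 by (auto simp: zero_above_def)
    obtain t' c' where tc': "t < t'" "c < c'" "conv t' c'"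
      using kernel_zero_imp_conv_beyond[of t c] c t01 \<open>0 < c\<close> by (auto simp: zero_above_def)
    have cx: "conv x c'" "conv x c"
      using conv_mono[OF tc'(3)] x01 xt tc' \<open>0 < c\<close> by auto
    have "kernel p x c < 0"
      using kernel_zero_upwards[OF cx(2)] bad x01 xt \<open>t < c\<close> by force
    then obtain c1 where c1: "c < c1" "c1 < c'" "kernel p x c1 < 0"
      using kernel_neg_upwards[OF cx(1)] x01 \<open>0 < c\<close> tc' by auto
    have "conv x c1" using conv_mono[OF cx(1)] c1 x01 \<open>0 < c\<close> by auto
    then obtain a2 where "0 < a2" "a2 \<le> x" "kernel p a2 c1 = 0"
      using kernel_zero_leftwards[of x c1] c1 x01 \<open>0 < c\<close> by auto
    then have "zero_above a2 c1" using x01 xt \<open>t < c\<close> c1 by (simp add: zero_above_def)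
    from mB(3)[OF this] show False using c1 cB by simp
  qed
  then show ?thesis using u_fun_zero_above x by (auto simp: x_def)
qed

section \<open>The staircase of zeros and its decay\<close>

lemma v_fun_swap: "v_fun p = u_fun (map_pmf prod.swap p)"
  by (simp add: fun_eq_iff v_fun_def u_fun_def kernel_swap)

lemma v_star_swap: "v_star p = u_star (map_pmf prod.swap p)"
  by (simp add: fun_eq_iff v_star_def u_star_def beta_tilde_def alpha_hat_def v_fun_swap)

lemma u_star_props:
  assumes "0 < b" "b \<le> 1"
  shows "0 < u_star p b" "u_star p b < b" "kernel p (u_star p b) b = 0"
  using u_star_zero_above[OF assms] by (auto simp: zero_above_def)

lemma v_star_props:
  assumes "0 < a" "a \<le> 1"
  shows "0 < v_star p a" "v_star p a < a" "kernel p a (v_star p a) = 0"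
  using step_law.u_star_props[OF step_law_swap assms] by (auto simp: v_star_swap kernel_swap)

text \<open>The shift in \<open>xs\<close> aligns indices: \<open>xs n\<close> is alpha_(n+1) and
  \<open>ys n\<close> is beta_n, so the points of d_(n+1) and c_(n+1) are (\<open>xs n\<close>,
  \<open>ys n\<close>) and (\<open>xs n\<close>, \<open>ys (Suc n)\<close>).\<close>

definition xs :: "nat \<Rightarrow> real" where "xs n = fst (ab_fwd p (Suc n))"
definition ys :: "nat \<Rightarrow> real" where "ys n = snd (ab_fwd p n)"

lemma xs_eq: "xs n = u_star p (ys n)" and ys_0: "ys 0 = 1" and ys_Suc: "ys (Suc n) = v_star p (xs n)"
  by (simp_all add: xs_def ys_def Let_def)

lemma alpha_eq_xs: "alpha p (int n + 1) = xs n" and beta_eq_ys: "beta p (int n) = ys n"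
  by (simp_all add: alpha_def beta_def xs_def ys_def nat_add_distrib del: ab_fwd.simps)

lemma ys_bounds: "0 < ys n \<and> ys n \<le> 1"
proof (induction n)
  case (Suc n)
  then have "0 < xs n" "xs n \<le> 1" using u_star_props[of "ys n"] by (auto simp: xs_eq)
  then show ?case using v_star_props[of "xs n"] by (auto simp: ys_Suc)
qed (simp add: ys_0)

lemma xs_bounds: "0 < xs n" "xs n < ys n" "xs n < 1"
  using u_star_props[of "ys n"] ys_bounds[of n] by (auto simp: xs_eq)

lemma ys_Suc_less: "ys (Suc n) < xs n"
  using v_star_props[of "xs n"] xs_bounds[of n] by (auto simp: ys_Suc)

lemma kernel_xs_ys: "kernel p (xs n) (ys n) = 0" and kernel_xs_ys_Suc: "kernel p (xs n) (ys (Suc n)) = 0"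
  using u_star_props[of "ys n"] v_star_props[of "xs n"] xs_bounds[of n] ys_bounds[of n]
  by (auto simp: xs_eq ys_Suc)

lemma xs_decreasing: "m \<le> n \<Longrightarrow> xs n \<le> xs m" and ys_decreasing: "m \<le> n \<Longrightarrow> ys n \<le> ys m"
proof -
  have "xs (Suc n) \<le> xs n" "ys (Suc n) \<le> ys n" for n
    using xs_bounds(2)[of n] xs_bounds(2)[of "Suc n"] ys_Suc_less[of n] by linarith+
  then show "m \<le> n \<Longrightarrow> xs n \<le> xs m" "m \<le> n \<Longrightarrow> ys n \<le> ys m"
    by (simp_all add: lift_Suc_antimono_le[of xs] lift_Suc_antimono_le[of ys])
qed

lemma jump_exponents:
  "x \<in> set_pmf p \<Longrightarrow> nat (fst x + 1) + nat (snd x + 1) = 2 + nat (fst x + snd x)"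
  using support[of x] by (subst of_nat_eq_iff[where 'a = int, symmetric]) simp

lemma jump_monom_ray:
  "x \<in> set_pmf p \<Longrightarrow> jump_monom a (s * a) x = s ^ nat (snd x + 1) * (a\<^sup>2 * a ^ nat (fst x + snd x))"
proof -
  assume x: "x \<in> set_pmf p"
  have "jump_monom a (s * a) x = s ^ nat (snd x + 1) * (a ^ nat (fst x + 1) * a ^ nat (snd x + 1))"
    by (simp add: jump_monom_def power_mult_distrib)
  then show ?thesis by (simp only: power_add[symmetric] jump_exponents[OF x])
qed

text \<open>On the ray of slope \<open>s\<close> the normalised kernel increases with \<open>a\<close>, because
  \<open>k + l \<ge> 0\<close> on the support.\<close>

lemma contraction_ratio:
  assumes a: "0 < a" "a < 1"
  shows "\<exists>\<theta>. 0 < \<theta> \<and> \<theta> < 1 \<and> (\<forall>x y. 0 < y \<longrightarrow> y < x \<longrightarrow> x \<le> a \<longrightarrow> kernel p x y = 0 \<longrightarrow> y \<le> \<theta> * x)"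
proof -
  have "continuous_on {0..1} (kernel p a)"
    using continuous_on_kernel_snd[of a 1] conv_unit[of a 1] a by simp
  then have "isCont (kernel p a) a"
    using a by (intro continuous_on_interior[of "{0..1}"]) auto
  moreover have "((\<lambda>s. s * a) \<longlongrightarrow> a) (at_left 1)"
    by (auto intro!: tendsto_eq_intros)
  ultimately have "((\<lambda>s. kernel p a (s * a)) \<longlongrightarrow> kernel p a a) (at_left 1)"
    by (rule isCont_tendsto_compose)
  then have "\<forall>\<^sub>F s in at_left 1. kernel p a (s * a) < 0"
    using kernel_diag_neg[OF a] by (rule order_tendstoD)
  then obtain b where b: "b < 1" "\<And>s. b < s \<Longrightarrow> s < 1 \<Longrightarrow> kernel p a (s * a) < 0"
    unfolding eventually_at_left[of 0 1, simplified] by (auto simp: eventually_at_left_field)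
  \<comment> \<open>Zeros of abscissa at most \<open>a\<close> have slope at most \<theta>, since
    slopes in (\<open>b\<close>, 1) give a negative kernel at abscissa \<open>a\<close>; the 1/2
    only ensures positivity.\<close>
  define \<theta> where "\<theta> = max b (1/2)"
  have "y \<le> \<theta> * x" if xy: "0 < y" "y < x" "x \<le> a" "kernel p x y = 0" for x y
  proof (rule ccontr)
    assume "\<not> y \<le> \<theta> * x"
    define s where "s = y / x"
    have s: "\<theta> < s" "s < 1" "y = s * x" "0 < s"
      using xy \<open>\<not> y \<le> \<theta> * x\<close> by (auto simp: s_def field_simps)
    have K: "kernel p a (s * a) < 0" using b(2)[of s] s by (simp add: \<theta>_def)
    have c: "conv x y" "conv a (s * a)"
      using xy a s by (auto intro!: conv_unit mult_le_one)
    have "a\<^sup>2 * ker_sum x y \<le> x\<^sup>2 * ker_sum a (s * a)"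
      unfolding ker_sum_def integral_mult_right_zero[symmetric]
    proof (rule integral_mono_AE)
      have "a\<^sup>2 * jump_monom x y z \<le> x\<^sup>2 * jump_monom a (s * a) z" if "z \<in> set_pmf p" for z
      proof -
        have "s ^ nat (snd z + 1) * (a\<^sup>2 * x\<^sup>2 * x ^ nat (fst z + snd z))
            \<le> s ^ nat (snd z + 1) * (a\<^sup>2 * x\<^sup>2 * a ^ nat (fst z + snd z))"
          using xy s by (intro mult_left_mono power_mono) auto
        then show ?thesis unfolding s(3) jump_monom_ray[OF that] by (simp add: algebra_simps)
      qed
      then show "AE z in measure_pmf p. a\<^sup>2 * jump_monom x y z \<le> x\<^sup>2 * jump_monom a (s * a) z"
        by (simp add: AE_measure_pmf_iff)
    qed (use c in \<open>auto simp: conv_def\<close>)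
    also have "\<dots> < x\<^sup>2 * (a * (s * a))" using K xy by (simp add: kernel_eq)
    also have "\<dots> = a\<^sup>2 * ker_sum x y"
      using xy s by (simp add: kernel_eq power2_eq_square)
    finally show False by simp
  qed
  moreover have "0 < \<theta>" "\<theta> < 1" using b by (auto simp: \<theta>_def)
  ultimately show ?thesis by blast
qed

text \<open>Each step from \<open>xs n\<close> down to \<open>ys (Suc n)\<close> contracts by one
  ratio valid up to \<open>xs 0\<close>; the step from there to \<open>xs (Suc n)\<close> can only
  decrease further.\<close>

lemma summable_xs: "summable xs" and summable_ys: "summable ys"
proof -
  obtain \<theta> where th: "0 < \<theta>" "\<theta> < 1"
    "\<And>x y. 0 < y \<Longrightarrow> y < x \<Longrightarrow> x \<le> xs 0 \<Longrightarrow> kernel p x y = 0 \<Longrightarrow> y \<le> \<theta> * x"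
    using contraction_ratio[of "xs 0"] xs_bounds[of 0] by metis
  have step: "xs (Suc n) \<le> \<theta> * xs n" for n
  proof -
    have "ys (Suc n) \<le> \<theta> * xs n"
      using th(3)[of "ys (Suc n)" "xs n"] ys_bounds[of "Suc n"] ys_Suc_less xs_decreasing[of 0 n]
        kernel_xs_ys_Suc by simp
    with xs_bounds(2)[of "Suc n"] show ?thesis by simp
  qed
  have "xs n \<le> xs 0 * \<theta> ^ n" for n
  proof (induction n)
    case (Suc n)
    have "xs (Suc n) \<le> \<theta> * (xs 0 * \<theta> ^ n)"
      using step[of n] mult_left_mono[OF Suc, of \<theta>] th by linarith
    then show ?case by (simp add: algebra_simps)
  qed simp
  then have "norm (xs n) \<le> xs 0 * \<theta> ^ n" for n using xs_bounds(1)[of n] by simp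
  moreover have "summable (\<lambda>n. xs 0 * \<theta> ^ n)" using th by (intro summable_mult summable_geometric) auto
  ultimately show s: "summable xs" by (rule summable_comparison_test'[where N = 0, rotated])
  have "summable (\<lambda>n. ys (Suc n))"
    using ys_Suc_less ys_bounds
    by (intro summable_comparison_test'[OF s, where N = 0]) (auto simp: less_imp_le)
  then show "summable ys" by (simp add: summable_Suc_iff)
qed

text \<open>If z were at most y, convexity in the second variable between z and 1 would make the
  kernel nonpositive at (1, y). It is negative at (y, y), so convexity in the first variable would
  make it negative at (x, y).\<close>

lemma kernel_zero_less:
  assumes "0 < x" "x < 1" "0 < y" "y < x" "kernel p x y = 0"
    and "0 < z" "z < 1" "kernel p 1 z = 0"
  shows "y < z"
proof (rule ccontr)
  assume "\<not> y < z"
  then have zy: "z \<le> y" by simp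
  have K1: "kernel p 1 y \<le> 0"
  proof (cases "z = y")
    case False
    then have "(1 - z) * kernel p 1 y \<le> (1 - y) * kernel p 1 z + (y - z) * kernel p 1 1"
      using zy assms conv_1_1 by (intro kernel_convex_snd) auto
    then show ?thesis using assms kernel_1_1 by (simp add: mult_le_0_iff)
  qed (use assms in auto)
  have "(1 - y) * kernel p x y \<le> (1 - x) * kernel p y y + (x - y) * kernel p 1 y"
    using assms conv_unit[of 1 y] by (intro kernel_convex_fst) auto
  moreover have "(1 - x) * kernel p y y < 0"
    using assms kernel_diag_neg[of y] by (intro mult_pos_neg) auto
  moreover have "(x - y) * kernel p 1 y \<le> 0" using K1 assms by (simp add: mult_le_0_iff)
  ultimately show False using assms by simp
qed

text \<open>In the original indices: beta_1 < beta_(-1). This separates the first pole inside the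
  series from the pole at 1 / h0.\<close>

lemma ys_1_less: "ys 1 < v_star p 1"
  using kernel_zero_less[of "xs 0" "ys 1" "v_star p 1"] xs_bounds[of 0] ys_bounds[of 1]
    ys_Suc_less[of 0] kernel_xs_ys_Suc[of 0] v_star_props[of 1] by simp

text \<open>At height 1 the kernel is convex in the abscissa and vanishes at \<open>xs 0\<close> and
  1, so it can be negative only between them. The bound below by \<open>xs 0\<close> lets powers of
  \<open>a\<close> dominate powers of \<open>xs 0\<close>.\<close>

lemma kernel_1_neg': "\<exists>a. xs 0 < a \<and> a < 1 \<and> kernel p a 1 < 0"
proof -
  obtain a where a: "0 < a" "a < 1" "kernel p a 1 < 0" using kernel_1_neg by auto
  have K: "kernel p (xs 0) 1 = 0" using kernel_xs_ys[of 0] by (simp add: ys_0)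
  have "xs 0 < a"
  proof (rule ccontr)
    assume "\<not> xs 0 < a"
    then have "a < xs 0" using a K by (cases "a = xs 0") auto
    then have "(1 - a) * kernel p (xs 0) 1 \<le> (1 - xs 0) * kernel p a 1 + (xs 0 - a) * kernel p 1 1"
      using a conv_1_1 xs_bounds[of 0] by (intro kernel_convex_fst) auto
    moreover have "(1 - xs 0) * kernel p a 1 < 0" using a xs_bounds[of 0] by (intro mult_pos_neg) auto
    ultimately show False using K kernel_1_1 by simp
  qed
  with a show ?thesis by blast
qed

end

section \<open>Reflection laws and the compensation series\<close>

locale reflection_law =
  fixes w :: weights
  assumes refl_support: "\<And>k l. k < 0 \<or> l < 0 \<or> (k, l) = (0, 0) \<Longrightarrow> pmf w (k, l) = 0"
begin

lemma supportD: "x \<in> set_pmf w \<Longrightarrow> 0 \<le> fst x \<and> 0 \<le> snd x \<and> 0 < fst x + snd x"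
  using refl_support[of "fst x" "snd x"] by (cases x) (force simp: set_pmf_iff not_less)

definition refl_monom :: "real \<Rightarrow> real \<Rightarrow> int \<times> int \<Rightarrow> real" where
  "refl_monom a b x = a ^ nat (fst x) * b ^ nat (snd x)"

lemma gen_fun_eq: "gen_fun w a b = measure_pmf.expectation w (refl_monom a b)"
proof -
  have "gen_fun w a b = (\<Sum>\<^sub>\<infinity>x. pmf w x * refl_monom a b x)"
    unfolding gen_fun_def
    using refl_support by (intro infsum_cong) (auto simp: refl_monom_def power_int_def not_le)
  then show ?thesis by (simp add: infsum_pmf_times)
qed

text \<open>A reflection jump is nonzero with nonnegative coordinates, so at least one factor
  \<open>a\<close> or \<open>b\<close> occurs. Hence the generating functions decay along the
  staircase and the coefficient products stay bounded.\<close>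

lemma refl_monom_le:
  assumes "0 \<le> a" "a \<le> 1" "0 \<le> b" "b \<le> 1" "x \<in> set_pmf w"
  shows "refl_monom a b x \<le> max a b"
proof (cases "0 < fst x")
  case True
  then have "a ^ nat (fst x) \<le> a ^ 1" using assms by (intro power_decreasing) auto
  then have "refl_monom a b x \<le> a * 1"
    unfolding refl_monom_def using assms by (intro mult_mono power_le_one) auto
  then show ?thesis by simp
next
  case False
  with supportD[OF assms(5)] have "0 < snd x" by linarith
  then have "b ^ nat (snd x) \<le> b ^ 1" using assms by (intro power_decreasing) auto
  then have "refl_monom a b x \<le> 1 * b"
    unfolding refl_monom_def using assms by (intro mult_mono power_le_one) auto
  then show ?thesis by simp
qed

lemma refl_monom_unit: "0 \<le> a \<Longrightarrow> a \<le> 1 \<Longrightarrow> 0 \<le> b \<Longrightarrow> b \<le> 1 \<Longrightarrow> 0 \<le> refl_monom a b x \<and> refl_monom a b x \<le> 1"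
  by (simp add: refl_monom_def mult_le_one power_le_one)

lemma integrable_refl_monom:
  "0 \<le> a \<Longrightarrow> a \<le> 1 \<Longrightarrow> 0 \<le> b \<Longrightarrow> b \<le> 1 \<Longrightarrow> integrable (measure_pmf w) (refl_monom a b)"
  by (intro measure_pmf.integrable_const_bound[where B = 1]) (auto simp: refl_monom_unit)

lemma gen_fun_bounds:
  assumes "0 \<le> a" "a \<le> 1" "0 \<le> b" "b \<le> 1"
  shows "0 \<le> gen_fun w a b" "gen_fun w a b \<le> max a b"
proof -
  show "0 \<le> gen_fun w a b" unfolding gen_fun_eq using assms by (simp add: refl_monom_unit)
  have "gen_fun w a b \<le> measure_pmf.expectation w (\<lambda>_. max a b)"
    unfolding gen_fun_eq using assms refl_monom_le
    by (intro integral_mono_AE integrable_refl_monom) (auto simp: AE_measure_pmf_iff)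
  then show "gen_fun w a b \<le> max a b" by simp
qed

lemma gen_fun_mono:
  assumes "0 \<le> a'" "a' \<le> a" "a \<le> 1" "0 \<le> b'" "b' \<le> b" "b \<le> 1"
  shows "gen_fun w a' b' \<le> gen_fun w a b"
  unfolding gen_fun_eq using assms
  by (intro integral_mono integrable_refl_monom) (auto simp: refl_monom_def intro!: mult_mono power_mono)

lemma refl_monom_strict_mono:
  assumes "0 < a'" "a' < a" "a \<le> 1" "0 < b'" "b' < b" "b \<le> 1" "x \<in> set_pmf w"
  shows "refl_monom a' b' x < refl_monom a b x"
proof (cases "0 < fst x")
  case True
  then show ?thesis unfolding refl_monom_def
    using assms by (intro mult_less_le_imp_less power_strict_mono power_mono) auto
next
  case False
  with supportD[OF assms(7)] have "0 < snd x" by linarith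
  then show ?thesis unfolding refl_monom_def
    using assms by (intro mult_le_less_imp_less power_strict_mono power_mono) auto
qed

lemma gen_fun_strict_mono:
  assumes "0 < a'" "a' < a" "a \<le> 1" "0 < b'" "b' < b" "b \<le> 1"
  shows "gen_fun w a' b' < gen_fun w a b"
proof -
  obtain y where y: "y \<in> set_pmf w" using set_pmf_not_empty[of w] by blast
  have i: "integrable (measure_pmf w) (refl_monom a b)" "integrable (measure_pmf w) (refl_monom a' b')"
    using assms by (auto intro: integrable_refl_monom)
  have "0 < measure_pmf.expectation w (\<lambda>x. refl_monom a b x - refl_monom a' b' x)"
    using refl_monom_strict_mono[OF assms] i y
    by (intro integral_pmf_pos[where y = y]) (auto intro: less_imp_le)
  then show ?thesis unfolding gen_fun_eq using i by simp
qed

lemma gen_fun_less_1: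
  assumes "0 < a" "a < 1" "0 < b" "b \<le> 1" "y \<in> set_pmf w" "0 < fst y"
  shows "gen_fun w a b < 1"
proof -
  have i: "integrable (measure_pmf w) (refl_monom a b)"
    using assms by (auto intro: integrable_refl_monom)
  have "refl_monom a b y \<le> a ^ nat (fst y) * 1"
    unfolding refl_monom_def using assms by (intro mult_left_mono power_le_one) auto
  also have "\<dots> < 1" using assms by (simp add: power_less_one_iff)
  finally have "refl_monom a b y < 1" .
  then have "0 < measure_pmf.expectation w (\<lambda>x. 1 - refl_monom a b x)"
    using i assms refl_monom_unit[of a b]
    by (intro integral_pmf_pos[where y = y]) auto
  then show ?thesis unfolding gen_fun_eq using i by simp
qed

lemma gen_fun_pos:
  assumes "0 < a" "a \<le> 1" "0 < b" "b \<le> 1"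
  shows "0 < gen_fun w a b"
proof -
  obtain y where y: "y \<in> set_pmf w" using set_pmf_not_empty[of w] by blast
  show ?thesis unfolding gen_fun_eq using assms y
    by (intro integral_pmf_pos[where y = y] integrable_refl_monom) (auto simp: refl_monom_def)
qed

end

section \<open>Action of one step on monomials\<close>

text \<open>The truncation by \<open>nat\<close> is harmless: jumps of positive probability keep the
  walk in the quadrant.\<close>

definition move :: "nat \<times> nat \<Rightarrow> int \<times> int \<Rightarrow> nat \<times> nat" where
  "move s x = (nat (int (fst s) + fst x), nat (int (snd s) + snd x))"

definition monom2 :: "real \<Rightarrow> real \<Rightarrow> nat \<times> nat \<Rightarrow> real" where
  "monom2 a b s = a ^ fst s * b ^ snd s"

lemma monom2_unit: "0 \<le> a \<Longrightarrow> a \<le> 1 \<Longrightarrow> 0 \<le> b \<Longrightarrow> b \<le> 1 \<Longrightarrow> 0 \<le> monom2 a b x \<and> monom2 a b x \<le> 1"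
  by (simp add: monom2_def mult_le_one power_le_one)

lemma integrable_monom2:
  "0 \<le> a \<Longrightarrow> a \<le> 1 \<Longrightarrow> 0 \<le> b \<Longrightarrow> b \<le> 1 \<Longrightarrow> integrable (measure_pmf w) (\<lambda>x. monom2 a b (f x))"
  by (intro measure_pmf.integrable_const_bound[where B = 1]) (auto simp: monom2_unit)

text \<open>The factor \<open>a * b\<close> clears the possible exponent -1. At a zero of the kernel
  \<open>ker_sum a b\<close> equals \<open>a * b\<close>, so the monomial is harmonic for interior
  steps.\<close>

lemma (in step_law) integral_monom2:
  assumes "0 < fst s" "0 < snd s"
  shows "a * b * measure_pmf.expectation p (\<lambda>x. monom2 a b (move s x)) = ker_sum a b * monom2 a b s"
proof -
  obtain i j where s: "s = (Suc i, Suc j)"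
    using assms by (metis gr0_conv_Suc prod.collapse)
  have "monom2 a b (move s x) = monom2 a b (i, j) * jump_monom a b x" if "x \<in> set_pmf p" for x
  proof -
    have "nat (int (Suc i) + fst x) = i + nat (fst x + 1)" "nat (int (Suc j) + snd x) = j + nat (snd x + 1)"
      using support[OF that] nat_add_distrib[of "int i" "fst x + 1"] nat_add_distrib[of "int j" "snd x + 1"]
      by (simp_all add: algebra_simps)
    then show ?thesis by (simp add: s move_def monom2_def jump_monom_def power_add algebra_simps)
  qed
  then have "measure_pmf.expectation p (\<lambda>x. monom2 a b (move s x))
      = measure_pmf.expectation p (\<lambda>x. monom2 a b (i, j) * jump_monom a b x)"
    by (intro integral_cong_AE) (auto simp: AE_measure_pmf_iff)
  then show ?thesis by (simp add: ker_sum_def s monom2_def)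
qed

lemma (in reflection_law) integral_monom2_refl:
  "measure_pmf.expectation w (\<lambda>x. monom2 a b (move s x)) = gen_fun w a b * monom2 a b s"
proof -
  have "monom2 a b (move s x) = monom2 a b s * refl_monom a b x" if "x \<in> set_pmf w" for x
    using supportD[OF that]
    by (simp add: move_def monom2_def refl_monom_def power_add nat_add_distrib algebra_simps)
  then have "measure_pmf.expectation w (\<lambda>x. monom2 a b (move s x))
      = measure_pmf.expectation w (\<lambda>x. monom2 a b s * refl_monom a b x)"
    by (intro integral_cong_AE) (auto simp: AE_measure_pmf_iff)
  then show ?thesis by (simp add: gen_fun_eq)
qed

lemma norm_denominator:
  fixes z :: "'a::real_normed_field"
  assumes "norm z \<le> R" "0 \<le> b" "b \<le> c"
  shows "1 - R * c \<le> norm (1 - z * of_real b)"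
proof -
  have "norm (z * of_real b) \<le> R * c"
    using assms order_trans[OF norm_ge_zero assms(1)] by (auto simp: norm_mult intro!: mult_mono)
  then show ?thesis using norm_triangle_ineq2[of 1 "z * of_real b"] by simp
qed

section \<open>The compensation series in the direction of positive indices\<close>

locale compensation = step_law p + h: reflection_law h + v: reflection_law v for p h v
begin

text \<open>Up to sign, \<open>h_ratio n\<close> leads from d_(n+1) to c_(n+1) and
  \<open>v_ratio n\<close> from c_(n+1) to d_(n+2). The field is left open: complex arguments serve
  holomorphy, real ones the limit constant.\<close>

definition h_ratio :: "nat \<Rightarrow> 'a::real_normed_field \<Rightarrow> 'a" where
  "h_ratio n z = (1 - z * of_real (gen_fun h (xs n) (ys n))) /
                 (1 - z * of_real (gen_fun h (xs n) (ys (Suc n))))"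

definition v_ratio :: "nat \<Rightarrow> 'a::real_normed_field \<Rightarrow> 'a" where
  "v_ratio n z = (1 - z * of_real (gen_fun v (xs n) (ys (Suc n)))) /
                 (1 - z * of_real (gen_fun v (xs (Suc n)) (ys (Suc n))))"

text \<open>\<open>dq n\<close> and \<open>cq n\<close> are the quotients \<open>d\<^sub>n\<^sub>+\<^sub>1 / d\<^sub>1\<close> and \<open>c\<^sub>n\<^sub>+\<^sub>1 / d\<^sub>1\<close>.\<close>

definition dq :: "nat \<Rightarrow> 'a::real_normed_field \<Rightarrow> 'a" where
  "dq n z = (\<Prod>k<n. h_ratio k z * v_ratio k z)"

definition cq :: "nat \<Rightarrow> 'a::real_normed_field \<Rightarrow> 'a" where
  "cq n z = - dq n z * h_ratio n z"

text \<open>By monotonicity the largest generating function value in any denominator occurs at the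
  first index of each kind, so all ratios are regular for |z| below
  \<open>1 / pole_bound\<close>.\<close>

definition pole_bound :: real where
  "pole_bound = max (gen_fun v (xs 1) (ys 1)) (gen_fun h (xs 0) (ys 1))"

lemma pole_bound_pos: "0 < pole_bound"
  unfolding pole_bound_def using v.gen_fun_pos[of "xs 1" "ys 1"] xs_bounds[of 1] ys_bounds[of 1]
  by simp

lemma pole_bound_less_1: "pole_bound < 1"
proof -
  have "ys 1 < 1" using ys_Suc_less[of 0] xs_bounds[of 0] by simp
  then show ?thesis
    unfolding pole_bound_def using v.gen_fun_bounds(2)[of "xs 1" "ys 1"]
      h.gen_fun_bounds(2)[of "xs 0" "ys 1"] xs_bounds[of 1] xs_bounds[of 0] ys_bounds[of 1]
    by simp
qed

lemma pole_le:
  "gen_fun h (xs n) (ys (Suc n)) \<le> pole_bound" "gen_fun v (xs (Suc n)) (ys (Suc n)) \<le> pole_bound"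
  using h.gen_fun_mono[of "xs n" "xs 0" "ys (Suc n)" "ys 1"] v.gen_fun_mono[of "xs (Suc n)" "xs 1" "ys (Suc n)" "ys 1"]
    xs_bounds[of n] xs_bounds[of 0] xs_bounds[of "Suc n"] xs_bounds[of 1] ys_bounds[of 1] ys_bounds[of "Suc n"]
    xs_decreasing[of 0 n] xs_decreasing[of 1 "Suc n"] ys_decreasing[of 1 "Suc n"]
  by (auto simp: pole_bound_def)

lemma pole_nonneg: "0 \<le> gen_fun h (xs n) (ys (Suc n))" "0 \<le> gen_fun v (xs (Suc n)) (ys (Suc n))"
  using h.gen_fun_bounds[of "xs n" "ys (Suc n)"] v.gen_fun_bounds[of "xs (Suc n)" "ys (Suc n)"]
    xs_bounds[of n] xs_bounds[of "Suc n"] ys_bounds[of "Suc n"] by auto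

lemma denominator_nonzero:
  fixes z :: "'a::real_normed_field"
  assumes "norm z * pole_bound < 1"
  shows "1 - z * of_real (gen_fun h (xs n) (ys (Suc n))) \<noteq> 0"
    "1 - z * of_real (gen_fun v (xs (Suc n)) (ys (Suc n))) \<noteq> 0"
  using norm_denominator[OF order_refl pole_nonneg(1) pole_le(1), of z n]
    norm_denominator[OF order_refl pole_nonneg(2) pole_le(2), of z n] assms by force+

text \<open>The quotient is 1 + z (b - a) / (1 - z b), and 1 + r is at most exp r. The exponent is
  linear in \<open>y\<close>, so that products become exponentials of summable series.\<close>

lemma norm_ratio_le:
  fixes z :: "'a::real_normed_field"
  assumes "norm z \<le> R" "R * pole_bound < 1" "0 \<le> a" "a \<le> y" "0 \<le> b" "b \<le> y" "b \<le> pole_bound"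
  shows "norm ((1 - z * of_real a) / (1 - z * of_real b)) \<le> exp (R * y / (1 - R * pole_bound))"
proof -
  have R: "0 \<le> R" using norm_ge_zero assms(1) by (rule order_trans)
  have d: "1 - R * pole_bound \<le> norm (1 - z * of_real b)"
    using norm_denominator assms by blast
  then have nz: "1 - z * of_real b \<noteq> 0" using assms(2) by force
  have "(1 - z * of_real a) / (1 - z * of_real b) = 1 + z * of_real (b - a) / (1 - z * of_real b)"
    using nz by (simp add: field_simps)
  also have "norm \<dots> \<le> 1 + norm (z * of_real (b - a) / (1 - z * of_real b))"
    by (rule order_trans[OF norm_triangle_ineq]) simp
  also have "norm (z * of_real (b - a) / (1 - z * of_real b)) \<le> R * y / (1 - R * pole_bound)"
    unfolding norm_divide norm_mult norm_of_real
    using assms d R by (intro frac_le mult_mono) auto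
  also have "1 + R * y / (1 - R * pole_bound) \<le> exp (R * y / (1 - R * pole_bound))"
    by (rule exp_ge_add_one_self)
  finally show ?thesis by simp
qed

lemma norm_ratios:
  fixes z :: "'a::real_normed_field"
  assumes "norm z \<le> R" "R * pole_bound < 1"
  shows "norm (h_ratio n z) \<le> exp (R * ys n / (1 - R * pole_bound))"
    "norm (v_ratio n z) \<le> exp (R * ys n / (1 - R * pole_bound))"
proof -
  note b = xs_bounds[of n] ys_bounds[of n] ys_bounds[of "Suc n"] ys_Suc_less[of n] xs_bounds[of "Suc n"]
  show "norm (h_ratio n z) \<le> exp (R * ys n / (1 - R * pole_bound))"
    unfolding h_ratio_def
    by (rule norm_ratio_le[OF assms]) (use b h.gen_fun_bounds[of "xs n" "ys n"]
      h.gen_fun_bounds[of "xs n" "ys (Suc n)"] pole_le in auto)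
  show "norm (v_ratio n z) \<le> exp (R * ys n / (1 - R * pole_bound))"
    unfolding v_ratio_def
    by (rule norm_ratio_le[OF assms]) (use b v.gen_fun_bounds[of "xs n" "ys (Suc n)"]
      v.gen_fun_bounds[of "xs (Suc n)" "ys (Suc n)"] pole_le in auto)
qed

lemma coeff_bound:
  assumes "0 \<le> R" "R * pole_bound < 1"
  obtains B where "0 < B"
    "\<And>n (z :: 'a::real_normed_field). norm z \<le> R \<Longrightarrow> norm (dq n z) \<le> B"
    "\<And>n (z :: 'a::real_normed_field). norm z \<le> R \<Longrightarrow> norm (cq n z) \<le> B"
proof
  define r where "r = R / (1 - R * pole_bound)"
  have r: "0 \<le> r" using assms by (simp add: r_def)
  define B where "B = exp (2 * r * suminf ys)"
  show "0 < B" by (simp add: B_def)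
  \<comment> \<open>Indices below n count twice, for \<open>h_ratio\<close> and
    \<open>v_ratio\<close>; index n counts once, for the extra \<open>h_ratio n\<close> in
    \<open>cq n\<close>.\<close>
  have part: "2 * (\<Sum>k<n. ys k) + ys n \<le> 2 * suminf ys" for n
  proof -
    have "(\<Sum>k<Suc n. ys k) \<le> suminf ys"
      using ys_bounds by (intro sum_le_suminf summable_ys) (auto intro: less_imp_le)
    then show ?thesis using ys_bounds[of n] by simp
  qed
  fix n and z :: 'a
  assume z: "norm z \<le> R"
  have nr: "norm (h_ratio k z) \<le> exp (r * ys k)" "norm (v_ratio k z) \<le> exp (r * ys k)" for k
    using norm_ratios[OF z assms(2), of k] by (simp_all add: r_def)
  have "norm (dq n z) = (\<Prod>k<n. norm (h_ratio k z) * norm (v_ratio k z))"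
    by (simp add: dq_def prod_norm[symmetric] norm_mult)
  also have "\<dots> \<le> (\<Prod>k<n. exp (r * ys k) * exp (r * ys k))"
    by (intro prod_mono conjI mult_mono nr mult_nonneg_nonneg) auto
  also have "\<dots> = exp (2 * r * (\<Sum>k<n. ys k))"
    by (simp add: exp_sum sum_distrib_left exp_add[symmetric] mult.assoc)
  finally have d: "norm (dq n z) \<le> exp (2 * r * (\<Sum>k<n. ys k))" .
  also have "\<dots> \<le> B"
    using mult_left_mono[OF part[of n] r] ys_bounds[of n] mult_nonneg_nonneg[OF r, of "ys n"]
    by (simp add: B_def algebra_simps)
  finally show "norm (dq n z) \<le> B" .
  have "norm (cq n z) \<le> exp (2 * r * (\<Sum>k<n. ys k)) * exp (r * ys n)"
    unfolding cq_def norm_mult norm_minus_cancel by (intro mult_mono d nr) auto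
  also have "\<dots> \<le> B"
    using mult_left_mono[OF part[of n] r] by (simp add: B_def exp_add[symmetric] algebra_simps)
  finally show "norm (cq n z) \<le> B" .
qed

text \<open>Grouped as in S_1: the two monomials share the base \<open>xs n\<close>, so within a
  term they agree on the horizontal axis.\<close>

definition comp_term :: "nat \<Rightarrow> 'a::{real_normed_field} \<Rightarrow> nat \<times> nat \<Rightarrow> 'a" where
  "comp_term n z s = dq n z * of_real (monom2 (xs n) (ys n) s) + cq n z * of_real (monom2 (xs n) (ys (Suc n)) s)"

definition comp_series :: "'a::{real_normed_field,banach} \<Rightarrow> nat \<times> nat \<Rightarrow> 'a" where
  "comp_series z s = (\<Sum>n. comp_term n z s)"

text \<open>Away from the origin one factor can be spared to supply the summable
  \<open>ys n\<close>; the remaining powers of \<open>xs 0\<close> are kept as decay in the first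
  coordinate.\<close>

lemma monom2_xs_ys_le:
  assumes "s \<noteq> (0, 0)" "0 \<le> y" "y \<le> ys n"
  shows "monom2 (xs n) y s \<le> xs 0 ^ fst s / xs 0 * ys n"
proof (cases "fst s")
  case 0
  then obtain j where j: "snd s = Suc j" using assms by (metis not0_implies_Suc prod.collapse)
  have "y * y ^ j \<le> ys n * 1"
    using assms ys_bounds[of n] by (intro mult_mono power_le_one) auto
  also have "\<dots> \<le> ys n / xs 0"
    using xs_bounds[of 0] ys_bounds[of n] by (simp add: pos_le_divide_eq mult_left_le)
  finally show ?thesis using 0 j by (simp add: monom2_def)
next
  case (Suc i)
  have "xs n * xs n ^ i * y ^ snd s \<le> ys n * xs 0 ^ i * 1"
    using assms xs_bounds[of n] ys_bounds[of n] xs_decreasing[of 0 n]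
    by (intro mult_mono power_le_one power_mono) auto
  then show ?thesis using Suc xs_bounds[of 0] by (simp add: monom2_def algebra_simps)
qed

lemma comp_term_bound:
  assumes "0 \<le> R" "R * pole_bound < 1"
  obtains C where "0 < C"
    "\<And>n (z :: 'a::real_normed_field) s. norm z \<le> R \<Longrightarrow> s \<noteq> (0, 0) \<Longrightarrow>
      norm (comp_term n z s) \<le> C * xs 0 ^ fst s * ys n"
proof -
  obtain B where B: "0 < B"
    "\<And>n (z :: 'a). norm z \<le> R \<Longrightarrow> norm (dq n z) \<le> B"
    "\<And>n (z :: 'a). norm z \<le> R \<Longrightarrow> norm (cq n z) \<le> B"
    using coeff_bound[OF assms] by metis
  show ?thesis
  proof
    show "0 < 2 * B / xs 0" using B xs_bounds by simp
    fix n :: nat and s :: "nat \<times> nat" and z :: 'a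
    assume z: "norm z \<le> R" and s: "s \<noteq> (0, 0)"
    have yS: "0 \<le> ys (Suc n)" "ys (Suc n) \<le> ys n"
      using ys_bounds[of "Suc n"] ys_decreasing[of n "Suc n"] by auto
    have nn: "0 \<le> monom2 (xs n) (ys n) s" "0 \<le> monom2 (xs n) (ys (Suc n)) s"
      using xs_bounds[of n] ys_bounds[of n] yS by (auto simp: monom2_def)
    have "norm (comp_term n z s) \<le> norm (dq n z) * monom2 (xs n) (ys n) s + norm (cq n z) * monom2 (xs n) (ys (Suc n)) s"
      unfolding comp_term_def
      by (rule order_trans[OF norm_triangle_ineq]) (simp add: norm_mult nn)
    also have "\<dots> \<le> B * (xs 0 ^ fst s / xs 0 * ys n) + B * (xs 0 ^ fst s / xs 0 * ys n)"
      using B(1) z yS ys_bounds[of n]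
      by (intro add_mono mult_mono B(2,3) monom2_xs_ys_le s nn) auto
    also have "\<dots> = 2 * B / xs 0 * xs 0 ^ fst s * ys n" by (simp add: algebra_simps)
    finally show "norm (comp_term n z s) \<le> 2 * B / xs 0 * xs 0 ^ fst s * ys n" .
  qed
qed

lemma summable_norm_comp_term:
  fixes z :: "'a::{real_normed_field,banach}"
  assumes "norm z * pole_bound < 1" "s \<noteq> (0, 0)"
  shows "summable (\<lambda>n. norm (comp_term n z s))"
proof -
  obtain C where C: "0 < C" "\<And>n (z' :: 'a) s. norm z' \<le> norm z \<Longrightarrow> s \<noteq> (0, 0) \<Longrightarrow>
      norm (comp_term n z' s) \<le> C * xs 0 ^ fst s * ys n"
    using comp_term_bound[OF norm_ge_zero assms(1)] by metis
  show ?thesis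
    by (rule summable_comparison_test'[OF summable_mult[OF summable_ys], where N = 0])
      (use C(2)[OF order_refl assms(2)] in simp)
qed

lemma comp_series_bound:
  assumes "0 \<le> R" "R * pole_bound < 1"
  obtains C where "0 < C"
    "\<And>(z :: 'a::{real_normed_field,banach}) s. norm z \<le> R \<Longrightarrow> s \<noteq> (0, 0) \<Longrightarrow> norm (comp_series z s) \<le> C * xs 0 ^ fst s"
proof -
  obtain C where C: "0 < C" "\<And>n (z :: 'a) s. norm z \<le> R \<Longrightarrow> s \<noteq> (0, 0) \<Longrightarrow>
      norm (comp_term n z s) \<le> C * xs 0 ^ fst s * ys n"
    using comp_term_bound[OF assms] by metis
  have ypos: "0 < suminf ys" using ys_bounds by (intro suminf_pos summable_ys) auto
  show ?thesis
  proof
    show "0 < C * suminf ys" using C ypos by simp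
    fix z :: 'a and s :: "nat \<times> nat" assume z: "norm z \<le> R" "s \<noteq> (0, 0)"
    have "norm (comp_series z s) \<le> (\<Sum>n. C * xs 0 ^ fst s * ys n)"
      unfolding comp_series_def
      by (rule norm_suminf_le[OF C(2)[OF z] summable_mult[OF summable_ys]])
    also have "\<dots> = C * xs 0 ^ fst s * suminf ys" by (rule suminf_mult[OF summable_ys])
    finally show "norm (comp_series z s) \<le> C * suminf ys * xs 0 ^ fst s"
      by (simp add: mult_ac)
  qed
qed

lemma integrable_comp_term:
  fixes z :: complex
  shows "integrable (measure_pmf w) (\<lambda>x. comp_term n z (f x))"
  unfolding comp_term_def
  using xs_bounds[of n] ys_bounds[of n] ys_bounds[of "Suc n"]
  by (intro Bochner_Integration.integrable_add integrable_mult_right integrable_of_real integrable_monom2) auto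

lemma integral_comp_series:
  fixes z :: complex
  assumes z: "norm z * pole_bound < 1" and ne: "\<And>x. x \<in> set_pmf w \<Longrightarrow> f x \<noteq> (0, 0)"
  shows "(\<lambda>n. measure_pmf.expectation w (\<lambda>x. comp_term n z (f x))) sums
    measure_pmf.expectation w (\<lambda>x. comp_series z (f x))"
  unfolding comp_series_def
proof (rule sums_integral)
  obtain C where C: "0 < C" "\<And>n (z' :: complex) s. norm z' \<le> norm z \<Longrightarrow> s \<noteq> (0, 0) \<Longrightarrow>
      norm (comp_term n z' s) \<le> C * xs 0 ^ fst s * ys n"
    using comp_term_bound[OF norm_ge_zero z] by metis
  show "AE x in measure_pmf w. summable (\<lambda>n. norm (comp_term n z (f x)))"
    using ne by (auto simp: AE_measure_pmf_iff intro: summable_norm_comp_term[OF z])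
  show "summable (\<lambda>n. measure_pmf.expectation w (\<lambda>x. norm (comp_term n z (f x))))"
  proof (rule summable_comparison_test'[OF summable_mult[OF summable_ys, of C], where N = 0])
    fix n
    have "norm (comp_term n z (f x)) \<le> C * ys n" if "x \<in> set_pmf w" for x
    proof -
      have "C * xs 0 ^ fst (f x) * ys n \<le> C * 1 * ys n"
        using C ys_bounds[of n] xs_bounds[of 0] by (intro mult_mono power_le_one) auto
      then show ?thesis using C(2)[OF order_refl ne[OF that], of n] by simp
    qed
    then have "measure_pmf.expectation w (\<lambda>x. norm (comp_term n z (f x))) \<le> measure_pmf.expectation w (\<lambda>x. C * ys n)"
      by (intro integral_mono_AE integrable_norm integrable_comp_term) (auto simp: AE_measure_pmf_iff)
    then show "norm (measure_pmf.expectation w (\<lambda>x. norm (comp_term n z (f x)))) \<le> C * ys n"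
      by simp
  qed
qed (rule integrable_comp_term)

lemma expectation_comp_term:
  fixes z :: complex
  shows "measure_pmf.expectation w (\<lambda>x. comp_term n z (f x)) =
    dq n z * of_real (measure_pmf.expectation w (\<lambda>x. monom2 (xs n) (ys n) (f x))) +
    cq n z * of_real (measure_pmf.expectation w (\<lambda>x. monom2 (xs n) (ys (Suc n)) (f x)))"
proof -
  have i: "integrable (measure_pmf w) (\<lambda>x. monom2 (xs n) (ys n) (f x))"
    "integrable (measure_pmf w) (\<lambda>x. monom2 (xs n) (ys (Suc n)) (f x))"
    using xs_bounds[of n] ys_bounds[of n] ys_bounds[of "Suc n"]
    by (auto intro!: integrable_monom2)
  show ?thesis
    unfolding comp_term_def integral_of_real[symmetric]
    using i by (subst Bochner_Integration.integral_add) auto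
qed

lemma comp_series_sums:
  fixes z :: complex
  assumes "norm z * pole_bound < 1" "s \<noteq> (0, 0)"
  shows "(\<lambda>n. comp_term n z s) sums comp_series z s"
  unfolding comp_series_def
  by (rule summable_sums[OF summable_norm_cancel[OF summable_norm_comp_term[OF assms]]])

lemma comp_series_interior:
  fixes z :: complex
  assumes z: "norm z * pole_bound < 1" and s: "0 < fst s" "0 < snd s"
  shows "measure_pmf.expectation p (\<lambda>x. comp_series z (move s x)) = comp_series z s"
proof -
  have ne: "move s x \<noteq> (0, 0)" if "x \<in> set_pmf p" for x
    using support[OF that] s by (auto simp: move_def)
  have "measure_pmf.expectation p (\<lambda>x. comp_term n z (move s x)) = comp_term n z s" for n
  proof -
    have "measure_pmf.expectation p (\<lambda>x. monom2 (xs n) y (move s x)) = monom2 (xs n) y s"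
      if "kernel p (xs n) y = 0" "0 < y" for y
      using integral_monom2[OF s, of "xs n" y] that xs_bounds[of n] by (simp add: kernel_eq)
    then show ?thesis
      unfolding expectation_comp_term
      using kernel_xs_ys kernel_xs_ys_Suc ys_bounds by (simp add: comp_term_def)
  qed
  then have "(\<lambda>n. comp_term n z s) sums measure_pmf.expectation p (\<lambda>x. comp_series z (move s x))"
    using integral_comp_series[OF z ne, of p "\<lambda>x. x"] by simp
  then show ?thesis using comp_series_sums[OF z, of s] s sums_unique2 by fastforce
qed

text \<open>Both monomials of a term reduce to the same power of \<open>xs n\<close>, and
  \<open>h_ratio\<close> is chosen so that the equation holds term by term.\<close>

lemma comp_series_h_boundary:
  fixes z :: complex
  assumes z: "norm z * pole_bound < 1" and s: "0 < fst s" "snd s = 0"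
  shows "z * measure_pmf.expectation h (\<lambda>x. comp_series z (move s x)) = comp_series z s"
proof -
  have ne: "move s x \<noteq> (0, 0)" if "x \<in> set_pmf h" for x
    using h.supportD[OF that] s by (auto simp: move_def)
  have "z * measure_pmf.expectation h (\<lambda>x. comp_term n z (move s x)) = comp_term n z s" for n
  proof -
    let ?a = "1 - z * of_real (gen_fun h (xs n) (ys n))"
    let ?b = "1 - z * of_real (gen_fun h (xs n) (ys (Suc n)))"
    have "cq n z * ?b = - dq n z * ?a"
      using denominator_nonzero(1)[OF z, of n] by (simp add: cq_def h_ratio_def)
    then have *: "dq n z * (z * of_real (gen_fun h (xs n) (ys n))) + cq n z * (z * of_real (gen_fun h (xs n) (ys (Suc n))))
       = dq n z + cq n z"
      by (simp add: algebra_simps)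
    have m: "monom2 (xs n) y s = xs n ^ fst s" for y using s by (simp add: monom2_def)
    have "z * measure_pmf.expectation h (\<lambda>x. comp_term n z (move s x))
      = (dq n z * (z * of_real (gen_fun h (xs n) (ys n))) + cq n z * (z * of_real (gen_fun h (xs n) (ys (Suc n)))))
        * of_real (xs n ^ fst s)"
      unfolding expectation_comp_term h.integral_monom2_refl m by (simp add: algebra_simps)
    then show ?thesis unfolding * by (simp add: comp_term_def m algebra_simps)
  qed
  then have "(\<lambda>n. comp_term n z s) sums (z * measure_pmf.expectation h (\<lambda>x. comp_series z (move s x)))"
    using sums_mult[OF integral_comp_series[OF z ne, of h "\<lambda>x. x"], of z] by simp
  then show ?thesis using comp_series_sums[OF z, of s] s sums_unique2 by fastforce
qed

text \<open>Here cancellation links \<open>cq n\<close> with \<open>dq (Suc n)\<close>, whose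
  monomials share \<open>ys (Suc n)\<close>. The sum telescopes and only the defect of the very
  first monomial remains.\<close>

lemma comp_series_v_boundary:
  fixes z :: complex
  assumes z: "norm z * pole_bound < 1" and s: "fst s = 0" "0 < snd s"
  shows "z * measure_pmf.expectation v (\<lambda>x. comp_series z (move s x)) =
    comp_series z s - (1 - z * of_real (gen_fun v (xs 0) 1))"
proof -
  have ne: "move s x \<noteq> (0, 0)" if "x \<in> set_pmf v" for x
    using v.supportD[OF that] s by (auto simp: move_def)
  \<comment> \<open>The defect left on the vertical axis by the first monomial of term n.\<close>
  define t where "t n = dq n z * (1 - z * of_real (gen_fun v (xs n) (ys n))) * of_real (ys n ^ snd s)" for n
  have m: "monom2 a y s = y ^ snd s" for a y using s by (simp add: monom2_def)
  have step: "comp_term n z s - z * measure_pmf.expectation v (\<lambda>x. comp_term n z (move s x)) = t n - t (Suc n)" for n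
  proof -
    let ?a = "1 - z * of_real (gen_fun v (xs n) (ys (Suc n)))"
    let ?b = "1 - z * of_real (gen_fun v (xs (Suc n)) (ys (Suc n)))"
    have *: "cq n z * ?a = - dq (Suc n) z * ?b"
      using denominator_nonzero(2)[OF z, of n] by (simp add: cq_def dq_def v_ratio_def)
    have "comp_term n z s - z * measure_pmf.expectation v (\<lambda>x. comp_term n z (move s x))
      = t n + cq n z * ?a * of_real (ys (Suc n) ^ snd s)"
      unfolding expectation_comp_term v.integral_monom2_refl unfolding comp_term_def m t_def
      by (simp add: algebra_simps)
    also have "cq n z * ?a * of_real (ys (Suc n) ^ snd s) = - t (Suc n)"
      unfolding * t_def by simp
    finally show ?thesis by simp
  qed
  have "t \<longlonglongrightarrow> 0"
  proof -
    obtain B where B: "\<And>n (z' :: complex). norm z' \<le> norm z \<Longrightarrow> norm (dq n z') \<le> B" "0 < B"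
      using coeff_bound[OF norm_ge_zero z] by metis
    obtain j where j: "snd s = Suc j" using s gr0_conv_Suc by blast
    have "norm (t n) \<le> B * (1 + norm z) * ys n" for n
    proof -
      have g: "0 \<le> gen_fun v (xs n) (ys n)" "gen_fun v (xs n) (ys n) \<le> 1"
        using v.gen_fun_bounds[of "xs n" "ys n"] xs_bounds[of n] ys_bounds[of n] by auto
      have "norm (1 - z * of_real (gen_fun v (xs n) (ys n))) \<le> 1 + norm (z * of_real (gen_fun v (xs n) (ys n)))"
        by (rule order_trans[OF norm_triangle_ineq4]) simp
      also have "\<dots> \<le> 1 + norm z * 1"
        unfolding norm_mult norm_of_real using g by (intro add_left_mono mult_left_mono) auto
      finally have 1: "norm (1 - z * of_real (gen_fun v (xs n) (ys n))) \<le> 1 + norm z" by simp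
      have 2: "ys n ^ snd s \<le> ys n"
        using ys_bounds[of n] by (simp add: j mult_left_le power_le_one)
      show ?thesis unfolding t_def norm_mult norm_of_real
        using B 1 2 ys_bounds[of n] by (intro mult_mono) auto
    qed
    moreover have "(\<lambda>n. B * (1 + norm z) * ys n) \<longlonglongrightarrow> 0"
      using tendsto_mult_right_zero[OF summable_LIMSEQ_zero[OF summable_ys]] by blast
    ultimately show ?thesis
      by (intro Lim_null_comparison[where f = t and g = "\<lambda>n. B * (1 + norm z) * ys n"] always_eventually allI)
  qed
  then have "(\<lambda>n. t n - t (Suc n)) sums (t 0 - 0)" by (rule telescope_sums')
  moreover have "t 0 = 1 - z * of_real (gen_fun v (xs 0) 1)" by (simp add: t_def dq_def ys_0)
  moreover have "(\<lambda>n. comp_term n z s - z * measure_pmf.expectation v (\<lambda>x. comp_term n z (move s x))) sums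
    (comp_series z s - z * measure_pmf.expectation v (\<lambda>x. comp_series z (move s x)))"
    using s by (intro sums_diff sums_mult integral_comp_series comp_series_sums z ne) auto
  ultimately have "comp_series z s - z * measure_pmf.expectation v (\<lambda>x. comp_series z (move s x))
      = 1 - z * of_real (gen_fun v (xs 0) 1)"
    unfolding step by (metis diff_zero sums_unique2)
  then show ?thesis by (simp add: algebra_simps)
qed

lemma comp_series_holomorphic:
  assumes "s \<noteq> (0, 0)"
  shows "(\<lambda>z. comp_series z s) holomorphic_on ball 0 (1 / pole_bound)"
proof (rule holomorphic_uniform_sequence[where f = "\<lambda>n z. \<Sum>k<n. comp_term k z s"])
  show "open (ball 0 (1 / pole_bound) :: complex set)" by simp
  have nb: "norm z * pole_bound < 1" if "z \<in> ball 0 (1 / pole_bound)" for z :: complex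
    using that pole_bound_pos by (simp add: field_simps)
  show "(\<lambda>z. \<Sum>k<n. comp_term k z s) holomorphic_on ball 0 (1 / pole_bound)" for n
    unfolding comp_term_def cq_def dq_def h_ratio_def v_ratio_def
    using denominator_nonzero[OF nb] by (intro holomorphic_intros) auto
  fix x :: complex assume x: "x \<in> ball 0 (1 / pole_bound)"
  define R where "R = (norm x + 1 / pole_bound) / 2"
  have R: "norm x < R" "R < 1 / pole_bound" using x by (auto simp: R_def)
  then have R2: "0 \<le> R" "R * pole_bound < 1"
    using pole_bound_pos norm_ge_zero[of x] by (auto simp: field_simps simp del: norm_ge_zero)
  obtain C where C: "0 < C" "\<And>n (z :: complex) s. norm z \<le> R \<Longrightarrow> s \<noteq> (0, 0) \<Longrightarrow>
      norm (comp_term n z s) \<le> C * xs 0 ^ fst s * ys n"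
    using comp_term_bound[OF R2] by metis
  have "cball x (R - norm x) \<subseteq> cball 0 R"
    by (auto simp: subset_iff dist_norm) (smt (verit) norm_minus_commute norm_triangle_sub)
  moreover have "cball 0 R \<subseteq> (ball 0 (1 / pole_bound) :: complex set)" using R by auto
  moreover have "uniform_limit (cball 0 R) (\<lambda>n (z :: complex). \<Sum>k<n. comp_term k z s) (\<lambda>z. comp_series z s) sequentially"
    unfolding comp_series_def
    by (rule Weierstrass_m_test[OF _ summable_mult[OF summable_ys, of "C * xs 0 ^ fst s"]])
      (use C(2) assms in simp)
  ultimately show "\<exists>d>0. cball x d \<subseteq> ball 0 (1 / pole_bound) \<and>
      uniform_limit (cball x d) (\<lambda>n z. \<Sum>k<n. comp_term k z s) (\<lambda>z. comp_series z s) sequentially"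
    using R by (intro exI[of _ "R - norm x"]) (auto intro: uniform_limit_on_subset)
qed

end

section \<open>The generating function of the number of contacts\<close>

lemma integrable_pmf_bounded:
  fixes f :: "'a \<Rightarrow> 'b::{banach, second_countable_topology}"
  shows "(\<And>x. x \<in> set_pmf w \<Longrightarrow> norm (f x) \<le> B) \<Longrightarrow> integrable (measure_pmf w) f"
  by (intro measure_pmf.integrable_const_bound[where B = B]) (auto simp: AE_measure_pmf_iff)

lemma norm_integral_pmf_le:
  fixes f :: "'a \<Rightarrow> 'b::{banach, second_countable_topology}"
  assumes "\<And>x. x \<in> set_pmf w \<Longrightarrow> norm (f x) \<le> B"
  shows "norm (measure_pmf.expectation w f) \<le> B"
proof -
  have "norm (measure_pmf.expectation w f) \<le> measure_pmf.expectation w (\<lambda>x. norm (f x))"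
    by (rule integral_norm_bound)
  also have "\<dots> \<le> measure_pmf.expectation w (\<lambda>_. B)"
    using assms
    by (intro integral_mono_AE integrable_norm integrable_pmf_bounded[OF assms]) (auto simp: AE_measure_pmf_iff)
  finally show ?thesis by simp
qed

text \<open>Adding the bound \<open>B\<close> makes the integrand nonnegative, so the identity
  follows from the one for nonnegative integrals.\<close>

lemma integral_bind_pmf_bounded_real:
  fixes f :: "'b \<Rightarrow> real"
  assumes B: "\<And>x. \<bar>f x\<bar> \<le> B"
  shows "measure_pmf.expectation (bind_pmf w N) f = measure_pmf.expectation w (\<lambda>a. measure_pmf.expectation (N a) f)"
proof -
  let ?g = "\<lambda>x. f x + B"
  have g: "0 \<le> ?g x" "\<bar>?g x\<bar> \<le> 2 * B" for x using B[of x] by auto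
  have ig: "integrable (measure_pmf u) ?g" for u :: "'b pmf"
    using g by (intro integrable_pmf_bounded[where B = "2 * B"]) auto
  have i2: "integrable (measure_pmf w) (\<lambda>a. measure_pmf.expectation (N a) ?g)"
    using g by (intro integrable_pmf_bounded[where B = "2 * B"] norm_integral_pmf_le) auto
  have "ennreal (measure_pmf.expectation (bind_pmf w N) ?g) = (\<integral>\<^sup>+x. ?g x \<partial>bind_pmf w N)"
    using g by (intro nn_integral_eq_integral[symmetric] ig) auto
  also have "\<dots> = (\<integral>\<^sup>+a. ennreal (measure_pmf.expectation (N a) ?g) \<partial>w)"
    unfolding nn_integral_bind_pmf
    using g by (intro nn_integral_cong nn_integral_eq_integral ig) auto
  also have "\<dots> = ennreal (measure_pmf.expectation w (\<lambda>a. measure_pmf.expectation (N a) ?g))"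
    using g by (intro nn_integral_eq_integral i2) auto
  finally have "measure_pmf.expectation (bind_pmf w N) ?g = measure_pmf.expectation w (\<lambda>a. measure_pmf.expectation (N a) ?g)"
    using g by (subst (asm) ennreal_inj) (auto intro!: integral_nonneg_AE)
  moreover have i: "integrable (measure_pmf u) f" for u :: "'b pmf"
    using B by (intro integrable_pmf_bounded[where B = B]) auto
  moreover have "integrable (measure_pmf w) (\<lambda>a. measure_pmf.expectation (N a) f)"
    using B by (intro integrable_pmf_bounded[where B = B] norm_integral_pmf_le) auto
  ultimately show ?thesis by simp
qed

lemma integral_bind_pmf_bounded:
  fixes f :: "'b \<Rightarrow> complex"
  assumes B: "\<And>x. norm (f x) \<le> B"
  shows "measure_pmf.expectation (bind_pmf w N) f = measure_pmf.expectation w (\<lambda>a. measure_pmf.expectation (N a) f)"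
proof (rule complex_eqI)
  have i: "integrable (measure_pmf u) f" for u :: "'b pmf"
    using B by (intro integrable_pmf_bounded[where B = B]) auto
  have i': "integrable (measure_pmf w) (\<lambda>a. measure_pmf.expectation (N a) f)"
    using B by (intro integrable_pmf_bounded[where B = B] norm_integral_pmf_le) auto
  have B': "\<bar>Re (f x)\<bar> \<le> B" "\<bar>Im (f x)\<bar> \<le> B" for x
    using B[of x] abs_Re_le_cmod[of "f x"] abs_Im_le_cmod[of "f x"] by auto
  show "Re (measure_pmf.expectation (bind_pmf w N) f) = Re (measure_pmf.expectation w (\<lambda>a. measure_pmf.expectation (N a) f))"
    using integral_bind_pmf_bounded_real[of "\<lambda>x. Re (f x)" B w N] B' i i'
    by (simp flip: integral_Re)
  show "Im (measure_pmf.expectation (bind_pmf w N) f) = Im (measure_pmf.expectation w (\<lambda>a. measure_pmf.expectation (N a) f))"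
    using integral_bind_pmf_bounded_real[of "\<lambda>x. Im (f x)" B w N] B' i i'
    by (simp flip: integral_Im)
qed

lemma expectation_nat_pmf:
  fixes f :: "nat \<Rightarrow> complex"
  assumes "\<And>n. norm (f n) \<le> B"
  shows "measure_pmf.expectation w f = (\<Sum>n. of_real (pmf w n) * f n)"
proof -
  have "integrable (measure_pmf w) f" using assms by (intro integrable_pmf_bounded) auto
  then have "integrable (count_space UNIV) (\<lambda>n. pmf w n *\<^sub>R f n)"
    unfolding measure_pmf_eq_density by (subst (asm) integrable_density) auto
  moreover have "measure_pmf.expectation w f = (\<integral>n. pmf w n *\<^sub>R f n \<partial>count_space UNIV)"
    unfolding measure_pmf_eq_density by (subst integral_density) auto
  ultimately show ?thesis
    by (simp add: integral_count_space_nat scaleR_conv_of_real)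
qed

lemma (in reflection_law) reflection_law_swap: "reflection_law (map_pmf prod.swap w)"
  by unfold_locales (use refl_support in \<open>auto simp: pmf_swap\<close>)

lemma (in reflection_law) gen_fun_swap: "gen_fun (map_pmf prod.swap w) a b = gen_fun w b a"
proof -
  interpret sw: reflection_law "map_pmf prod.swap w" by (rule reflection_law_swap)
  have "(\<lambda>x. sw.refl_monom a b (prod.swap x)) = refl_monom b a"
    by (simp add: fun_eq_iff refl_monom_def sw.refl_monom_def)
  then show ?thesis by (simp add: gen_fun_eq sw.gen_fun_eq)
qed

lemma move_swap: "move (prod.swap s) (prod.swap x) = prod.swap (move s x)"
  by (simp add: move_def)

section \<open>The two series together and the counting chain\<close>

locale walk_data = compensation p h v + q: reflection_law q for p h v q +
  assumes h_up: "\<exists>x\<in>set_pmf h. 0 < snd x" and v_right: "\<exists>x\<in>set_pmf v. 0 < fst x"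
begin

text \<open>Transposition exchanges the axes, hence also the reflection laws;
  \<open>sw.comp_series\<close> at the swapped state is the series S_0.\<close>

sublocale sw: compensation "map_pmf prod.swap p" "map_pmf prod.swap v" "map_pmf prod.swap h"
  using step_law_swap h.reflection_law_swap v.reflection_law_swap
  by (simp add: compensation_def)

definition v1 :: real where "v1 = gen_fun v (xs 0) 1"
text \<open>\<open>v_star p 1\<close> is beta_(-1), so this is the value
  \<open>h_tilde_0 p h\<close>.\<close>

definition h0 :: real where "h0 = gen_fun h 1 (v_star p 1)"
definition rate :: real where "rate = max v1 h0"

lemma sw_xs_0: "sw.xs 0 = v_star p 1"
  by (simp add: sw.xs_eq sw.ys_0 v_star_swap)

lemma sw_v1: "gen_fun (map_pmf prod.swap h) (sw.xs 0) 1 = h0"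
  by (simp add: h.gen_fun_swap sw_xs_0 h0_def)

lemma v1_bounds: "0 < v1" "v1 < 1"
  using v_right v.gen_fun_pos[of "xs 0" 1] v.gen_fun_less_1[of "xs 0" 1] xs_bounds[of 0]
  by (auto simp: v1_def)

lemma h0_bounds: "0 < h0" "h0 < 1"
proof -
  show "0 < h0" "h0 < 1"
    using h_up sw.v.gen_fun_pos[of "sw.xs 0" 1] sw.v.gen_fun_less_1[of "sw.xs 0" 1] sw.xs_bounds[of 0]
    by (auto simp: sw_v1[symmetric])
qed

lemma rate_bounds: "0 < rate" "rate < 1" "v1 \<le> rate" "h0 \<le> rate"
  using v1_bounds h0_bounds by (auto simp: rate_def)

lemma v_star_1_bounds: "0 < v_star p 1" "v_star p 1 < 1"
  using v_star_props[of 1] by auto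

lemma xs_1_less: "xs 1 < xs 0" "ys 1 < 1"
  using xs_bounds[of 1] ys_Suc_less[of 0] xs_bounds[of 0] by auto

text \<open>Each generating function in \<open>pole_bound\<close> is compared at a point strictly
  smaller in both coordinates. The gap makes the series holomorphic on a disc strictly larger than
  that of radius \<open>1 / rate\<close>.\<close>

lemma pole_bound_less_rate: "pole_bound < rate"
proof -
  have "gen_fun v (xs 1) (ys 1) < v1"
    unfolding v1_def using xs_1_less xs_bounds[of 0] xs_bounds[of 1] ys_bounds[of 1]
    by (intro v.gen_fun_strict_mono) auto
  moreover have "gen_fun h (xs 0) (ys 1) < h0"
    unfolding h0_def using ys_1_less v_star_1_bounds xs_bounds[of 0] ys_bounds[of 1]
    by (intro h.gen_fun_strict_mono) auto
  ultimately show ?thesis by (auto simp: pole_bound_def rate_def)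
qed

text \<open>The transposed data satisfy the same locale, and transposition only exchanges the two
  arguments of the maximum in \<open>rate\<close>.\<close>

lemma sw_pole_bound_less_rate: "sw.pole_bound < rate"
proof -
  interpret sw: walk_data "map_pmf prod.swap p" "map_pmf prod.swap v" "map_pmf prod.swap h" "map_pmf prod.swap q"
    by unfold_locales (use h_up v_right q.reflection_law_swap in
      \<open>auto simp: reflection_law_def\<close>)
  have "sw.rate = rate"
    using step_law.v_star_swap[OF step_law_swap]
    by (simp add: sw.rate_def rate_def sw.v1_def sw.h0_def h0_def v1_def h.gen_fun_swap v.gen_fun_swap
        sw_xs_0 xs_eq ys_0 pmf.map_comp o_def max.commute)
  then show ?thesis using sw.pole_bound_less_rate by simp
qed

definition interior_state :: "nat \<times> nat \<Rightarrow> bool" where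
  "interior_state s \<longleftrightarrow> 0 < fst s \<and> 0 < snd s"

abbreviation law :: "nat \<times> nat \<Rightarrow> weights" where
  "law s \<equiv> increment_law p h v q s"

lemma law_nonzero: "s \<noteq> (0, 0) \<Longrightarrow> x \<in> set_pmf (law s) \<Longrightarrow> move s x \<noteq> (0, 0)"
proof -
  assume s: "s \<noteq> (0, 0)" and x: "x \<in> set_pmf (law s)"
  have "0 < int (fst s) + fst x \<or> 0 < int (snd s) + snd x"
    using x support[of x] h.supportD[of x] v.supportD[of x] q.supportD[of x]
    by (auto simp: increment_law_def split: if_splits)
  then show ?thesis by (auto simp: move_def)
qed

text \<open>The coefficients \<open>- (1 - z) / (1 - z * v1)\<close> and \<open>- (1 - z) / (1 - z * h0)\<close> are
  \<open>d\<^sub>1\<close> and \<open>d\<^sub>0\<close>; they cancel the boundary defect \<open>1 - z\<close> of the constant solution.\<close>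

definition H :: "complex \<Rightarrow> nat \<times> nat \<Rightarrow> complex" where
  "H z s = (if s = (0, 0) then 1 else
     1 - (1 - z) / (1 - z * of_real v1) * comp_series z s
       - (1 - z) / (1 - z * of_real h0) * sw.comp_series z (prod.swap s))"

lemma small_z:
  assumes "norm (z :: complex) < 1"
  shows "norm z * pole_bound < 1" "norm z * sw.pole_bound < 1"
    "1 - z * of_real v1 \<noteq> 0" "1 - z * of_real h0 \<noteq> 0"
proof -
  have lt: "norm z * c < 1" if "0 < c" "c < 1" for c
    using that assms mult_strict_mono[of "norm z" 1 c 1] by simp
  show "norm z * pole_bound < 1" "norm z * sw.pole_bound < 1"
    using lt pole_bound_pos pole_bound_less_1 sw.pole_bound_pos sw.pole_bound_less_1 by auto
  have "1 - z * of_real c \<noteq> 0" if "0 < c" "c < 1" for c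
    using lt[OF that] that by (metis abs_of_pos eq_iff_diff_eq_0 less_irrefl norm_mult norm_of_real norm_one)
  then show "1 - z * of_real v1 \<noteq> 0" "1 - z * of_real h0 \<noteq> 0"
    using v1_bounds h0_bounds by auto
qed

lemma H_bound:
  assumes "norm z < 1"
  obtains C where "0 < C" "\<And>s. norm (H z s - 1) \<le> C * (xs 0 ^ fst s + sw.xs 0 ^ snd s)"
proof -
  obtain C1 where C1: "0 < C1" "\<And>(z' :: complex) s. norm z' \<le> norm z \<Longrightarrow> s \<noteq> (0, 0) \<Longrightarrow>
      norm (comp_series z' s) \<le> C1 * xs 0 ^ fst s"
    using comp_series_bound[OF norm_ge_zero small_z(1)[OF assms]] by metis
  obtain C2 where C2: "0 < C2" "\<And>(z' :: complex) s. norm z' \<le> norm z \<Longrightarrow> s \<noteq> (0, 0) \<Longrightarrow>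
      norm (sw.comp_series z' s) \<le> C2 * sw.xs 0 ^ fst s"
    using sw.comp_series_bound[OF norm_ge_zero small_z(2)[OF assms]] by metis
  define A B where "A = norm ((1 - z) / (1 - z * of_real v1))" and "B = norm ((1 - z) / (1 - z * of_real h0))"
  have AB: "0 \<le> A" "0 \<le> B" by (simp_all add: A_def B_def)
  define C where "C = A * C1 + B * C2 + 1"
  have Cpos: "0 < C" using AB C1 C2 by (simp add: C_def add_nonneg_pos)
  show ?thesis
  proof
    show "0 < C" by (rule Cpos)
    fix s
    have x: "0 \<le> xs 0 ^ fst s" "0 \<le> sw.xs 0 ^ snd s"
      using xs_bounds(1)[of 0] sw.xs_bounds(1)[of 0] by simp_all
    show "norm (H z s - 1) \<le> C * (xs 0 ^ fst s + sw.xs 0 ^ snd s)"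
    proof (cases "s = (0, 0)")
      case True
      then show ?thesis using Cpos by (simp add: H_def)
    next
      case False
      then have sw0: "prod.swap s \<noteq> (0, 0)" by (cases s) auto
      have "norm (H z s - 1) = norm ((1 - z) / (1 - z * of_real v1) * comp_series z s
         + (1 - z) / (1 - z * of_real h0) * sw.comp_series z (prod.swap s))"
        using False by (simp add: H_def norm_minus_cancel[symmetric, of "_ + _"] del: norm_minus_cancel)
      also have "\<dots> \<le> A * norm (comp_series z s) + B * norm (sw.comp_series z (prod.swap s))"
        unfolding A_def B_def norm_mult[symmetric] by (rule norm_triangle_ineq)
      also have "\<dots> \<le> A * (C1 * xs 0 ^ fst s) + B * (C2 * sw.xs 0 ^ fst (prod.swap s))"
        by (intro add_mono mult_left_mono C1(2) C2(2) False sw0 AB) auto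
      also have "\<dots> \<le> C * xs 0 ^ fst s + C * sw.xs 0 ^ snd s"
        unfolding mult.assoc[symmetric] fst_swap
        using x AB C1 C2 by (intro add_mono mult_right_mono) (auto simp: C_def)
      finally show ?thesis by (simp add: algebra_simps)
    qed
  qed
qed

lemma integrable_comp_series:
  assumes "norm (z :: complex) < 1" "\<And>x. x \<in> set_pmf w \<Longrightarrow> f x \<noteq> (0, 0)"
  shows "integrable (measure_pmf w) (\<lambda>x. comp_series z (f x))"
    "integrable (measure_pmf w) (\<lambda>x. sw.comp_series z (prod.swap (f x)))"
proof -
  obtain C1 where C1: "0 < C1" "\<And>(z' :: complex) s. norm z' \<le> norm z \<Longrightarrow> s \<noteq> (0, 0) \<Longrightarrow>
      norm (comp_series z' s) \<le> C1 * xs 0 ^ fst s"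
    using comp_series_bound[OF norm_ge_zero small_z(1)[OF assms(1)]] by metis
  obtain C2 where C2: "0 < C2" "\<And>(z' :: complex) s. norm z' \<le> norm z \<Longrightarrow> s \<noteq> (0, 0) \<Longrightarrow>
      norm (sw.comp_series z' s) \<le> C2 * sw.xs 0 ^ fst s"
    using sw.comp_series_bound[OF norm_ge_zero small_z(2)[OF assms(1)]] by metis
  have "norm (comp_series z (f x)) \<le> C1" if "x \<in> set_pmf w" for x
    using C1(2)[OF order_refl assms(2)[OF that]] C1(1) xs_bounds[of 0]
    by (smt (verit) mult_left_le power_le_one)
  then show "integrable (measure_pmf w) (\<lambda>x. comp_series z (f x))" by (rule integrable_pmf_bounded)
  have "norm (sw.comp_series z (prod.swap (f x))) \<le> C2" if "x \<in> set_pmf w" for x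
  proof -
    have "prod.swap (f x) \<noteq> (0, 0)" using assms(2)[OF that] by (cases "f x") auto
    then show ?thesis
      using C2(2)[OF order_refl, of "prod.swap (f x)"] C2(1) sw.xs_bounds[of 0]
      by (smt (verit) mult_left_le power_le_one)
  qed
  then show "integrable (measure_pmf w) (\<lambda>x. sw.comp_series z (prod.swap (f x)))" by (rule integrable_pmf_bounded)
qed

lemma expectation_sw_comp_series:
  "measure_pmf.expectation w (\<lambda>x. sw.comp_series z (prod.swap (move s x))) =
   measure_pmf.expectation (map_pmf prod.swap w) (\<lambda>x. sw.comp_series z (move (prod.swap s) x))" for z :: complex
  by (simp add: move_swap)

lemma H_step:
  assumes z: "norm z < 1" and s: "s \<noteq> (0, 0)"
  shows "(if interior_state s then 1 else z) * measure_pmf.expectation (law s) (\<lambda>x. H z (move s x)) = H z s"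
proof -
  note sz = small_z[OF z]
  define A B where "A = (1 - z) / (1 - z * of_real v1)" and "B = (1 - z) / (1 - z * of_real h0)"
  define I where "I = measure_pmf.expectation (law s) (\<lambda>x. comp_series z (move s x))"
  define J where "J = measure_pmf.expectation (law s) (\<lambda>x. sw.comp_series z (prod.swap (move s x)))"
  have ne: "\<And>x. x \<in> set_pmf (law s) \<Longrightarrow> move s x \<noteq> (0, 0)" using law_nonzero[OF s] .
  have "measure_pmf.expectation (law s) (\<lambda>x. H z (move s x)) =
      measure_pmf.expectation (law s) (\<lambda>x. 1 - A * comp_series z (move s x) - B * sw.comp_series z (prod.swap (move s x)))"
    using ne by (intro integral_cong_AE) (auto simp: AE_measure_pmf_iff H_def A_def B_def)
  also have "\<dots> = 1 - A * I - B * J"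
    unfolding I_def J_def using integrable_comp_series[OF z, of "law s" "move s", OF ne] by simp
  finally have E: "measure_pmf.expectation (law s) (\<lambda>x. H z (move s x)) = 1 - A * I - B * J" .
  have Hs: "H z s = 1 - A * comp_series z s - B * sw.comp_series z (prod.swap s)"
    using s by (simp add: H_def A_def B_def)
  consider "0 < fst s" "0 < snd s" | "0 < fst s" "snd s = 0" | "fst s = 0" "0 < snd s"
    using s by (cases s) auto
  then show ?thesis
  proof cases
    case 1
    then have "I = comp_series z s" "J = sw.comp_series z (prod.swap s)"
      using comp_series_interior[OF sz(1), of s] sw.comp_series_interior[OF sz(2), of "prod.swap s"]
      unfolding I_def J_def expectation_sw_comp_series by (simp_all add: increment_law_def)
    then show ?thesis using 1 by (simp add: E Hs interior_state_def)
  next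
    case 2
    then have IJ: "z * I = comp_series z s" "z * J = sw.comp_series z (prod.swap s) - (1 - z * of_real h0)"
      using comp_series_h_boundary[OF sz(1), of s] sw.comp_series_v_boundary[OF sz(2), of "prod.swap s"]
      unfolding I_def J_def expectation_sw_comp_series by (simp_all add: increment_law_def sw_v1)
    have cancel: "B * (1 - z * of_real h0) = 1 - z" using sz by (simp add: B_def)
    have "z * (1 - A * I - B * J) = z - A * (z * I) - B * (z * J)" by (simp add: algebra_simps)
    also have "\<dots> = z - A * comp_series z s - B * sw.comp_series z (prod.swap s) + B * (1 - z * of_real h0)"
      unfolding IJ by (simp add: algebra_simps)
    also have "\<dots> = H z s" unfolding cancel Hs by simp
    finally show ?thesis using 2 by (simp add: E interior_state_def)
  next
    case 3
    then have IJ: "z * J = sw.comp_series z (prod.swap s)" "z * I = comp_series z s - (1 - z * of_real v1)"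
      using comp_series_v_boundary[OF sz(1), of s] sw.comp_series_h_boundary[OF sz(2), of "prod.swap s"]
      unfolding I_def J_def expectation_sw_comp_series by (simp_all add: increment_law_def v1_def)
    have cancel: "A * (1 - z * of_real v1) = 1 - z" using sz by (simp add: A_def)
    have "z * (1 - A * I - B * J) = z - A * (z * I) - B * (z * J)" by (simp add: algebra_simps)
    also have "\<dots> = z - A * comp_series z s - B * sw.comp_series z (prod.swap s) + A * (1 - z * of_real v1)"
      unfolding IJ by (simp add: algebra_simps)
    also have "\<dots> = H z s" unfolding cancel Hs by simp
    finally show ?thesis using 3 by (simp add: E interior_state_def)
  qed
qed

text \<open>A state \<open>(n, s)\<close> of the counting chain records the number \<open>n\<close> of past boundary contacts
  (excluding the present one) and the position \<open>s\<close>.\<close>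

definition cstep :: "nat \<times> (nat \<times> nat) \<Rightarrow> (nat \<times> (nat \<times> nat)) pmf" where
  "cstep a = map_pmf (\<lambda>x. (fst a + (if interior_state (snd a) then 0 else 1), move (snd a) x)) (law (snd a))"

primrec chain :: "nat \<Rightarrow> nat \<times> (nat \<times> nat) \<Rightarrow> (nat \<times> (nat \<times> nat)) pmf" where
  "chain 0 a = return_pmf a"
| "chain (Suc t) a = bind_pmf (cstep a) (chain t)"

text \<open>The definition splits off the first step, which suits inductions on harmonic functions;
  this form splits off the last step, as monotonicity in time and the comparison with a given
  process require.\<close>

lemma chain_Suc: "chain (Suc t) a = bind_pmf (chain t a) cstep"
proof (induction t arbitrary: a)
  case 0
  have "chain 0 = return_pmf" by (rule ext) simp
  then show ?case by (simp add: bind_return_pmf bind_return_pmf')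
next
  case (Suc t)
  have "chain (Suc (Suc t)) a = bind_pmf (cstep a) (\<lambda>b. chain (Suc t) b)"
    by (rule chain.simps(2))
  also have "\<dots> = bind_pmf (cstep a) (\<lambda>b. bind_pmf (chain t b) cstep)" by (simp only: Suc)
  also have "\<dots> = bind_pmf (chain (Suc t) a) cstep" by (simp add: bind_assoc_pmf)
  finally show ?case .
qed

lemma chain_Suc': "chain (Suc t) (n, s) =
    bind_pmf (law s) (\<lambda>x. chain t (n + (if interior_state s then 0 else 1), move s x))"
  by (simp add: cstep_def bind_map_pmf)

lemma chain_shift: "chain t (m + n, s) = map_pmf (\<lambda>b. (m + fst b, snd b)) (chain t (n, s))"
proof (induction t arbitrary: n s)
  case (Suc t)
  show ?case unfolding chain_Suc' map_bind_pmf by (simp add: Suc[symmetric] add.assoc)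
qed simp

text \<open>The martingale property: \<open>H_step\<close> charges a factor z exactly when the
  counter increases.\<close>

lemma expectation_chain_H:
  assumes z: "norm z < 1" and s: "s \<noteq> (0, 0)"
  shows "measure_pmf.expectation (chain t (n, s)) (\<lambda>b. z ^ fst b * H z (snd b)) = z ^ n * H z s"
  using s
proof (induction t arbitrary: n s)
  case (Suc t)
  obtain C where C: "0 < C" "\<And>s. norm (H z s - 1) \<le> C * (xs 0 ^ fst s + sw.xs 0 ^ snd s)"
    by (rule H_bound[OF z]) blast
  have HB: "norm (H z s) \<le> 1 + C * 2" for s
  proof -
    have "C * (xs 0 ^ fst s + sw.xs 0 ^ snd s) \<le> C * (1 + 1)"
      using C xs_bounds[of 0] sw.xs_bounds[of 0] by (intro mult_left_mono add_mono power_le_one) auto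
    then show ?thesis using C(2)[of s] norm_triangle_ineq2[of "H z s" 1] by simp
  qed
  have "norm (z ^ fst b * H z (snd b)) \<le> 1 * (1 + C * 2)" for b :: "nat \<times> nat \<times> nat"
    unfolding norm_mult norm_power using z HB by (intro mult_mono power_le_one) auto
  then have "measure_pmf.expectation (chain (Suc t) (n, s)) (\<lambda>b. z ^ fst b * H z (snd b)) =
     measure_pmf.expectation (law s) (\<lambda>x. measure_pmf.expectation
       (chain t (n + (if interior_state s then 0 else 1), move s x)) (\<lambda>b. z ^ fst b * H z (snd b)))"
    unfolding chain_Suc' by (rule integral_bind_pmf_bounded)
  also have "\<dots> = measure_pmf.expectation (law s) (\<lambda>x. z ^ n * ((if interior_state s then 1 else z) * H z (move s x)))"
    using Suc.IH law_nonzero[OF Suc.prems] by (intro integral_cong_AE) (auto simp: AE_measure_pmf_iff)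
  also have "\<dots> = z ^ n * H z s" using H_step[OF z Suc.prems] by simp
  finally show ?case .
qed (simp add: return_pmf.rep_eq integral_return)

text \<open>In the interior the two powers are multiplied by \<open>ker_sum a 1 / a\<close> and
  \<open>ker_sum 1 b / b\<close>, below 1 because the kernel is negative there. On the axes the
  coordinates do not decrease, and the weight \<open>r\<close> contracts by itself.\<close>

lemma contraction:
  assumes r: "0 \<le> r" "r < 1"
  obtains a b g where "xs 0 \<le> a" "a \<le> 1" "sw.xs 0 \<le> b" "b \<le> 1" "0 \<le> g" "g < 1"
    "\<And>t n s. measure_pmf.expectation (chain t (n, s)) (\<lambda>c. r ^ fst c * (a ^ fst (snd c) + b ^ snd (snd c)))
      \<le> r ^ n * g ^ t * (a ^ fst s + b ^ snd s)"
proof -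
  obtain a where a: "xs 0 < a" "a < 1" "kernel p a 1 < 0" using kernel_1_neg' by auto
  obtain b where b: "sw.xs 0 < b" "b < 1" "kernel p 1 b < 0" using sw.kernel_1_neg' by (auto simp: kernel_swap)
  have ab0: "0 < a" "0 < b" using a b xs_bounds(1)[of 0] sw.xs_bounds(1)[of 0] by linarith+
  define g where "g = max r (max (ker_sum a 1 / a) (ker_sum 1 b / b))"
  have g: "0 \<le> g" "g < 1" "r \<le> g" "ker_sum a 1 / a \<le> g" "ker_sum 1 b / b \<le> g"
  proof -
    have "ker_sum a 1 / a < 1" "ker_sum 1 b / b < 1" using a b ab0 by (auto simp: kernel_eq)
    then show "0 \<le> g" "g < 1" "r \<le> g" "ker_sum a 1 / a \<le> g" "ker_sum 1 b / b \<le> g"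
      using r by (auto simp: g_def le_max_iff_disj)
  qed
  define psi where "psi s = a ^ fst s + b ^ snd s" for s :: "nat \<times> nat"
  have psi: "psi s = monom2 a 1 s + monom2 1 b s" for s by (simp add: psi_def monom2_def)
  have psi_bd: "0 \<le> psi s" "psi s \<le> 2" for s
    using a b ab0 power_le_one[of a "fst s"] power_le_one[of b "snd s"] by (auto simp: psi_def)
  have i_psi: "integrable (measure_pmf w) (\<lambda>x. psi (f x))" for w :: weights and f
    using psi_bd by (intro integrable_pmf_bounded[where B = 2]) auto
  have contr: "(if interior_state s then 1 else r) * measure_pmf.expectation (law s) (\<lambda>x. psi (move s x)) \<le> g * psi s" for s
  proof (cases "interior_state s")
    case True
    then have s: "0 < fst s" "0 < snd s" by (auto simp: interior_state_def)
    have "measure_pmf.expectation p (\<lambda>x. psi (move s x)) =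
        ker_sum a 1 / a * monom2 a 1 s + ker_sum 1 b / b * monom2 1 b s"
    proof -
      have "measure_pmf.expectation p (\<lambda>x. monom2 a 1 (move s x)) = ker_sum a 1 / a * monom2 a 1 s"
        "measure_pmf.expectation p (\<lambda>x. monom2 1 b (move s x)) = ker_sum 1 b / b * monom2 1 b s"
        using integral_monom2[OF s, of a 1] integral_monom2[OF s, of 1 b] ab0 by (simp_all add: field_simps)
      moreover have "integrable (measure_pmf p) (\<lambda>x. monom2 a 1 (move s x))"
        "integrable (measure_pmf p) (\<lambda>x. monom2 1 b (move s x))"
        using a b ab0 by (auto intro!: integrable_monom2)
      ultimately show ?thesis unfolding psi by (simp only: Bochner_Integration.integral_add)
    qed
    also have "\<dots> \<le> g * monom2 a 1 s + g * monom2 1 b s"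
      using g ab0 by (intro add_mono mult_right_mono) (auto simp: monom2_def)
    finally show ?thesis using True s by (simp add: psi increment_law_def algebra_simps)
  next
    case False
    have "psi (move s x) \<le> psi s" if "x \<in> set_pmf (law s)" for x
    proof -
      have "0 \<le> fst x" "0 \<le> snd x"
        using that False h.supportD[of x] v.supportD[of x] q.supportD[of x]
        by (auto simp: increment_law_def interior_state_def split: if_splits)
      then have "fst s \<le> fst (move s x)" "snd s \<le> snd (move s x)" by (auto simp: move_def)
      then show ?thesis unfolding psi_def using a b ab0 by (intro add_mono power_decreasing) auto
    qed
    then have "measure_pmf.expectation (law s) (\<lambda>x. psi (move s x)) \<le> measure_pmf.expectation (law s) (\<lambda>x. psi s)"
      by (intro integral_mono_AE i_psi) (auto simp: AE_measure_pmf_iff)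
    then have "r * measure_pmf.expectation (law s) (\<lambda>x. psi (move s x)) \<le> g * psi s"
      using g r psi_bd by (intro mult_mono) auto
    then show ?thesis using False by simp
  qed
  have "measure_pmf.expectation (chain t (n, s)) (\<lambda>c. r ^ fst c * psi (snd c)) \<le> r ^ n * g ^ t * psi s" for t n s
  proof (induction t arbitrary: n s)
    case (Suc t)
    let ?n = "n + (if interior_state s then 0 else 1)"
    have bd: "\<bar>r ^ fst c * psi (snd c)\<bar> \<le> 1 * 2" for c :: "nat \<times> nat \<times> nat"
      unfolding abs_mult using r psi_bd by (intro mult_mono) (auto simp: power_le_one)
    then have "measure_pmf.expectation (chain (Suc t) (n, s)) (\<lambda>c. r ^ fst c * psi (snd c)) =
       measure_pmf.expectation (law s) (\<lambda>x. measure_pmf.expectation (chain t (?n, move s x)) (\<lambda>c. r ^ fst c * psi (snd c)))"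
      unfolding chain_Suc' by (rule integral_bind_pmf_bounded_real)
    also have "\<dots> \<le> measure_pmf.expectation (law s) (\<lambda>x. r ^ ?n * g ^ t * psi (move s x))"
      using bd by (intro integral_mono integrable_mult_right i_psi Suc.IH integrable_pmf_bounded[where B = 2] norm_integral_pmf_le) auto
    also have "\<dots> = r ^ n * g ^ t * ((if interior_state s then 1 else r) * measure_pmf.expectation (law s) (\<lambda>x. psi (move s x)))"
      by simp
    also have "\<dots> \<le> r ^ n * g ^ t * (g * psi s)"
      using r g contr by (intro mult_left_mono) auto
    finally show ?case by (simp add: algebra_simps)
  qed (simp add: return_pmf.rep_eq integral_return)
  with that[of a b g] a b g show ?thesis by (simp add: psi_def)
qed

text \<open>By the martingale identity the error is the expectation of z^N (H - 1), with N the
  count; its modulus is at most a multiple of the contracted test function and decays like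
  \<open>g ^ t\<close>.\<close>

lemma chain_gf_tendsto:
  assumes z: "norm z < 1" and s: "s \<noteq> (0, 0)"
  shows "(\<lambda>t. measure_pmf.expectation (chain t (0, s)) (\<lambda>b. z ^ fst b)) \<longlonglongrightarrow> H z s"
proof -
  obtain C where C: "0 < C" "\<And>s. norm (H z s - 1) \<le> C * (xs 0 ^ fst s + sw.xs 0 ^ snd s)"
    by (rule H_bound[OF z]) blast
  obtain a b g where abg: "xs 0 \<le> a" "a \<le> 1" "sw.xs 0 \<le> b" "b \<le> 1" "0 \<le> g" "g < 1"
    "\<And>t n s. measure_pmf.expectation (chain t (n, s)) (\<lambda>c. norm z ^ fst c * (a ^ fst (snd c) + b ^ snd (snd c)))
      \<le> norm z ^ n * g ^ t * (a ^ fst s + b ^ snd s)"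
    by (rule contraction[OF norm_ge_zero z]) blast
  have ab0: "0 \<le> a" "0 \<le> b" using abg xs_bounds(1)[of 0] sw.xs_bounds(1)[of 0] by linarith+
  have H1: "norm (H z y - 1) \<le> C * (a ^ fst y + b ^ snd y)" for y
  proof -
    have "C * (xs 0 ^ fst y + sw.xs 0 ^ snd y) \<le> C * (a ^ fst y + b ^ snd y)"
      using C abg xs_bounds(1)[of 0] sw.xs_bounds(1)[of 0] by (intro mult_left_mono add_mono power_mono) auto
    with C(2)[of y] show ?thesis by simp
  qed
  have ab2: "a ^ fst y + b ^ snd y \<le> 2" for y
    using power_le_one[of a "fst y"] power_le_one[of b "snd y"] abg ab0 by simp
  have H2: "norm (H z y - 1) \<le> C * 2" for y
    using H1[of y] mult_left_mono[OF ab2, of C y] C(1) by linarith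
  have diff: "norm (measure_pmf.expectation (chain t (0, s)) (\<lambda>b. z ^ fst b) - H z s) \<le> C * (a ^ fst s + b ^ snd s) * g ^ t" for t
  proof -
    let ?E = "measure_pmf.expectation (chain t (0, s))"
    have zz: "norm z ^ k \<le> 1" for k using z by (simp add: power_le_one)
    have i1: "integrable (measure_pmf (chain t (0, s))) (\<lambda>c. z ^ fst c)"
      using zz by (intro integrable_pmf_bounded[where B = 1]) (auto simp: norm_power)
    have n2: "norm (z ^ fst c * (H z (snd c) - 1)) \<le> 1 * (C * 2)" for c :: "nat \<times> nat \<times> nat"
      unfolding norm_mult norm_power using zz H2 C by (intro mult_mono) auto
    have i2: "integrable (measure_pmf (chain t (0, s))) (\<lambda>c. z ^ fst c * (H z (snd c) - 1))"
      using n2 by (intro integrable_pmf_bounded) auto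
    have "?E (\<lambda>c. z ^ fst c * H z (snd c)) = ?E (\<lambda>c. z ^ fst c + z ^ fst c * (H z (snd c) - 1))"
      by (simp add: algebra_simps)
    also have "\<dots> = ?E (\<lambda>c. z ^ fst c) + ?E (\<lambda>c. z ^ fst c * (H z (snd c) - 1))"
      using i1 i2 by (rule Bochner_Integration.integral_add)
    finally have "?E (\<lambda>c. z ^ fst c) - H z s = - ?E (\<lambda>c. z ^ fst c * (H z (snd c) - 1))"
      using expectation_chain_H[OF z s, of t 0] by simp
    then have "norm (?E (\<lambda>c. z ^ fst c) - H z s) = norm (?E (\<lambda>c. z ^ fst c * (H z (snd c) - 1)))"
      by simp
    also have "\<dots> \<le> ?E (\<lambda>c. norm (z ^ fst c * (H z (snd c) - 1)))" by (rule integral_norm_bound)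
    also have "\<dots> \<le> ?E (\<lambda>c. C * (norm z ^ fst c * (a ^ fst (snd c) + b ^ snd (snd c))))"
    proof (rule integral_mono)
      show "integrable (measure_pmf (chain t (0, s))) (\<lambda>c. norm (z ^ fst c * (H z (snd c) - 1)))"
        using i2 by (rule integrable_norm)
      show "integrable (measure_pmf (chain t (0, s))) (\<lambda>c. C * (norm z ^ fst c * (a ^ fst (snd c) + b ^ snd (snd c))))"
      proof (intro integrable_mult_right integrable_pmf_bounded)
        fix c :: "nat \<times> nat \<times> nat"
        have "norm z ^ fst c * (a ^ fst (snd c) + b ^ snd (snd c)) \<le> 1 * 2"
          using zz ab2 ab0 by (intro mult_mono) auto
        then show "norm (norm z ^ fst c * (a ^ fst (snd c) + b ^ snd (snd c))) \<le> 2"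
          using ab0 by simp
      qed
      fix c :: "nat \<times> nat \<times> nat"
      have "norm z ^ fst c * norm (H z (snd c) - 1) \<le> norm z ^ fst c * (C * (a ^ fst (snd c) + b ^ snd (snd c)))"
        by (intro mult_left_mono H1) auto
      then show "norm (z ^ fst c * (H z (snd c) - 1)) \<le> C * (norm z ^ fst c * (a ^ fst (snd c) + b ^ snd (snd c)))"
        unfolding norm_mult norm_power by (simp only: mult_ac)
    qed
    also have "\<dots> = C * ?E (\<lambda>c. norm z ^ fst c * (a ^ fst (snd c) + b ^ snd (snd c)))" by simp
    also have "\<dots> \<le> C * (norm z ^ 0 * g ^ t * (a ^ fst s + b ^ snd s))"
      using C by (intro mult_left_mono abg(7)) auto
    finally show ?thesis by (simp add: algebra_simps)
  qed
  have "(\<lambda>t. C * (a ^ fst s + b ^ snd s) * g ^ t) \<longlonglongrightarrow> 0"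
    using abg by (intro tendsto_mult_right_zero LIMSEQ_power_zero) auto
  then have "(\<lambda>t. measure_pmf.expectation (chain t (0, s)) (\<lambda>b. z ^ fst b) - H z s) \<longlonglongrightarrow> 0"
    using diff by (rule Lim_null_comparison[OF always_eventually[OF allI], rotated])
  then show ?thesis by (simp add: LIM_zero_iff)
qed

section \<open>The limiting law of the count\<close>

definition cnt :: "nat \<Rightarrow> nat \<times> nat \<Rightarrow> nat \<Rightarrow> real" where
  "cnt t s n = pmf (map_pmf fst (chain t (0, s))) n"

text \<open>The counter never decreases, so the probability of a count below n is monotone in t;
  \<open>cnt\<close> is a difference of two such sequences.\<close>

lemma cnt_convergent: "convergent (\<lambda>t. cnt t s n)"
proof -
  define F where "F n t = measure (chain t (0, s)) {b. fst b < n}" for n t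
  have conv: "convergent (F n)" for n
  proof -
    have "decseq (F n)"
    proof (rule decseq_SucI)
      fix t
      have "emeasure (chain (Suc t) (0, s)) {b. fst b < n} = (\<integral>\<^sup>+b. emeasure (cstep b) {b. fst b < n} \<partial>chain t (0, s))"
        unfolding chain_Suc by simp
      also have "\<dots> \<le> (\<integral>\<^sup>+b. indicator {b. fst b < n} b \<partial>chain t (0, s))"
      proof (rule nn_integral_mono)
        fix b :: "nat \<times> nat \<times> nat"
        show "emeasure (cstep b) {b. fst b < n} \<le> indicator {b. fst b < n} b"
        proof (cases "fst b < n")
          case False
          then have "emeasure (cstep b) {b. fst b < n} = 0"
            by (auto simp: measure_pmf.emeasure_eq_measure measure_pmf_zero_iff cstep_def)
          then show ?thesis by simp
        qed (simp add: measure_pmf.emeasure_le_1)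
      qed
      also have "\<dots> = emeasure (chain t (0, s)) {b. fst b < n}" by simp
      finally show "F n (Suc t) \<le> F n t"
        by (simp add: F_def measure_pmf.emeasure_eq_measure)
    qed
    moreover have "\<forall>t. 0 \<le> F n t" by (simp add: F_def)
    ultimately obtain L where "F n \<longlonglongrightarrow> L" by (rule decseq_convergent)
    then show ?thesis by (rule convergentI)
  qed
  have "cnt t s n = F (Suc n) t - F n t" for t
  proof -
    have "F (Suc n) t = measure (chain t (0, s)) ({b. fst b < n} \<union> {b. fst b = n})"
      unfolding F_def by (rule arg_cong[where f = "measure _"]) auto
    also have "\<dots> = F n t + measure (chain t (0, s)) {b. fst b = n}"
      unfolding F_def by (rule measure_pmf.finite_measure_Union) auto
    also have "measure (chain t (0, s)) {b. fst b = n} = cnt t s n"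
      by (simp add: cnt_def pmf_map vimage_def)
    finally show ?thesis by simp
  qed
  then show ?thesis using convergent_diff[OF conv conv] by simp
qed

text \<open>The numbers f_n, built from the pmf chain alone. They are matched with the given
  probability space only in \<open>prob_contacts\<close>.\<close>

definition hits :: "nat \<Rightarrow> nat \<times> nat \<Rightarrow> real" where
  "hits n s = lim (\<lambda>t. cnt t s n)"

lemma cnt_tendsto: "(\<lambda>t. cnt t s n) \<longlonglongrightarrow> hits n s"
  using cnt_convergent by (simp add: hits_def convergent_LIMSEQ_iff)

theorem hits_generating_function:
  assumes z: "norm z < 1" and s: "s \<noteq> (0, 0)"
  shows "(\<lambda>n. of_real (hits n s) * z ^ n) sums H z s"
proof -
  have "summable (\<lambda>n. norm (of_real (hits n s) * z ^ n)) \<and>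
      ((\<lambda>t. \<Sum>n. of_real (cnt t s n) * z ^ n) \<longlonglongrightarrow> (\<Sum>n. of_real (hits n s) * z ^ n))"
  proof -
    have "\<forall>\<^sub>F x in at_top \<times>\<^sub>F sequentially. case x of (n, t) \<Rightarrow> norm (complex_of_real (cnt t s n) * z ^ n) \<le> norm z ^ n"
    proof (intro always_eventually allI, clarify)
      fix n t
      have "norm (complex_of_real (cnt t s n) * z ^ n) \<le> 1 * norm z ^ n"
        unfolding norm_mult norm_power by (intro mult_right_mono) (auto simp: cnt_def pmf_le_1)
      then show "norm (complex_of_real (cnt t s n) * z ^ n) \<le> norm z ^ n" by simp
    qed
    moreover have "(\<lambda>t. complex_of_real (cnt t s n) * z ^ n) \<longlonglongrightarrow> of_real (hits n s) * z ^ n" for n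
      by (intro tendsto_intros cnt_tendsto)
    moreover have "summable (\<lambda>n. norm z ^ n)" using z by (intro summable_geometric) simp
    ultimately show ?thesis
      using tannerys_theorem[where a = "\<lambda>n t. complex_of_real (cnt t s n) * z ^ n" and
        b = "\<lambda>n. of_real (hits n s) * z ^ n" and F = sequentially and M = "\<lambda>n. norm z ^ n"]
      by simp
  qed
  moreover have "(\<Sum>n. of_real (cnt t s n) * z ^ n) = measure_pmf.expectation (chain t (0, s)) (\<lambda>b. z ^ fst b)" for t
  proof -
    have "measure_pmf.expectation (map_pmf fst (chain t (0, s))) (\<lambda>n. z ^ n) = (\<Sum>n. of_real (cnt t s n) * z ^ n)"
      unfolding cnt_def using z by (intro expectation_nat_pmf[where B = 1]) (auto simp: norm_power power_le_one)
    then show ?thesis by simp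
  qed
  ultimately have "summable (\<lambda>n. norm (of_real (hits n s) * z ^ n))"
    "(\<Sum>n. of_real (hits n s) * z ^ n) = H z s"
    using chain_gf_tendsto[OF z s] LIMSEQ_unique by auto
  then show ?thesis using summable_sums[OF summable_norm_cancel] by metis
qed

lemma hits_ge:
  shows "interior_state s \<Longrightarrow> pmf (law s) x * hits n (move s x) \<le> hits n s"
    "\<not> interior_state s \<Longrightarrow> pmf (law s) x * hits n (move s x) \<le> hits (Suc n) s"
proof -
  have le: "pmf (law s) x * pmf (map_pmf fst (chain t (m, move s x))) n \<le> cnt (Suc t) s n"
    if "m = (if interior_state s then 0 else 1)" for t n m
  proof -
    have "cnt (Suc t) s n = measure_pmf.expectation (law s) (\<lambda>x. pmf (map_pmf fst (chain t (m, move s x))) n)"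
      unfolding cnt_def chain_Suc' map_bind_pmf pmf_bind using that by simp
    then show ?thesis
      by (simp only:) (intro integral_pmf_ge_single integrable_pmf_bounded[where B = 1], auto simp: pmf_le_1)
  qed
  show "pmf (law s) x * hits n (move s x) \<le> hits n s" if "interior_state s"
    using le[of 0 _ n] that
    by (intro LIMSEQ_le[OF tendsto_mult_left[OF cnt_tendsto] LIMSEQ_Suc[OF cnt_tendsto]]) (auto simp: cnt_def)
  have shift: "pmf (map_pmf fst (chain t (1, y))) (Suc n) = cnt t y n" for t y
  proof -
    have "map_pmf fst (chain t (1, y)) = map_pmf Suc (map_pmf fst (chain t (0, y)))"
      using chain_shift[of t 1 0 y] by (simp add: pmf.map_comp o_def)
    then show ?thesis by (simp add: cnt_def pmf_map_inj' inj_Suc del: pmf.map_comp)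
  qed
  show "pmf (law s) x * hits n (move s x) \<le> hits (Suc n) s" if "\<not> interior_state s"
    using le[of 1 _ "Suc n"] that unfolding shift
    by (intro LIMSEQ_le[OF tendsto_mult_left[OF cnt_tendsto] LIMSEQ_Suc[OF cnt_tendsto]]) auto
qed

end

section \<open>Asymptotics of the coefficients\<close>

text \<open>The Taylor coefficients of \<open>(1 - z) * s z\<close> decay faster than \<open>\<rho> ^ n\<close>, so those of the quotient are
  governed by the simple pole at \<open>1 / t\<close>.\<close>

lemma simple_pole_coefficients:
  fixes s :: "complex \<Rightarrow> complex" and t \<rho> R :: real
  assumes hol: "s holomorphic_on ball 0 R" and t: "0 < t" "t \<le> \<rho>" and R: "1 < R * \<rho>"
  obtains a where
    "\<And>z. norm z < 1 / \<rho> \<Longrightarrow> (\<lambda>n. a n * z ^ n) sums ((1 - z) / (1 - z * of_real t) * s z)"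
    "(\<lambda>n. a n / of_real \<rho> ^ n) \<longlonglongrightarrow> (if t = \<rho> then (1 - 1 / of_real \<rho>) * s (1 / of_real \<rho>) else 0)"
proof
  have \<rho>: "0 < \<rho>" using t by simp
  define g where "g z = (1 - z) * s z" for z
  define b where "b n = (deriv ^^ n) g 0 / fact n" for n
  have "g holomorphic_on ball 0 R" unfolding g_def by (intro holomorphic_intros hol)
  then have g_sums: "(\<lambda>n. b n * z ^ n) sums g z" if "norm z < R" for z
    using holomorphic_power_series[of g 0 R z] that by (simp add: b_def)
  have R1: "1 / \<rho> < R" using R \<rho> by (simp add: field_simps)
  have b_abs: "summable (\<lambda>n. norm (b n * z ^ n))" if "norm z \<le> 1 / \<rho>" for z
  proof -
    define r where "r = (1 / \<rho> + R) / 2"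
    have r: "1 / \<rho> < r" "r < R" using R1 by (auto simp: r_def)
    then have "norm (of_real r :: complex) = r"
      using \<rho> order_less_trans[of 0 "1 / \<rho>" r] by simp
    then have "summable (\<lambda>n. b n * (of_real r) ^ n)"
      using g_sums[of "of_real r"] r by (simp add: sums_iff)
    then show ?thesis
      by (rule powser_insidea) (use r that \<open>norm (of_real r :: complex) = r\<close> in simp)
  qed
  \<comment> \<open>The Cauchy product of the Taylor coefficients of (1 - z) s(z) with the geometric
    series of 1 / (1 - z t).\<close>
  define a where "a n = (\<Sum>i\<le>n. b i * of_real t ^ (n - i))" for n
  have a_eq: "a n * z ^ n = (\<Sum>i\<le>n. (b i * z ^ i) * (z * of_real t) ^ (n - i))" for n z
    unfolding a_def sum_distrib_right
    by (intro sum.cong refl) (simp add: power_mult_distrib power_add[symmetric] mult_ac)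
  \<comment> \<open>The closed disc is essential: for t < \<rho> convergence at
    \<open>1 / \<rho>\<close> itself forces the normalised coefficients to 0.\<close>
  have cauchy: "(\<lambda>n. a n * z ^ n) sums ((1 - z) / (1 - z * of_real t) * s z)"
    if z: "norm z \<le> 1 / \<rho>" "norm (z * of_real t) < 1" for z
  proof -
    have "(\<lambda>n. \<Sum>i\<le>n. (b i * z ^ i) * (z * of_real t) ^ (n - i)) sums
        ((\<Sum>n. b n * z ^ n) * (\<Sum>n. (z * of_real t) ^ n))"
      using b_abs[OF z(1)] z(2)
      by (intro Cauchy_product_sums) (auto simp: norm_power intro: summable_geometric)
    moreover have "(\<Sum>n. b n * z ^ n) = g z" using g_sums[of z] z R1 by (simp add: sums_iff)
    moreover have "(\<Sum>n. (z * of_real t) ^ n) = 1 / (1 - z * of_real t)" using z by (intro suminf_geometric)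
    ultimately show ?thesis unfolding a_eq by (simp add: g_def)
  qed
  show "(\<lambda>n. a n * z ^ n) sums ((1 - z) / (1 - z * of_real t) * s z)" if z: "norm z < 1 / \<rho>" for z
  proof (rule cauchy)
    have "norm z * t \<le> norm z * \<rho>" using t by (intro mult_left_mono) auto
    also have "\<dots> < 1" using z \<rho> by (simp add: field_simps)
    finally show "norm (z * of_real t) < 1" using t by (simp add: norm_mult)
  qed (use z in simp)
  have w: "norm (1 / of_real \<rho> :: complex) = 1 / \<rho>" using \<rho> by (simp add: norm_divide)
  show "(\<lambda>n. a n / of_real \<rho> ^ n) \<longlonglongrightarrow> (if t = \<rho> then (1 - 1 / of_real \<rho>) * s (1 / of_real \<rho>) else 0)"
  proof (cases "t = \<rho>")
    case True
    \<comment> \<open>For t = \<rho> the normalised coefficient is a partial sum of the Taylor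
      series of \<open>g\<close> at the pole.\<close>
    have "a n / of_real \<rho> ^ n = (\<Sum>i\<le>n. b i * (1 / of_real \<rho>) ^ i)" for n
      using a_eq[of n "1 / of_real \<rho>"] \<rho> True by (simp add: power_one_over divide_inverse power_inverse)
    moreover have "(\<lambda>n. \<Sum>i\<le>n. b i * (1 / of_real \<rho>) ^ i) \<longlonglongrightarrow> g (1 / of_real \<rho>)"
      using g_sums[of "1 / of_real \<rho>"] w R1 by (simp add: sums_def_le)
    ultimately show ?thesis using True by (simp add: g_def)
  next
    case False
    then have "t / \<rho> < 1" using t by simp
    then have "norm (1 / of_real \<rho> * of_real t :: complex) < 1" using t \<rho> by (simp add: norm_mult norm_divide)
    then have "summable (\<lambda>n. a n * (1 / of_real \<rho>) ^ n)"
      using cauchy[of "1 / of_real \<rho>"] w by (simp add: sums_iff)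
    then have "(\<lambda>n. a n * (1 / of_real \<rho>) ^ n) \<longlonglongrightarrow> 0" by (rule summable_LIMSEQ_zero)
    then show ?thesis using False by (simp add: power_one_over divide_inverse power_inverse)
  qed
qed

lemma power_series_zero_coefficients:
  fixes d :: "nat \<Rightarrow> complex"
  assumes "\<And>z. norm z < 1 \<Longrightarrow> (\<lambda>n. d n * z ^ n) sums 0"
  shows "d n = 0"
proof (rule ccontr)
  assume dn: "d n \<noteq> 0"
  show False
  proof (cases "n = 0")
    case True
    have "(\<lambda>n. d n * 0 ^ n) sums d 0" by (rule powser_sums_zero)
    then show False using assms[of 0] dn True sums_unique2 by force
  next
    case False
    then obtain r where "0 < r" "\<And>z. z \<in> cball 0 r - {0 :: complex} \<Longrightarrow> (0 :: complex) \<noteq> 0"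
      using powser_0_nonzero[of 1 0 d "\<lambda>_. 0" n] assms dn by auto
    from this(2)[of "of_real r"] this(1) show False by simp
  qed
qed

context compensation
begin

lemma dq_of_real: "dq n (of_real z :: 'a::real_normed_field) = of_real (dq n z)"
  and cq_of_real: "cq n (of_real z :: 'a::real_normed_field) = of_real (cq n z)"
  by (simp_all add: dq_def cq_def h_ratio_def v_ratio_def)

lemma comp_series_of_real:
  assumes "0 \<le> z" "z * pole_bound < 1" "s \<noteq> (0, 0)"
  shows "comp_series (of_real z :: complex) s = of_real (comp_series z s)"
proof -
  have "(\<lambda>n. comp_term n z s) sums comp_series z s"
    unfolding comp_series_def using assms
    by (intro summable_sums[OF summable_norm_cancel[OF summable_norm_comp_term]]) auto
  then have "(\<lambda>n. complex_of_real (comp_term n z s)) sums of_real (comp_series z s)"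
    by (rule sums_of_real)
  moreover have "complex_of_real (comp_term n z s) = comp_term n (of_real z) s" for n
    by (simp add: comp_term_def dq_of_real cq_of_real)
  ultimately show ?thesis using assms comp_series_sums[of "of_real z" s] sums_unique2 by force
qed

lemma comp_series_pos:
  fixes z :: real
  assumes z: "0 \<le> z" "z * pole_bound < 1"
  obtains K where "\<And>s. K \<le> fst s \<Longrightarrow> K \<le> snd s \<Longrightarrow> 0 < comp_series z s"
proof -
  obtain B where B: "0 < B" "\<And>n (z' :: real). norm z' \<le> z \<Longrightarrow> norm (dq n z') \<le> B"
    "\<And>n (z' :: real). norm z' \<le> z \<Longrightarrow> norm (cq n z') \<le> B"
    by (rule coeff_bound[OF z, where 'a = real]) blast
  have Bz: "\<bar>dq n z\<bar> \<le> B" "\<bar>cq n z\<bar> \<le> B" for n using B z by auto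
  define X x y where "X = xs 0" and "x = xs 1" and "y = ys 1"
  have x: "0 < x" "x < X" "0 < y" "y < 1"
    using xs_bounds[of 0] xs_bounds[of 1] ys_bounds[of 1] ys_Suc_less[of 0] by (auto simp: X_def x_def y_def)
  have sx: "summable (\<lambda>n. xs (Suc n))" using summable_xs by (simp add: summable_Suc_iff)
  \<comment> \<open>\<open>D * (x / X) ^ i\<close> bounds all terms after the first relative to
    \<open>X ^ i\<close>. With this and the second monomial of the first term both below 1/2, the
    leading monomial wins.\<close>
  define D where "D = 2 * B / x * (\<Sum>n. xs (Suc n))"
  have "(\<lambda>n. B * y ^ n) \<longlonglongrightarrow> 0" "(\<lambda>n. D * (x / X) ^ n) \<longlonglongrightarrow> 0"
    using x by (intro tendsto_mult_right_zero LIMSEQ_power_zero; simp)+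
  then have "\<forall>\<^sub>F n in sequentially. B * y ^ n < 1/2 \<and> D * (x / X) ^ n < 1/2"
    by (intro eventually_conj order_tendstoD) auto
  then obtain K0 where K0: "\<And>n. K0 \<le> n \<Longrightarrow> B * y ^ n < 1/2 \<and> D * (x / X) ^ n < 1/2"
    by (auto simp: eventually_sequentially)
  show ?thesis
  proof
    fix s :: "nat \<times> nat"
    assume s: "Suc K0 \<le> fst s" "Suc K0 \<le> snd s"
    then obtain i where i: "fst s = Suc i" by (metis Suc_le_D)
    have s0: "s \<noteq> (0, 0)" using i by auto
    have summ: "summable (\<lambda>n. comp_term n z s)"
      using z s0 by (intro summable_norm_cancel[OF summable_norm_comp_term]) auto
    have term_le: "norm (comp_term (Suc n) z s) \<le> 2 * B / x * x ^ fst s * xs (Suc n)" for n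
    proof -
      have m: "0 \<le> monom2 (xs (Suc n)) w s \<and> monom2 (xs (Suc n)) w s \<le> x ^ fst s / x * xs (Suc n)"
        if "0 \<le> w" "w \<le> 1" for w
      proof -
        have "xs (Suc n) * xs (Suc n) ^ i * w ^ snd s \<le> xs (Suc n) * x ^ i * 1"
          using that xs_bounds[of "Suc n"] xs_decreasing[of 1 "Suc n"]
          by (intro mult_mono power_le_one power_mono) (auto simp: x_def)
        then show ?thesis
          using that x xs_bounds(1)[of "Suc n"] by (simp add: monom2_def i mult_ac)
      qed
      have yb: "0 \<le> ys k \<and> ys k \<le> 1" for k using ys_bounds[of k] by simp
      have "norm (comp_term (Suc n) z s) \<le>
          \<bar>dq (Suc n) z\<bar> * monom2 (xs (Suc n)) (ys (Suc n)) s + \<bar>cq (Suc n) z\<bar> * monom2 (xs (Suc n)) (ys (Suc (Suc n))) s"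
        unfolding comp_term_def
        by (rule order_trans[OF norm_triangle_ineq]) (use m yb in \<open>simp add: abs_mult\<close>)
      also have "\<dots> \<le> B * (x ^ fst s / x * xs (Suc n)) + B * (x ^ fst s / x * xs (Suc n))"
        using B(1) m yb by (intro add_mono mult_mono Bz) auto
      also have "\<dots> = 2 * B / x * x ^ fst s * xs (Suc n)" by (simp add: algebra_simps)
      finally show ?thesis .
    qed
    have "norm (\<Sum>n. comp_term (Suc n) z s) \<le> (\<Sum>n. 2 * B / x * x ^ fst s * xs (Suc n))"
      by (rule norm_suminf_le[OF term_le summable_mult[OF sx]])
    also have "\<dots> = 2 * B / x * x ^ fst s * (\<Sum>n. xs (Suc n))" by (rule suminf_mult[OF sx])
    also have "\<dots> = X ^ fst s * (D * (x / X) ^ fst s)"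
      using x by (simp add: D_def power_divide)
    also have "\<dots> < X ^ fst s * (1/2)"
      using K0[of "fst s"] s x by (intro mult_strict_left_mono) auto
    finally have tail: "\<bar>\<Sum>n. comp_term (Suc n) z s\<bar> < X ^ fst s / 2" by simp
    have "\<bar>cq 0 z * y ^ snd s\<bar> \<le> B * y ^ snd s"
      using x Bz(2)[of 0] by (simp add: abs_mult)
    also have "\<dots> < 1/2" using K0[of "snd s"] s by auto
    finally have "1/2 < 1 + cq 0 z * y ^ snd s" by linarith
    then have "X ^ fst s * (1/2) < X ^ fst s * (1 + cq 0 z * y ^ snd s)"
      using x by (intro mult_strict_left_mono) auto
    also have "\<dots> = comp_term 0 z s"
      by (simp add: comp_term_def monom2_def dq_def ys_0 X_def y_def algebra_simps)
    finally have "X ^ fst s / 2 < comp_term 0 z s" by simp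
    then show "0 < comp_series z s"
      unfolding comp_series_def suminf_split_head[OF summ, simplified]
      using tail suminf_split_head[OF summ] by linarith
  qed
qed

end

section \<open>The limit constant and its positivity\<close>

context walk_data
begin

text \<open>Two independent conditionals, so that in a tie both poles contribute. The factor is
  \<open>1 / rate - 1\<close> because \<open>H\<close> subtracts both series.\<close>

definition lim_const :: "nat \<times> nat \<Rightarrow> real" where
  "lim_const s =
    (if v1 = rate then (1 / rate - 1) * comp_series (1 / rate) s else 0) +
    (if h0 = rate then (1 / rate - 1) * sw.comp_series (1 / rate) (prod.swap s) else 0)"

lemma rate_poles: "1 / rate * pole_bound < 1" "1 / rate * sw.pole_bound < 1"
  using pole_bound_less_rate sw_pole_bound_less_rate rate_bounds by auto

lemma hits_tendsto:
  assumes s: "s \<noteq> (0, 0)"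
  shows "(\<lambda>n. hits n s / rate ^ n) \<longlonglongrightarrow> lim_const s"
proof -
  have s': "prod.swap s \<noteq> (0, 0)" using s by (cases s) auto
  have pb: "1 < 1 / pole_bound * rate" "1 < 1 / sw.pole_bound * rate"
    using pole_bound_less_rate sw_pole_bound_less_rate pole_bound_pos sw.pole_bound_pos by auto
  obtain a :: "nat \<Rightarrow> complex" where a: "\<And>z. norm z < 1 / rate \<Longrightarrow> (\<lambda>n. a n * z ^ n) sums ((1 - z) / (1 - z * of_real v1) * comp_series z s)"
    "(\<lambda>n. a n / of_real rate ^ n) \<longlonglongrightarrow> (if v1 = rate then (1 - 1 / of_real rate) * comp_series (1 / of_real rate) s else 0)"
    by (rule simple_pole_coefficients[OF comp_series_holomorphic[OF s] v1_bounds(1) rate_bounds(3) pb(1)]) blast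
  obtain b :: "nat \<Rightarrow> complex" where b: "\<And>z. norm z < 1 / rate \<Longrightarrow> (\<lambda>n. b n * z ^ n) sums ((1 - z) / (1 - z * of_real h0) * sw.comp_series z (prod.swap s))"
    "(\<lambda>n. b n / of_real rate ^ n) \<longlonglongrightarrow> (if h0 = rate then (1 - 1 / of_real rate) * sw.comp_series (1 / of_real rate) (prod.swap s) else 0)"
    by (rule simple_pole_coefficients[OF sw.comp_series_holomorphic[OF s'] h0_bounds(1) rate_bounds(4) pb(2)]) blast
  \<comment> \<open>The coefficients of the constant 1 in \<open>H\<close>; they vanish from index 1
    on.\<close>
  define e :: "nat \<Rightarrow> complex" where "e n = (if n = 0 then 1 else 0)" for n
  have "of_real (hits n s) - (e n - a n - b n) = 0" for n
  proof (rule power_series_zero_coefficients)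
    fix z :: complex assume z: "norm z < 1"
    then have z': "norm z < 1 / rate" using rate_bounds by (simp add: field_simps less_trans)
    have "(\<lambda>n. e n * z ^ n) sums 1"
      using sums_finite[of "{0}" "\<lambda>n. e n * z ^ n"] by (simp add: e_def)
    then have "(\<lambda>n. of_real (hits n s) * z ^ n - (e n * z ^ n - a n * z ^ n - b n * z ^ n)) sums
      (H z s - (1 - (1 - z) / (1 - z * of_real v1) * comp_series z s
         - (1 - z) / (1 - z * of_real h0) * sw.comp_series z (prod.swap s)))"
      by (intro sums_diff hits_generating_function z s a(1) b(1) z')
    then show "(\<lambda>n. (of_real (hits n s) - (e n - a n - b n)) * z ^ n) sums 0"
      by (simp only: H_def if_not_P[OF s] left_diff_distrib diff_self)
  qed
  then have eq: "of_real (hits n s) = e n - a n - b n" for n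
    by (rule eq_iff_diff_eq_0[THEN iffD2])
  have "(\<lambda>n. e n / of_real rate ^ n) \<longlonglongrightarrow> 0"
  proof (rule tendsto_eventually)
    show "\<forall>\<^sub>F n in sequentially. e n / of_real rate ^ n = 0"
      using eventually_gt_at_top[of 0] by eventually_elim (simp add: e_def)
  qed
  from tendsto_diff[OF tendsto_diff[OF this a(2)] b(2)]
  have "(\<lambda>n. complex_of_real (hits n s) / of_real rate ^ n) \<longlonglongrightarrow> 0
      - (if v1 = rate then (1 - 1 / of_real rate) * comp_series (1 / of_real rate) s else 0)
      - (if h0 = rate then (1 - 1 / of_real rate) * sw.comp_series (1 / of_real rate) (prod.swap s) else 0)"
    unfolding eq diff_divide_distrib .
  also have "0 - (if v1 = rate then (1 - 1 / of_real rate) * comp_series (1 / of_real rate) s else 0)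
      - (if h0 = rate then (1 - 1 / of_real rate) * sw.comp_series (1 / of_real rate) (prod.swap s) else 0)
    = complex_of_real (lim_const s)"
    using comp_series_of_real[of "1 / rate" s] sw.comp_series_of_real[of "1 / rate" "prod.swap s"]
      rate_poles rate_bounds s s' by (simp add: lim_const_def algebra_simps)
  finally have "(\<lambda>n. complex_of_real (hits n s / rate ^ n)) \<longlonglongrightarrow> complex_of_real (lim_const s)" by simp
  then show ?thesis by (simp only: tendsto_of_real_iff)
qed

text \<open>\<open>hits_ge\<close> passed to the limit. A step from the boundary shifts the index by
  one and thus costs one factor \<open>rate\<close>, which is positive.\<close>

lemma lim_const_step:
  assumes s: "s \<noteq> (0, 0)" and x: "x \<in> set_pmf (law s)" and pos: "0 < lim_const (move s x)"
  shows "0 < lim_const s"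
proof -
  have m: "move s x \<noteq> (0, 0)" using law_nonzero[OF s x] .
  have px: "0 < pmf (law s) x" using x by (simp add: pmf_positive)
  have rp: "0 < rate ^ n" for n using rate_bounds by simp
  have "pmf (law s) x * lim_const (move s x) \<le> (if interior_state s then 1 else rate) * lim_const s"
  proof (cases "interior_state s")
    case True
    have "pmf (law s) x * lim_const (move s x) \<le> lim_const s"
    proof (rule LIMSEQ_le[OF tendsto_mult_left[OF hits_tendsto[OF m]] hits_tendsto[OF s]], intro exI allI impI)
      fix n show "pmf (law s) x * (hits n (move s x) / rate ^ n) \<le> hits n s / rate ^ n"
        using hits_ge(1)[OF True, of x n] rp[of n] by (simp add: divide_right_mono)
    qed
    then show ?thesis using True by simp
  next
    case False
    have "pmf (law s) x * lim_const (move s x) \<le> rate * lim_const s"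
    proof (rule LIMSEQ_le[OF tendsto_mult_left[OF hits_tendsto[OF m]]
          tendsto_mult_left[OF LIMSEQ_Suc[OF hits_tendsto[OF s]]]], intro exI allI impI)
      fix n
      have "rate * (hits (Suc n) s / rate ^ Suc n) = hits (Suc n) s / rate ^ n"
        using rate_bounds by simp
      then show "pmf (law s) x * (hits n (move s x) / rate ^ n) \<le> rate * (hits (Suc n) s / rate ^ Suc n)"
        using hits_ge(2)[OF False, of x n] rp[of n] by (simp add: divide_right_mono)
    qed
    then show ?thesis using False by simp
  qed
  moreover have "0 < pmf (law s) x * lim_const (move s x)" using px pos by simp
  ultimately have "0 < (if interior_state s then 1 else rate) * lim_const s" by linarith
  then show ?thesis using rate_bounds by (auto simp: zero_less_mult_iff split: if_splits)
qed

lemma lim_const_pos_far: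
  obtains K where "\<And>s. K \<le> fst s \<Longrightarrow> K \<le> snd s \<Longrightarrow> 0 < lim_const s"
proof -
  have r0: "0 \<le> 1 / rate" "0 < 1 / rate - 1" using rate_bounds by auto
  obtain K1 where K1: "\<And>s. K1 \<le> fst s \<Longrightarrow> K1 \<le> snd s \<Longrightarrow> 0 < comp_series (1 / rate) s"
    using comp_series_pos[OF r0(1) rate_poles(1)] by blast
  obtain K2 where K2: "\<And>s. K2 \<le> fst s \<Longrightarrow> K2 \<le> snd s \<Longrightarrow> 0 < sw.comp_series (1 / rate) s"
    using sw.comp_series_pos[OF r0(1) rate_poles(2)] by blast
  have act: "v1 = rate \<or> h0 = rate" by (auto simp: rate_def max_def)
  show ?thesis
  proof
    fix s :: "nat \<times> nat" assume "max K1 K2 \<le> fst s" "max K1 K2 \<le> snd s"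
    then have "0 < (1 / rate - 1) * comp_series (1 / rate) s"
      "0 < (1 / rate - 1) * sw.comp_series (1 / rate) (prod.swap s)"
      using K1[of s] K2[of "prod.swap s"] r0(2) by (auto intro!: mult_pos_pos)
    then show "0 < lim_const s" using act by (auto simp: lim_const_def)
  qed
qed

text \<open>Two inductions: steps (1, -1) and (-1, 1) balance an interior state of coordinate sum at
  least 2 K until both coordinates reach K; from any other state, steps that raise the sum lead to
  such a state.\<close>

theorem lim_const_pos:
  assumes "s \<noteq> (0, 0)"
  shows "0 < lim_const s"
proof -
  obtain K where K: "\<And>s. K \<le> fst s \<Longrightarrow> K \<le> snd s \<Longrightarrow> 0 < lim_const s"
    using lim_const_pos_far by blast
  have balanced: "0 < lim_const s" if "interior_state s" "2 * K \<le> fst s + snd s" for s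
    using that
  proof (induction "(K - fst s) + (K - snd s)" arbitrary: s rule: less_induct)
    case less
    have s0: "s \<noteq> (0, 0)" and law: "law s = p" using less.prems by (auto simp: interior_state_def increment_law_def)
    consider "K \<le> fst s" "K \<le> snd s" | "fst s < K" | "snd s < K" by linarith
    then show ?case
    proof cases
      case 1
      then show ?thesis by (rule K)
    next
      case 2
      have m: "move s (1, -1) = (fst s + 1, snd s - 1)" by (auto simp: move_def nat_add_distrib)
      have "0 < lim_const (move s (1, -1))"
        unfolding m using 2 less.prems by (intro less.hyps) (auto simp: interior_state_def)
      then show ?thesis using antidiagonal by (intro lim_const_step[OF s0]) (auto simp: law set_pmf_iff)
    next
      case 3
      have m: "move s (-1, 1) = (fst s - 1, snd s + 1)" by (auto simp: move_def nat_add_distrib)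
      have "0 < lim_const (move s (-1, 1))"
        unfolding m using 3 less.prems by (intro less.hyps) (auto simp: interior_state_def)
      then show ?thesis using antidiagonal by (intro lim_const_step[OF s0]) (auto simp: law set_pmf_iff)
    qed
  qed
  show ?thesis
    using assms
  proof (induction "2 * K - (fst s + snd s)" arbitrary: s rule: less_induct)
    case less
    \<comment> \<open>The disjunction covers boundary states of large sum, where the truncated
      measure is already 0 and cannot drop: their successor is interior, so the first induction
      applies to it.\<close>
    have "\<exists>x\<in>set_pmf (law s). fst s + snd s < fst (move s x) + snd (move s x) \<and> (interior_state s \<or> interior_state (move s x))"
    proof -
      consider "interior_state s" | "0 < fst s" "snd s = 0" | "fst s = 0" "0 < snd s"
        using less.prems by (cases s) (auto simp: interior_state_def)
      then show ?thesis
      proof cases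
        case 1
        then have law: "law s = p" by (auto simp: interior_state_def increment_law_def)
        obtain k l where "0 < k + l" "(k, l) \<in> set_pmf p" using forward by (auto simp: set_pmf_iff)
        with 1 support[of "(k, l)"] show ?thesis
          unfolding law by (intro bexI[of _ "(k, l)"]) (auto simp: move_def interior_state_def)
      next
        case 2
        then have law: "law s = h" by (auto simp: increment_law_def)
        obtain x where "x \<in> set_pmf h" "0 < snd x" using h_up by auto
        with 2 h.supportD[of x] show ?thesis
          unfolding law by (intro bexI[of _ x]) (auto simp: move_def interior_state_def)
      next
        case 3
        then have law: "law s = v" by (auto simp: increment_law_def)
        obtain x where "x \<in> set_pmf v" "0 < fst x" using v_right by auto
        with 3 v.supportD[of x] show ?thesis
          unfolding law by (intro bexI[of _ x]) (auto simp: move_def interior_state_def)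
      qed
    qed
    then obtain x where x: "x \<in> set_pmf (law s)" "fst s + snd s < fst (move s x) + snd (move s x)"
      "interior_state s \<or> interior_state (move s x)" by auto
    show ?case
    proof (cases "interior_state s \<and> 2 * K \<le> fst s + snd s")
      case True
      then show ?thesis using balanced by blast
    next
      case False
      have "0 < lim_const (move s x)"
      proof (cases "interior_state (move s x) \<and> 2 * K \<le> fst (move s x) + snd (move s x)")
        case True
        then show ?thesis using balanced by blast
      next
        case nb: False
        have "2 * K - (fst (move s x) + snd (move s x)) < 2 * K - (fst s + snd s)"
          using False nb x by auto
        then show ?thesis using law_nonzero[OF less.prems x(1)] by (rule less.hyps)
      qed
      then show ?thesis by (rule lim_const_step[OF less.prems x(1)])
    qed
  qed
qed

end

section \<open>Rational coefficients and the walk\<close>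

text \<open>Any representation whose denominator does not vanish at z is accepted, so products can
  be evaluated without computing lowest terms.\<close>

definition rat_val :: "real poly fract \<Rightarrow> real \<Rightarrow> real \<Rightarrow> bool" where
  "rat_val r z x \<longleftrightarrow> (\<exists>a b. r = to_fract a / to_fract b \<and> poly b z \<noteq> 0 \<and> x = poly a z / poly b z)"

text \<open>The reduced denominator divides every other denominator, hence does not vanish at z
  either.\<close>

lemma rat_val_imp_rat_eval:
  assumes "rat_val r z x"
  shows "rat_eval r z = x"
proof -
  obtain a b where ab: "r = to_fract a / to_fract b" "poly b z \<noteq> 0" "x = poly a z / poly b z"
    using assms by (auto simp: rat_val_def)
  define m d where "m = fst (quot_of_fract r)" and "d = snd (quot_of_fract r)"
  have b0: "b \<noteq> 0" using ab by auto
  have d0: "d \<noteq> 0" by (simp add: d_def)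
  have "r = Fract a b" by (simp add: ab Fract_conv_to_fract)
  moreover have "Fract m d = r" by (simp add: m_def d_def)
  ultimately have "Fract m d = Fract a b" by simp
  then have eq: "m * b = a * d" using b0 d0 by (simp add: eq_fract)
  have "d dvd m * b" using eq by simp
  moreover have "coprime d m" using coprime_quot_of_fract[of r] by (simp add: m_def d_def coprime_commute)
  ultimately have "d dvd b" by (simp add: coprime_dvd_mult_right_iff)
  then have dz: "poly d z \<noteq> 0" using ab(2) by (auto elim!: dvdE)
  have "poly m z * poly b z = poly a z * poly d z" using arg_cong[OF eq, of "\<lambda>q. poly q z"] by simp
  then have "poly m z / poly d z = x"
    unfolding ab(3) using dz ab(2) by (simp add: frac_eq_eq)
  then show ?thesis by (simp add: rat_eval_def m_def d_def)
qed

lemma rat_val_1: "rat_val 1 z 1"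
  unfolding rat_val_def by (intro exI[of _ 1]) simp

lemma rat_val_mult: "rat_val r z x \<Longrightarrow> rat_val r' z x' \<Longrightarrow> rat_val (r * r') z (x * x')"
  unfolding rat_val_def
proof (elim exE conjE)
  fix a b a' b'
  assume "r = to_fract a / to_fract b" "poly b z \<noteq> 0" "x = poly a z / poly b z"
    "r' = to_fract a' / to_fract b'" "poly b' z \<noteq> 0" "x' = poly a' z / poly b' z"
  then show "\<exists>a b. r * r' = to_fract a / to_fract b \<and> poly b z \<noteq> 0 \<and> x * x' = poly a z / poly b z"
    by (intro exI[of _ "a * a'"] exI[of _ "b * b'"]) simp
qed

lemma rat_val_uminus: "rat_val r z x \<Longrightarrow> rat_val (- r) z (- x)"
  unfolding rat_val_def
proof (elim exE conjE)
  fix a b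
  assume "r = to_fract a / to_fract b" "poly b z \<noteq> 0" "x = poly a z / poly b z"
  then show "\<exists>a b. - r = to_fract a / to_fract b \<and> poly b z \<noteq> 0 \<and> - x = poly a z / poly b z"
    by (intro exI[of _ "- a"] exI[of _ b]) simp
qed

lemma rat_val_one_minus_z:
  "1 - z * t \<noteq> 0 \<Longrightarrow> rat_val (one_minus_z s / one_minus_z t) z ((1 - z * s) / (1 - z * t))"
  unfolding rat_val_def one_minus_z_def
  by (intro exI[of _ "[:1, - s:]"] exI[of _ "[:1, - t:]"]) simp

lemma v_quot_nonzero: "v_quot p v m \<noteq> 0" and h_quot_nonzero: "h_quot p h m \<noteq> 0"
  by (simp_all add: v_quot_def h_quot_def one_minus_z_nonzero)

context compensation
begin

lemma v_quot_eq: "v_quot p v (int n + 1) =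
    one_minus_z (gen_fun v (xs n) (ys (Suc n))) / one_minus_z (gen_fun v (xs (Suc n)) (ys (Suc n)))"
  unfolding v_quot_def
  using alpha_eq_xs[of n] alpha_eq_xs[of "Suc n"] beta_eq_ys[of "Suc n"] by (simp add: add.commute)

lemma h_quot_eq: "h_quot p h (int n + 1) =
    one_minus_z (gen_fun h (xs n) (ys n)) / one_minus_z (gen_fun h (xs n) (ys (Suc n)))"
  unfolding h_quot_def
  using alpha_eq_xs[of n] beta_eq_ys[of n] beta_eq_ys[of "Suc n"] by (simp add: add.commute)

lemma c_coeff_nat: "c_coeff p h v (int n) = c_fwd p h v n"
  by (simp add: c_coeff_def)

lemma d_coeff_Suc: "d_coeff p h v (int n + 1) = - c_fwd p h v n * v_quot p v (int n)"
  by (simp add: d_coeff_def c_coeff_nat)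

lemma rat_val_h_quot:
  assumes "0 \<le> z" "z * pole_bound < 1"
  shows "rat_val (h_quot p h (int n + 1)) z (h_ratio n z)"
  unfolding h_quot_eq h_ratio_def of_real_eq_id id_apply
  using denominator_nonzero(1)[of z n] assms by (intro rat_val_one_minus_z) simp

lemma rat_val_v_quot:
  assumes "0 \<le> z" "z * pole_bound < 1"
  shows "rat_val (v_quot p v (int n + 1)) z (v_ratio n z)"
  unfolding v_quot_eq v_ratio_def of_real_eq_id id_apply
  using denominator_nonzero(2)[of z n] assms by (intro rat_val_one_minus_z) simp

text \<open>d_1 has a pole at z = 1 / v1, the point of interest. Its factor
  \<open>v_quot p v 0\<close> is cancelled in the fraction field before evaluation, and only ratios
  regular there remain.\<close>

lemma rat_val_dq:
  assumes "0 \<le> z" "z * pole_bound < 1"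
  shows "rat_val (d_coeff p h v (int n + 1) / d_coeff p h v 1) z (dq n z)"
proof -
  have d1: "d_coeff p h v 1 = - v_quot p v 0" using d_coeff_Suc[of 0] by simp
  show ?thesis
  proof (induction n)
    case 0
    show ?case by (simp add: d1 v_quot_nonzero dq_def rat_val_1)
  next
    case (Suc n)
    have d: "d_coeff p h v (int (Suc n) + 1) / d_coeff p h v 1 =
        d_coeff p h v (int n + 1) / d_coeff p h v 1 * (h_quot p h (int n + 1) * v_quot p v (int n + 1))"
      unfolding d_coeff_Suc by (simp add: mult_ac add.commute)
    have q: "dq (Suc n) z = dq n z * (h_ratio n z * v_ratio n z)" by (simp add: dq_def)
    show ?case
      unfolding d q by (intro rat_val_mult Suc rat_val_h_quot rat_val_v_quot assms)
  qed
qed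

lemma rat_val_cq:
  assumes "0 \<le> z" "z * pole_bound < 1"
  shows "rat_val (c_coeff p h v (int n + 1) / d_coeff p h v 1) z (cq n z)"
proof -
  have "c_coeff p h v (int n + 1) = - d_coeff p h v (int n + 1) * h_quot p h (int n + 1)"
    unfolding h_quot_def by (rule coeff_recurrences)
  then have "c_coeff p h v (int n + 1) / d_coeff p h v 1 =
      - (d_coeff p h v (int n + 1) / d_coeff p h v 1) * h_quot p h (int n + 1)" by simp
  then show ?thesis
    unfolding cq_def
    using rat_val_mult[OF rat_val_uminus[OF rat_val_dq[OF assms, of n]] rat_val_h_quot[OF assms, of n]] by simp
qed

lemma S1_eq_comp_series:
  assumes "0 \<le> z" "z * pole_bound < 1"
  shows "S1 p h v i j z = comp_series z (i, j)"
proof -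
  have "beta p (int n + 1) = ys (Suc n)" for n using beta_eq_ys[of "Suc n"] by (simp add: add.commute)
  then show ?thesis
    unfolding S1_def comp_series_def Let_def
    by (simp add: rat_val_imp_rat_eval[OF rat_val_dq[OF assms]] rat_val_imp_rat_eval[OF rat_val_cq[OF assms]]
        alpha_eq_xs beta_eq_ys comp_term_def monom2_def mult.assoc)
qed

end

section \<open>Transposition of the coefficients and comparison of constants\<close>

context walk_data
begin

lemma u_star_swap: "u_star (map_pmf prod.swap p) = v_star p" "v_star (map_pmf prod.swap p) = u_star p"
proof -
  show "u_star (map_pmf prod.swap p) = v_star p" by (simp add: v_star_swap)
  show "v_star (map_pmf prod.swap p) = u_star p"
    using step_law.v_star_swap[OF step_law_swap] by (simp add: pmf.map_comp o_def)
qed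

lemma ab_fwd_swap: "ab_fwd (map_pmf prod.swap p) n = prod.swap (ab_bwd p n)"
  and ab_bwd_swap: "ab_bwd (map_pmf prod.swap p) n = prod.swap (ab_fwd p n)"
  by (induction n) (simp_all add: Let_def u_star_swap)

lemma alpha_swap: "alpha (map_pmf prod.swap p) m = beta p (- m)"
  and beta_swap: "beta (map_pmf prod.swap p) m = alpha p (- m)"
  by (cases "m = 0"; simp add: alpha_def beta_def ab_fwd_swap ab_bwd_swap)+

text \<open>Transposition maps alpha_m to beta_(-m) and reverses the direction of the recurrence,
  hence the reciprocal.\<close>

lemma v_quot_swap: "v_quot (map_pmf prod.swap p) (map_pmf prod.swap h) m = 1 / h_quot p h (- m)"
  by (simp add: v_quot_def h_quot_def alpha_swap beta_swap h.gen_fun_swap)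

lemma h_quot_swap: "h_quot (map_pmf prod.swap p) (map_pmf prod.swap v) m = 1 / v_quot p v (- m)"
  by (simp add: v_quot_def h_quot_def alpha_swap beta_swap v.gen_fun_swap)

lemma c_fwd_swap: "c_fwd (map_pmf prod.swap p) (map_pmf prod.swap v) (map_pmf prod.swap h) n = c_bwd p h v n"
  by (induction n) (simp_all add: v_quot_swap h_quot_swap mult.commute)

lemma c_bwd_swap: "c_bwd (map_pmf prod.swap p) (map_pmf prod.swap v) (map_pmf prod.swap h) n = c_fwd p h v n"
  by (induction n) (simp_all add: v_quot_swap h_quot_swap mult_ac add.commute)

lemma c_coeff_swap:
  "c_coeff (map_pmf prod.swap p) (map_pmf prod.swap v) (map_pmf prod.swap h) m = c_coeff p h v (- m)"
  by (cases "m = 0") (simp_all add: c_coeff_def c_fwd_swap c_bwd_swap)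

text \<open>d_m belongs to the point (alpha_m, beta_(m-1)), whose transpose carries the index 1 - m;
  for c_m it is - m.\<close>

lemma d_coeff_swap:
  "d_coeff (map_pmf prod.swap p) (map_pmf prod.swap v) (map_pmf prod.swap h) m = d_coeff p h v (1 - m)"
proof -
  have "c_coeff p h v (1 - m) = - d_coeff p h v (1 - m) * h_quot p h (1 - m)"
    unfolding h_quot_def by (rule coeff_recurrences)
  then show ?thesis
    unfolding d_coeff_def[of "map_pmf prod.swap p"]
    using h_quot_nonzero[of p h "1 - m"] by (simp add: c_coeff_swap v_quot_swap)
qed

lemma S0_swap:
  "S0 p h v i j z = S1 (map_pmf prod.swap p) (map_pmf prod.swap v) (map_pmf prod.swap h) j i z"
proof -
  have "- int n - 1 = - 1 - int n" for n by simp
  then show ?thesis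
    unfolding S0_def S1_def Let_def
    by (simp add: c_coeff_swap d_coeff_swap alpha_swap beta_swap mult_ac)
qed

lemma S0_eq_comp_series:
  assumes "0 \<le> z" "z * sw.pole_bound < 1"
  shows "S0 p h v i j z = sw.comp_series z (j, i)"
  unfolding S0_swap by (rule sw.S1_eq_comp_series[OF assms])

lemma v_tilde_1_eq: "v_tilde_1 p v = v1"
  using alpha_eq_xs[of 0] by (simp add: v_tilde_1_def v1_def alpha_beta_0)

lemma h_tilde_0_eq: "h_tilde_0 p h = h0"
  using alpha_beta_neg(1)[of "-1" p] by (simp add: h_tilde_0_def h0_def alpha_beta_0)

lemma C_const_eq: "C_const p h v i j = lim_const (i, j)"
proof -
  have r: "0 \<le> 1 / rate" using rate_bounds by simp
  show ?thesis
    using S1_eq_comp_series[OF r rate_poles(1), of i j] S0_eq_comp_series[OF r rate_poles(2), of i j]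
    by (auto simp: C_const_def Let_def v_tilde_1_eq h_tilde_0_eq lim_const_def rate_def max_def algebra_simps)
qed

lemma move_eq_iff:
  assumes "x \<in> set_pmf (law s)"
  shows "move s x = t \<longleftrightarrow> x = displacement s t"
proof -
  have "0 \<le> int (fst s) + fst x" "0 \<le> int (snd s) + snd x"
    using assms support[of x] h.supportD[of x] v.supportD[of x] q.supportD[of x]
    by (auto simp: increment_law_def split: if_splits)
  then show ?thesis
    by (cases s; cases t; cases x) (auto simp: move_def displacement_def)
qed

lemma pmf_cstep:
  "pmf (cstep a) b =
    (if fst b = fst a + (if interior_state (snd a) then 0 else 1)
     then pmf (law (snd a)) (displacement (snd a) (snd b)) else 0)"
proof (cases "fst b = fst a + (if interior_state (snd a) then 0 else 1)")
  case True
  let ?A = "{x. move (snd a) x = snd b}"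
  have "pmf (cstep a) b = measure (law (snd a)) ?A"
    unfolding cstep_def pmf_map vimage_def using True
    by (intro arg_cong[where f = "measure _"]) (auto simp: prod_eq_iff)
  also have "\<dots> = measure (law (snd a)) (?A \<inter> set_pmf (law (snd a)))"
    by (rule measure_Int_set_pmf[symmetric])
  also have "?A \<inter> set_pmf (law (snd a)) = {displacement (snd a) (snd b)} \<inter> set_pmf (law (snd a))"
    using move_eq_iff[of _ "snd a" "snd b"] by blast
  also have "measure (law (snd a)) \<dots> = pmf (law (snd a)) (displacement (snd a) (snd b))"
    by (simp only: measure_Int_set_pmf measure_pmf_single)
  finally show ?thesis using True by simp
next
  case False
  then have "b \<notin> set_pmf (cstep a)" by (auto simp: cstep_def)
  with False show ?thesis by (simp add: set_pmf_iff)
qed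

end

section \<open>From the counting chain to the given process\<close>

locale reflected_walk_process = walk_data p h v q + prob_space M
  for p h v q and M :: "'w measure" +
  fixes x :: "nat \<times> nat" and S :: "nat \<Rightarrow> 'w \<Rightarrow> nat \<times> nat"
  assumes walk: "reflected_walk p h v q M x S"
begin

lemma S_measurable [measurable]: "S n \<in> measurable M (count_space UNIV)"
  and S_0: "\<omega> \<in> space M \<Longrightarrow> S 0 \<omega> = x"
  and S_step: "\<P>(\<omega> in M. \<forall>k\<le>n. S k \<omega> = s k) > 0 \<Longrightarrow>
       \<P>(\<omega> in M. displacement (S n \<omega>) (S (Suc n) \<omega>) = e \<bar> \<forall>k\<le>n. S k \<omega> = s k) = pmf (law (s n)) e"
  using walk unfolding reflected_walk_def by blast+

text \<open>Contacts strictly before time t, the convention of the counting chain.\<close>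

definition past :: "nat \<Rightarrow> 'w \<Rightarrow> nat" where
  "past t \<omega> = (\<Sum>k<t. if interior_state (S k \<omega>) then 0 else 1)"

text \<open>\<open>reflected_walk\<close> conditions on complete histories; as lists of fixed length
  they form a countable set over which events can be split.\<close>

definition hist :: "nat \<Rightarrow> 'w \<Rightarrow> (nat \<times> nat) list" where
  "hist t \<omega> = map (\<lambda>k. S k \<omega>) [0..<Suc t]"

lemma hist_eq_iff: "length hs = Suc t \<Longrightarrow> hist t \<omega> = hs \<longleftrightarrow> (\<forall>k\<le>t. S k \<omega> = hs ! k)"
  by (auto simp: hist_def list_eq_iff_nth_eq less_Suc_eq_le simp del: upt_Suc)

lemma past_measurable [measurable]: "past t \<in> measurable M (count_space UNIV)"
  unfolding past_def[abs_def] by measurable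

lemma event_measurable:
  "{\<omega> \<in> space M. P (past t \<omega>) (S n \<omega>) (S m \<omega>)} \<in> sets M"
proof -
  have "(\<lambda>\<omega>. (past t \<omega>, S n \<omega>, S m \<omega>)) \<in> measurable M (count_space UNIV \<Otimes>\<^sub>M count_space UNIV \<Otimes>\<^sub>M count_space UNIV)"
    by measurable
  moreover have "count_space UNIV \<Otimes>\<^sub>M count_space UNIV \<Otimes>\<^sub>M count_space UNIV =
      (count_space UNIV :: (nat \<times> (nat \<times> nat) \<times> nat \<times> nat) measure)"
    by (simp add: pair_measure_countable)
  ultimately have "(\<lambda>\<omega>. (past t \<omega>, S n \<omega>, S m \<omega>)) \<in> measurable M (count_space UNIV)" by simp
  from measurable_sets[OF this, of "{(a, b, c). P a b c}"]
  show ?thesis by (simp add: vimage_def Int_def conj_commute)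
qed

lemma hist_event_measurable:
  "{\<omega> \<in> space M. hist t \<omega> = hs \<and> P (past n \<omega>) (S t \<omega>) (S m \<omega>)} \<in> sets M"
proof -
  have "{\<omega> \<in> space M. hist t \<omega> = hs} \<in> sets M"
  proof (cases "length hs = Suc t")
    case True
    show ?thesis unfolding hist_eq_iff[OF True] by measurable
  next
    case False
    then have "{\<omega> \<in> space M. hist t \<omega> = hs} = {}" by (auto simp: hist_def)
    then show ?thesis by (simp only: sets.empty_sets)
  qed
  from sets.Int[OF this event_measurable[of P n t m]] show ?thesis
    by (simp add: Int_def conj_ac)
qed

lemma prob_hist_step:
  assumes len: "length hs = Suc t"
  shows "prob {\<omega> \<in> space M. hist t \<omega> = hs \<and> displacement (S t \<omega>) (S (Suc t) \<omega>) = e}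
    = prob {\<omega> \<in> space M. hist t \<omega> = hs} * pmf (law (last hs)) e"
proof (cases "prob {\<omega> \<in> space M. hist t \<omega> = hs} = 0")
  case True
  have "prob {\<omega> \<in> space M. hist t \<omega> = hs \<and> displacement (S t \<omega>) (S (Suc t) \<omega>) = e}
      \<le> prob {\<omega> \<in> space M. hist t \<omega> = hs}"
    using hist_event_measurable[of t hs "\<lambda>_ _ _. True" 0 0] by (intro finite_measure_mono) auto
  with True show ?thesis by (simp add: measure_le_0_iff)
next
  case False
  then have "0 < prob {\<omega> \<in> space M. hist t \<omega> = hs}" by (simp add: zero_less_measure_iff)
  then have pos: "0 < prob {\<omega> \<in> space M. \<forall>k\<le>t. S k \<omega> = hs ! k}" unfolding hist_eq_iff[OF len] .
  have "last hs = hs ! t" using len by (subst last_conv_nth) auto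
  then show ?thesis
    using S_step[OF pos, of e] pos unfolding hist_eq_iff[OF len] cond_prob_def
    by (simp add: field_simps conj_commute)
qed

text \<open>Count and position are functions of the history, and the law of the next jump depends
  only on the position. Summing \<open>prob_hist_step\<close> over the countably many compatible
  histories gives the claim.\<close>

lemma prob_step:
  "prob {\<omega> \<in> space M. (past t \<omega>, S t \<omega>) = a \<and> displacement (S t \<omega>) (S (Suc t) \<omega>) = e}
    = prob {\<omega> \<in> space M. (past t \<omega>, S t \<omega>) = a} * pmf (law (snd a)) e"
proof -
  define L where "L = {hs. length hs = Suc t \<and> (\<Sum>k<t. if interior_state (hs ! k) then 0 else 1) = fst a \<and> last hs = snd a}"
  have inL: "hist t \<omega> \<in> L \<longleftrightarrow> (past t \<omega>, S t \<omega>) = a" for \<omega>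
    by (auto simp: L_def hist_def past_def prod_eq_iff last_map simp del: upt_Suc)
  have lenL: "length hs = Suc t" "last hs = snd a" if "hs \<in> L" for hs using that by (auto simp: L_def)
  have split: "emeasure M {\<omega> \<in> space M. (past t \<omega>, S t \<omega>) = a \<and> P (S t \<omega>) (S (Suc t) \<omega>)} =
      (\<integral>\<^sup>+hs. emeasure M {\<omega> \<in> space M. hist t \<omega> = hs \<and> P (S t \<omega>) (S (Suc t) \<omega>)} \<partial>count_space L)" for P
  proof -
    have "{\<omega> \<in> space M. (past t \<omega>, S t \<omega>) = a \<and> P (S t \<omega>) (S (Suc t) \<omega>)} =
        (\<Union>hs\<in>L. {\<omega> \<in> space M. hist t \<omega> = hs \<and> P (S t \<omega>) (S (Suc t) \<omega>)})"
      using inL by auto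
    moreover have "emeasure M (\<Union>hs\<in>L. {\<omega> \<in> space M. hist t \<omega> = hs \<and> P (S t \<omega>) (S (Suc t) \<omega>)}) =
        (\<integral>\<^sup>+hs. emeasure M {\<omega> \<in> space M. hist t \<omega> = hs \<and> P (S t \<omega>) (S (Suc t) \<omega>)} \<partial>count_space L)"
      using hist_event_measurable[of t _ "\<lambda>_. P" 0 "Suc t"]
      by (intro emeasure_UN_countable) (auto simp: disjoint_family_on_def)
    ultimately show ?thesis by simp
  qed
  have "emeasure M {\<omega> \<in> space M. (past t \<omega>, S t \<omega>) = a \<and> displacement (S t \<omega>) (S (Suc t) \<omega>) = e} =
     (\<integral>\<^sup>+hs. emeasure M {\<omega> \<in> space M. hist t \<omega> = hs \<and> True} * ennreal (pmf (law (snd a)) e) \<partial>count_space L)"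
    unfolding split[of "\<lambda>s s'. displacement s s' = e"]
  proof (rule nn_integral_cong)
    fix hs assume "hs \<in> space (count_space L)"
    then show "emeasure M {\<omega> \<in> space M. hist t \<omega> = hs \<and> displacement (S t \<omega>) (S (Suc t) \<omega>) = e} =
        emeasure M {\<omega> \<in> space M. hist t \<omega> = hs \<and> True} * ennreal (pmf (law (snd a)) e)"
      using prob_hist_step[of hs t e] lenL[of hs] by (simp add: emeasure_eq_measure ennreal_mult)
  qed
  also have "\<dots> = emeasure M {\<omega> \<in> space M. (past t \<omega>, S t \<omega>) = a \<and> True} * ennreal (pmf (law (snd a)) e)"
    unfolding split[of "\<lambda>_ _. True"] by (rule nn_integral_multc) simp
  finally show ?thesis
    by (simp add: emeasure_eq_measure flip: ennreal_mult)
qed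

lemma past_Suc: "past (Suc t) \<omega> = past t \<omega> + (if interior_state (S t \<omega>) then 0 else 1)"
  by (simp add: past_def)

text \<open>Splitting by the state at time t gives the same recursion as
  \<open>chain_Suc\<close>.\<close>

lemma prob_state: "prob {\<omega> \<in> space M. (past t \<omega>, S t \<omega>) = b} = pmf (chain t (0, x)) b"
proof (induction t arbitrary: b)
  case 0
  have "{\<omega> \<in> space M. (past 0 \<omega>, S 0 \<omega>) = b} = (if b = (0, x) then space M else {})"
    using S_0 by (auto simp: past_def)
  then show ?case by (simp add: prob_space indicator_def)
next
  case (Suc t)
  let ?E = "\<lambda>a. {\<omega> \<in> space M. (past t \<omega>, S t \<omega>) = a \<and> (past (Suc t) \<omega>, S (Suc t) \<omega>) = b}"
  have trans: "prob (?E a) = pmf (chain t (0, x)) a * pmf (cstep a) b" for a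
  proof (cases "fst b = fst a + (if interior_state (snd a) then 0 else 1)")
    case True
    have "?E a = {\<omega> \<in> space M. (past t \<omega>, S t \<omega>) = a \<and> displacement (S t \<omega>) (S (Suc t) \<omega>) = displacement (snd a) (snd b)}"
      using True by (cases a; cases b) (auto simp: past_Suc displacement_def intro: prod_eqI)
    then show ?thesis using prob_step[of t a "displacement (snd a) (snd b)"] True by (simp add: pmf_cstep Suc)
  next
    case False
    then have "?E a = {}" by (auto simp: past_Suc)
    then show ?thesis using False by (simp only: pmf_cstep) simp
  qed
  have "emeasure M {\<omega> \<in> space M. (past (Suc t) \<omega>, S (Suc t) \<omega>) = b} = emeasure M (\<Union>a\<in>UNIV. ?E a)"
    by (rule arg_cong[where f = "emeasure M"]) auto
  also have "\<dots> = (\<integral>\<^sup>+a. emeasure M (?E a) \<partial>count_space UNIV)"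
  proof (rule emeasure_UN_countable)
    show "?E a \<in> sets M" for a
      using event_measurable[of "\<lambda>m s s'. (m, s) = a \<and> (m + (if interior_state s then 0 else 1), s') = b" t t "Suc t"]
      by (simp add: past_Suc)
  qed (auto simp: disjoint_family_on_def)
  also have "\<dots> = (\<integral>\<^sup>+a. ennreal (pmf (chain t (0, x)) a) * ennreal (pmf (cstep a) b) \<partial>count_space UNIV)"
    using trans by (intro nn_integral_cong) (simp add: emeasure_eq_measure ennreal_mult)
  also have "\<dots> = ennreal (pmf (chain (Suc t) (0, x)) b)"
    unfolding chain_Suc ennreal_pmf_bind nn_integral_measure_pmf ..
  finally show ?case by (simp add: emeasure_eq_measure)
qed

lemma prob_past: "prob {\<omega> \<in> space M. past t \<omega> = n} = cnt t x n"
proof -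
  let ?X = "\<lambda>\<omega>. (past t \<omega>, S t \<omega>)"
  have X: "?X \<in> measurable M (count_space UNIV)"
  proof -
    have "?X \<in> measurable M (count_space UNIV \<Otimes>\<^sub>M count_space UNIV)" by measurable
    then show ?thesis by (simp add: pair_measure_countable)
  qed
  have "distr M (count_space UNIV) ?X = measure_pmf (chain t (0, x))"
  proof (rule measure_eqI_countable)
    fix b
    show "emeasure (distr M (count_space UNIV) ?X) {b} = emeasure (measure_pmf (chain t (0, x))) {b}"
      using prob_state[of t b] X
      by (simp add: emeasure_distr emeasure_pmf_single vimage_def Int_def conj_commute emeasure_eq_measure)
  qed auto
  then have "measure (distr M (count_space UNIV) ?X) {b. fst b = n} = measure (chain t (0, x)) {b. fst b = n}"
    by simp
  then show ?thesis
    using X by (simp add: measure_distr vimage_def Int_def conj_commute cnt_def pmf_map)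
qed

lemma past_tendsto_contacts: "(\<lambda>t. of_nat (past t \<omega>) :: ennreal) \<longlonglongrightarrow> boundary_contacts S \<omega>"
proof -
  have "of_nat (past t \<omega>) = (\<Sum>k<t. indicator (UNIV - {0<..} \<times> {0<..}) (S k \<omega>) :: ennreal)" for t
    by (induction t) (auto simp: past_def interior_state_def indicator_def mem_Times_iff add.commute)
  then show ?thesis
    unfolding boundary_contacts_def by (simp add: summable_LIMSEQ)
qed

lemma past_mono: "t \<le> t' \<Longrightarrow> past t \<omega> \<le> past t' \<omega>"
  unfolding past_def by (rule sum_mono2) auto

text \<open>The count is a nondecreasing sequence of naturals: either it becomes constant, at the
  total number of contacts, or it eventually exceeds n. The second case includes infinitely many
  contacts.\<close>

lemma eventually_past_iff: "\<forall>\<^sub>F t in sequentially. (past t \<omega> = n) = (boundary_contacts S \<omega> = of_nat n)"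
proof (cases "\<exists>t0. \<forall>t\<ge>t0. past t \<omega> = past t0 \<omega>")
  case True
  then obtain t0 where t0: "\<And>t. t0 \<le> t \<Longrightarrow> past t \<omega> = past t0 \<omega>" by auto
  then have ev: "\<forall>\<^sub>F t in sequentially. past t \<omega> = past t0 \<omega>"
    unfolding eventually_sequentially by blast
  then have "\<forall>\<^sub>F t in sequentially. (of_nat (past t \<omega>) :: ennreal) = of_nat (past t0 \<omega>)"
    by eventually_elim simp
  then have "(\<lambda>t. of_nat (past t \<omega>) :: ennreal) \<longlonglongrightarrow> of_nat (past t0 \<omega>)"
    by (rule tendsto_eventually)
  then have "boundary_contacts S \<omega> = of_nat (past t0 \<omega>)"
    using past_tendsto_contacts LIMSEQ_unique by blast
  with ev show ?thesis by (auto elim: eventually_mono)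
next
  case False
  have "\<exists>t. n < past t \<omega>" for n
  proof (induction n)
    case 0
    have "past 0 \<omega> = 0" by (simp add: past_def)
    moreover obtain t where "past t \<omega> \<noteq> past 0 \<omega>" using False by blast
    ultimately show ?case by (intro exI[of _ t]) simp
  next
    case (Suc n)
    then obtain t where t: "n < past t \<omega>" by auto
    obtain t' where "t \<le> t'" "past t' \<omega> \<noteq> past t \<omega>" using False by blast
    then have "past t \<omega> < past t' \<omega>" using past_mono[of t t' \<omega>] by simp
    with t show ?case by (intro exI[of _ t']) simp
  qed
  then obtain t where t: "n < past t \<omega>" by blast
  then have gt: "n < past t' \<omega>" if "t \<le> t'" for t' using past_mono[OF that, of \<omega>] by simp
  have "of_nat (Suc n) \<le> boundary_contacts S \<omega>"
  proof (rule LIMSEQ_le_const[OF past_tendsto_contacts], intro exI allI impI)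
    fix t' assume "t \<le> t'"
    then have "Suc n \<le> past t' \<omega>" using gt by (simp add: Suc_leI)
    then show "of_nat (Suc n) \<le> (of_nat (past t' \<omega>) :: ennreal)" by (rule of_nat_mono)
  qed
  moreover have "(of_nat n :: ennreal) < of_nat (Suc n)" by (simp only: of_nat_less_iff)
  ultimately have "boundary_contacts S \<omega> \<noteq> of_nat n" by auto
  with gt show ?thesis by (auto simp: eventually_sequentially intro!: exI[of _ t])
qed

text \<open>The indicators of a count n at time t are eventually constant pointwise, so dominated
  convergence identifies the limit of \<open>cnt\<close> with the probability.\<close>

lemma prob_contacts: "prob {\<omega> \<in> space M. boundary_contacts S \<omega> = of_nat n} = hits n x"
proof -
  have meas: "{\<omega> \<in> space M. boundary_contacts S \<omega> = of_nat n} \<in> sets M"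
  proof -
    have "(\<lambda>\<omega>. indicator (UNIV - {0<..} \<times> {0<..}) (S k \<omega>) :: ennreal) \<in> borel_measurable M" for k
      by (rule measurable_compose[OF S_measurable]) simp
    then have "boundary_contacts S \<in> borel_measurable M"
      unfolding boundary_contacts_def[abs_def] by (rule borel_measurable_suminf_order)
    then show ?thesis by measurable
  qed
  have past_meas: "{\<omega> \<in> space M. past t \<omega> = n} \<in> sets M" for t by measurable
  have "(\<lambda>t. integral\<^sup>L M (indicator {\<omega> \<in> space M. past t \<omega> = n} :: _ \<Rightarrow> real)) \<longlonglongrightarrow>
      integral\<^sup>L M (indicator {\<omega> \<in> space M. boundary_contacts S \<omega> = of_nat n})"
  proof (rule integral_dominated_convergence[where w = "\<lambda>_. 1"])
    show "AE \<omega> in M. (\<lambda>t. indicator {\<omega> \<in> space M. past t \<omega> = n} \<omega> :: real) \<longlonglongrightarrow>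
        indicator {\<omega> \<in> space M. boundary_contacts S \<omega> = of_nat n} \<omega>"
    proof (intro AE_I2 tendsto_eventually)
      fix \<omega>
      show "\<forall>\<^sub>F t in sequentially. (indicator {\<omega> \<in> space M. past t \<omega> = n} \<omega> :: real) =
          indicator {\<omega> \<in> space M. boundary_contacts S \<omega> = of_nat n} \<omega>"
        using eventually_past_iff[of \<omega> n] by eventually_elim (simp add: indicator_def)
    qed
  qed (use meas past_meas in auto)
  then have "(\<lambda>t. cnt t x n) \<longlonglongrightarrow> prob {\<omega> \<in> space M. boundary_contacts S \<omega> = of_nat n}"
    using meas past_meas by (simp add: prob_past)
  then show ?thesis using cnt_tendsto LIMSEQ_unique by blast
qed

end

lemma (in singular_reflected_data) walk_data: "walk_data p h v q"
proof -
  interpret step_law p by (rule step_law)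
  have refl: "reflection_law w" if "w \<in> {h, v, q}" for w
    by unfold_locales (use reflection_support[OF that] in blast)
  interpret h: reflection_law h by (rule refl) simp
  interpret v: reflection_law v by (rule refl) simp
  interpret q: reflection_law q by (rule refl) simp
  have "\<exists>x\<in>set_pmf h. 0 < snd x"
  proof (rule ccontr)
    assume "\<not> (\<exists>x\<in>set_pmf h. 0 < snd x)"
    then have "snd x = 0" if "x \<in> set_pmf h" for x using h.supportD[OF that] that by force
    then have "measure_pmf.expectation h (\<lambda>x. real_of_int (snd x)) = measure_pmf.expectation h (\<lambda>_. 0)"
      by (intro integral_cong_AE) (auto simp: AE_measure_pmf_iff)
    then show False
      using h_drift case_prod_pmf_times[of "\<lambda>x. real_of_int (snd x)" h] by (simp add: infsum_pmf_times)
  qed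
  moreover have "\<exists>x\<in>set_pmf v. 0 < fst x"
  proof (rule ccontr)
    assume "\<not> (\<exists>x\<in>set_pmf v. 0 < fst x)"
    then have "fst x = 0" if "x \<in> set_pmf v" for x using v.supportD[OF that] that by force
    then have "measure_pmf.expectation v (\<lambda>x. real_of_int (fst x)) = measure_pmf.expectation v (\<lambda>_. 0)"
      by (intro integral_cong_AE) (auto simp: AE_measure_pmf_iff)
    then show False
      using v_drift case_prod_pmf_times[of "\<lambda>x. real_of_int (fst x)" v] by (simp add: infsum_pmf_times)
  qed
  ultimately show ?thesis by unfold_locales
qed

theorem proposition16:
  fixes p h v q :: weights
    and M :: "'w measure"
    and S :: "nat \<Rightarrow> 'w \<Rightarrow> nat \<times> nat"
    and i j :: nat
  assumes "singular_reflected_data p h v q"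
    and "(i, j) \<noteq> (0, 0)"
    and "reflected_walk p h v q M (i, j) S"
  shows "(\<lambda>n::nat. \<P>(\<omega> in M. boundary_contacts S \<omega> = of_nat n))
           \<sim>[at_top] (\<lambda>n. C_const p h v i j * max (v_tilde_1 p v) (h_tilde_0 p h) ^ n)"
proof -
  interpret walk_data p h v q by (rule singular_reflected_data.walk_data[OF assms(1)])
  interpret prob_space M using assms(3) by (simp add: reflected_walk_def)
  interpret reflected_walk_process p h v q M "(i, j)" S by unfold_locales (rule assms(3))
  \<comment> \<open>Positivity of the limit is what upgrades convergence of the normalised sequence
    to asymptotic equivalence.\<close>
  have "(\<lambda>n. hits n (i, j)) \<sim>[at_top] (\<lambda>n. lim_const (i, j) * rate ^ n)"
    using hits_tendsto[OF assms(2)] lim_const_pos[OF assms(2)] by (intro asymp_equivI'_const) auto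
  then show ?thesis
    by (simp add: prob_contacts C_const_eq rate_def v_tilde_1_eq h_tilde_0_eq)
qed

end
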